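(* Let $N,n\ge1$ be integers, $1\le p\le\infty$, $0<\alpha<n$. Then $\Lambda^{p}_\alpha(\mathbb B_N)\subset H^p(\mathbb B_N)$. For a function $f\in H^p(\mathbb B_N)$ the following conditions are equivalent: $(\mathcal R)$ $f\in\Lambda^{p}_\alpha(\mathbb B_N)$; $(\Delta)$ $\|\Delta^n_tf\|_p=\mathcal O(t^\alpha)$, $0<t<1$; $(\omega^-)$ $\omega^-_n(\delta,f)_p=\mathcal O(\delta^\alpha)$, $0<\delta<1$; $(\omega)$ $\omega_n(\delta,f)_p=\mathcal O(\delta^\alpha)$, $0<\delta<1$; $(\omega^+)$ $\omega^+_n(\delta,f)_p=\mathcal O(\delta^\alpha)$, $0<\delta<1$.
   Context: $\mathbb B_N$ is the unit ball of $\mathbb C^N$, $\mathbb S_N=\partial\mathbb B_N$, $\sigma$ is the normalized Lebesgue measure on $\mathbb S_N$, and $H(\mathbb B_N)$ is the space of holomorphic functions on $\mathbb B_N$. For a Borel function $g$ on $\mathbb B_N$ and $0<r<1$, $M_p(r,g)=\left(\int_{\mathbb S_N}|g(r\zeta)|^p\,d\sigma(\zeta)\right)^{1/p}$ for $p<\infty$ and $M_\infty(r,g)=\operatorname{ess\,sup}_{\zeta\in\mathbb S_N}|g(r\zeta)|$. $H^p(\mathbb B_N)$ is the space of $f\in H(\mathbb B_N)$ with $\|f\|_p:=\sup_{0<r<1}M_p(r,f)<\infty$. If $f\in H(\mathbb B_N)$ has homogeneous expansion $f=\sum_{k\ge0}f_k$, then $\mathcal R^sf=\sum_{k\ge1}k^sf_k$.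 The Lipschitz space $\Lambda^{p}_\alpha(\mathbb B_N)=\Lambda^{p,\infty}_\alpha(\mathbb B_N)$ consists of those $f\in H(\mathbb B_N)$ with $\sup_{0\le r<1}(1-r^2)^{s-\alpha}M_p(r,\mathcal R^sf)<\infty$, where $s$ is the smallest integer greater than $\alpha$. Differences: for $t\in\mathbb R$, $\Delta^1_tf(z)=f(e^{it}z)-f(z)$ and $\Delta^n_tf=\Delta^1_t(\Delta^{n-1}_tf)$ for $n\ge2$. For a linear operator $U$ mapping $\mathbb B_N$ to $\mathbb B_N$, $\Delta^1_Uf(z)=f(Uz)-f(z)$ and $\Delta^n_Uf=\Delta^1_U(\Delta^{n-1}_Uf)$ for $n\ge2$. Let $\mathcal U$ be the group of unitary transformations of $\mathbb C^N$, $\mathcal L$ the semigroup of all linear operators from $\mathbb B_N$ to $\mathbb B_N$, and $I$ the identity. The moduli of continuity are $$\omega_n(\delta,f)_p=\sup_{\|U-I\|<\delta,\,U\in\mathcal U}\|\Delta^n_Uf\|_p,\quad \omega^-_n(\delta,f)_p=\sup_{|t|<\delta}\|\Delta^n_tf\|_p,\quad \omega^+_n(\delta,f)_p=\sup_{\|U-I\|<\delta,\,U\in\mathcal L}\|\Delta^n_Uf\|_p.$$ *)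

theory Defs
  imports "HOL-Analysis.Analysis" "HOL-Probability.Essential_Supremum"
begin

text \<open>
  \<open>\<complex>\<^sup>N\<close> is \<^typ>\<open>complex ^ 'n\<close> with \<open>N = CARD('n)\<close>. Functions on the unit ball are
  total functions whose values outside \<^term>\<open>ball (0 :: complex ^ 'n) 1\<close> are never
  inspected by the notions below.
\<close>

definition clinear_op :: "(complex ^ 'n \<Rightarrow> complex ^ 'n) \<Rightarrow> bool"
  where "clinear_op U \<longleftrightarrow> Vector_Spaces.linear (*s) (*s) U"

definition hprod :: "complex ^ 'n \<Rightarrow> complex ^ 'n \<Rightarrow> complex"
  where "hprod z w = (\<Sum>i\<in>UNIV. z $ i * cnj (w $ i))"

definition unitary_ops :: "(complex ^ 'n \<Rightarrow> complex ^ 'n) set"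
  where "unitary_ops = {U. clinear_op U \<and> surj U \<and> (\<forall>z w. hprod (U z) (U w) = hprod z w)}"

definition ball_ops :: "(complex ^ 'n \<Rightarrow> complex ^ 'n) set"
  where "ball_ops = {U. clinear_op U \<and> U ` ball 0 1 \<subseteq> ball 0 1}"


definition holo_ball :: "(complex ^ 'n \<Rightarrow> complex) set"
  where "holo_ball = {f. \<forall>z\<in>ball 0 1. \<exists>D. (f has_derivative D) (at z) \<and>
                                          (\<forall>c v. D (c *s v) = c * D v)}"

definition homogeneous_poly :: "nat \<Rightarrow> (complex ^ 'n \<Rightarrow> complex) \<Rightarrow> bool"
  where "homogeneous_poly k P \<longleftrightarrow>
    (\<exists>c :: ('n \<Rightarrow> nat) \<Rightarrow> complex. \<forall>z.
       P z = (\<Sum>a\<in>{a. (\<Sum>i\<in>UNIV. a i) = k}. c a * (\<Prod>i\<in>UNIV. (z $ i) ^ a i)))"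

definition homogeneous_expansion ::
    "(complex ^ 'n \<Rightarrow> complex) \<Rightarrow> (nat \<Rightarrow> complex ^ 'n \<Rightarrow> complex) \<Rightarrow> bool"
  where "homogeneous_expansion f F \<longleftrightarrow>
    (\<forall>k. homogeneous_poly k (F k)) \<and> (\<forall>z\<in>ball 0 1. (\<lambda>k. F k z) sums f z)"

text \<open>
  The expansion is unique, since \<open>F k z\<close> is the \<open>k\<close>-th coefficient of the power
  series of \<open>f (\<lambda>z)\<close> in \<open>\<lambda>\<close>; it exists for every \<open>f\<close> in \<^const>\<open>holo_ball\<close>.
\<close>

definition hom_part :: "(complex ^ 'n \<Rightarrow> complex) \<Rightarrow> nat \<Rightarrow> complex ^ 'n \<Rightarrow> complex"
  where "hom_part f = (THE F. homogeneous_expansion f F)"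

definition radial_deriv :: "real \<Rightarrow> (complex ^ 'n \<Rightarrow> complex) \<Rightarrow> complex ^ 'n \<Rightarrow> complex"
  where "radial_deriv s f z = (\<Sum>k. of_real (real (Suc k) powr s) * hom_part f (Suc k) z)"


text \<open>
  The normalized Lebesgue measure on the sphere, given by polar coordinates:
  \<open>\<sigma> A\<close> is the normalized volume of the cone \<open>{r \<zeta> | 0 < r < 1, \<zeta> \<in> A}\<close>. The origin
  is a null set. The underlying space is the sphere itself, so
  that measurability of \<open>\<lambda>\<zeta>. g (r \<zeta>)\<close> only concerns values of \<open>g\<close> in the ball.
\<close>

definition sphere_measure :: "(complex ^ 'n) measure"
  where "sphere_measure =
    restrict_space (distr (uniform_measure lborel (ball 0 1)) borel (\<lambda>z. z /\<^sub>R norm z))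
      (sphere 0 1)"

definition pmean :: "ennreal \<Rightarrow> real \<Rightarrow> (complex ^ 'n \<Rightarrow> complex) \<Rightarrow> ennreal"
  where "pmean p r g =
    (if p = \<infinity> then esssup sphere_measure (\<lambda>\<zeta>. ennreal (norm (g (r *\<^sub>R \<zeta>))))
     else let q = enn2real p;
              J = \<integral>\<^sup>+ \<zeta>. ennreal (norm (g (r *\<^sub>R \<zeta>)) powr q) \<partial>sphere_measure
          in if J = \<infinity> then \<infinity> else ennreal (enn2real J powr (1 / q)))"

definition hardy_norm :: "ennreal \<Rightarrow> (complex ^ 'n \<Rightarrow> complex) \<Rightarrow> ennreal"
  where "hardy_norm p f = (SUP r\<in>{0<..<1}. pmean p r f)"

definition hardy_space :: "ennreal \<Rightarrow> (complex ^ 'n \<Rightarrow> complex) set"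
  where "hardy_space p = {f \<in> holo_ball. hardy_norm p f < \<infinity>}"

text \<open>The smallest integer greater than \<open>\<alpha>\<close> is \<open>\<lfloor>\<alpha>\<rfloor> + 1\<close>.\<close>

definition lipschitz_space :: "ennreal \<Rightarrow> real \<Rightarrow> (complex ^ 'n \<Rightarrow> complex) set"
  where "lipschitz_space p \<alpha> =
    {f \<in> holo_ball. let s = real_of_int (\<lfloor>\<alpha>\<rfloor> + 1) in
       (SUP r\<in>{0..<1}. ennreal ((1 - r\<^sup>2) powr (s - \<alpha>)) * pmean p r (radial_deriv s f)) < \<infinity>}"


definition op_diff ::
    "nat \<Rightarrow> (complex ^ 'n \<Rightarrow> complex ^ 'n) \<Rightarrow> (complex ^ 'n \<Rightarrow> complex) \<Rightarrow> complex ^ 'n \<Rightarrow> complex"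
  where "op_diff n U f = ((\<lambda>g z. g (U z) - g z) ^^ n) f"

definition rot_diff ::
    "nat \<Rightarrow> real \<Rightarrow> (complex ^ 'n \<Rightarrow> complex) \<Rightarrow> complex ^ 'n \<Rightarrow> complex"
  where "rot_diff n t f = ((\<lambda>g z. g (exp (\<i> * of_real t) *s z) - g z) ^^ n) f"

definition modulus :: "nat \<Rightarrow> real \<Rightarrow> (complex ^ 'n \<Rightarrow> complex) \<Rightarrow> ennreal \<Rightarrow> ennreal"
  where "modulus n \<delta> f p =
    (SUP U\<in>{U \<in> unitary_ops. onorm (\<lambda>z. U z - z) < \<delta>}. hardy_norm p (op_diff n U f))"

definition modulus_minus :: "nat \<Rightarrow> real \<Rightarrow> (complex ^ 'n \<Rightarrow> complex) \<Rightarrow> ennreal \<Rightarrow> ennreal"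
  where "modulus_minus n \<delta> f p = (SUP t\<in>{t. \<bar>t\<bar> < \<delta>}. hardy_norm p (rot_diff n t f))"

definition modulus_plus :: "nat \<Rightarrow> real \<Rightarrow> (complex ^ 'n \<Rightarrow> complex) \<Rightarrow> ennreal \<Rightarrow> ennreal"
  where "modulus_plus n \<delta> f p =
    (SUP U\<in>{U \<in> ball_ops. onorm (\<lambda>z. U z - z) < \<delta>}. hardy_norm p (op_diff n U f))"

text \<open>
  \<open>h(x) = \<O>(x\<^sup>\<alpha>)\<close> for \<open>0 < x < 1\<close>, as a uniform bound on the whole interval; \<open>h\<close> may
  a priori be infinite.
\<close>

definition power_bound :: "real \<Rightarrow> (real \<Rightarrow> ennreal) \<Rightarrow> bool"
  where "power_bound \<alpha> h \<longleftrightarrow> (\<exists>C :: real. \<forall>x. 0 < x \<and> x < 1 \<longrightarrow> h x \<le> ennreal (C * x powr \<alpha>))"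

end

theory Submission
  imports Defs "HOL-Complex_Analysis.Complex_Analysis" "HOL-Probability.Distributions"
begin

text \<open>
  Everything is proved for finite exponents \<open>q \<ge> 1\<close> with constants that do not depend on \<open>q\<close>. Since \<open>\<sigma>\<close> has mass at most
  one, \<open>M\<^sub>\<infinity>(r, g) \<le> A\<close> holds iff \<open>M\<^sub>q(r, g) \<le> A\<close> for all finite \<open>q\<close> (\<open>pmean_le_iff\<close>), so the case \<open>p = \<infinity>\<close> is included.

  The implications from \<open>(\<omega>\<^sup>+)\<close> over \<open>(\<omega>)\<close> and \<open>(\<omega>\<^sup>-)\<close> to \<open>(\<Delta>)\<close> are inclusions: rotations by \<open>e\<^sup>i\<^sup>t\<close> are unitary with
  \<open>|e\<^sup>i\<^sup>t - 1| \<le> |t|\<close>, and unitary maps preserve the ball.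

  From \<open>(\<R>)\<close> to \<open>(\<omega>\<^sup>+)\<close>. Three facts carry the proof. First, the contraction principle: composing with a linear
  contraction does not increase integral means (\<open>nn_integral_contraction_le\<close>); this is a maximum principle on the unit
  ball of matrices, whose extreme points, the unitary matrices, preserve \<open>\<sigma>\<close>. Second, a Cauchy estimate
  (\<open>mean_le_op_diff_Cauchy\<close>): if \<open>|U - I| \<le> \<delta>\<close>, then \<open>c \<mapsto> g(z + c(Uz - z))\<close> is holomorphic, and Cauchy's formula on
  \<open>|c| = R\<close> together with the contraction principle bounds the mean of the \<open>n\<close>-th difference of \<open>g\<close> by \<open>(R - 1)\<^sup>-\<^sup>n\<close> times the
  mean of \<open>g\<close> over the radius enlarged by \<open>(1 + R\<delta>)\<^sup>n\<close>. Third, the reproducing formula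
  \<open>f(z) - f(0) = 1/\<Gamma>(s) \<integral> t\<^sup>s\<^sup>-\<^sup>1 (\<R>\<^sup>s f)(e\<^sup>-\<^sup>t z) dt\<close>. Taking differences under this integral, and using the trivial bound
  \<open>2\<^sup>n\<close> for \<open>t\<close> up to a multiple of \<open>\<delta>\<close> and the Cauchy estimate beyond, leads to the integral of
  \<open>t\<^sup>\<alpha>\<^sup>-\<^sup>1 min(1, \<delta>/t)\<^sup>n\<close>, which is of order \<open>\<delta>\<^sup>\<alpha>\<close> exactly because \<open>0 < \<alpha> < n\<close> (\<open>mean_le_op_diff\<close>). The same estimate for
  the operator \<open>z \<mapsto> z/2\<close> shows that the Lipschitz space lies in the Hardy space.

  From \<open>(\<Delta>)\<close> to \<open>(\<R>)\<close>. The shifted difference of order \<open>n\<close> of \<open>f\<close> by the rotation \<open>u\<close>, evaluated at \<open>u\<^sup>1\<^sup>-\<^sup>n z\<close>, contains one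
  term \<open>f(uz)\<close> and otherwise only terms \<open>f(u\<^sup>-\<^sup>l z)\<close> with \<open>l \<ge> 0\<close>. Integrated over the circle against
  \<open>\<Sum>\<^sub>m m\<^sup>s \<rho>\<^sup>m u\<^sup>-\<^sup>m\<close>, these other terms disappear and \<open>f(uz)\<close> yields \<open>(\<R>\<^sup>s f)(\<rho>z)\<close>
  (\<open>radial_deriv_rotation_representation\<close>). The kernel is bounded by a multiple of \<open>|1 - \<rho>/u|\<^sup>-\<^sup>s\<^sup>-\<^sup>1\<close>, and integrating this
  against \<open>|t|\<^sup>\<alpha>\<close> gives the order \<open>(1 - \<rho>)\<^sup>\<alpha>\<^sup>-\<^sup>s\<close> because \<open>s > \<alpha>\<close> (\<open>mean_le_radial_deriv\<close>).

  The homogeneous parts are identified with the Taylor coefficients of \<open>c \<mapsto> f(cz)\<close> (\<open>hom_part_eq_slice_coeff\<close>), which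
  requires proving that these coefficients are polynomials in \<open>z\<close>.
\<close>

section \<open>Lebesgue measure and linear isometries\<close>

lemma nn_integral_lborel_translate:
  fixes a :: "'a::euclidean_space" and f :: "'a \<Rightarrow> ennreal"
  assumes [measurable]: "f \<in> borel_measurable borel"
  shows "(\<integral>\<^sup>+x. f (a + x) \<partial>lborel) = (\<integral>\<^sup>+x. f x \<partial>lborel)"
  by (subst (2) lborel_distr_plus[of a, symmetric], subst nn_integral_distr) auto

lemma nn_integral_lborel_reflect:
  fixes f :: "'a::euclidean_space \<Rightarrow> ennreal"
  assumes [measurable]: "f \<in> borel_measurable borel"
  shows "(\<integral>\<^sup>+x. f (- x) \<partial>lborel) = (\<integral>\<^sup>+x. f x \<partial>lborel)"
  by (subst (2) lborel_affine[of "-1" 0], simp, subst nn_integral_density)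
     (auto simp: nn_integral_distr)

text \<open>
  The usual uniqueness argument for translation invariant measures. The image \<open>\<mu>\<close> of Lebesgue measure
  under \<open>T\<close> is translation invariant and agrees with Lebesgue measure on the unit ball \<open>B\<close>. Computing the
  integral of \<open>1\<^sub>X(x) 1\<^sub>B(x + y)\<close> with respect to \<open>d\<mu>(x) dy\<close> once by translating \<open>y\<close> and once by translating \<open>x\<close>
  gives \<open>\<mu>(X) vol(B) = vol(X) \<mu>(B)\<close>.
\<close>

lemma lborel_distr_linear_isometry:
  fixes T :: "'a::euclidean_space \<Rightarrow> 'a"
  assumes lin: "linear T" and iso: "\<And>x. norm (T x) = norm x"
  shows "distr lborel borel T = lborel"
proof (rule measure_eqI)
  have contT: "continuous_on UNIV T"
    using lin by (simp add: linear_continuous_on linear_linear)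
  have [measurable]: "T \<in> borel \<rightarrow>\<^sub>M borel"
    by (rule borel_measurable_continuous_onI[OF contT])
  have surjT: "surj T"
    using lin iso by (intro linear_injective_imp_surjective)
       (auto simp: linear_injective_0 dest: arg_cong[where f=norm])
  let ?\<mu> = "distr lborel borel T"
  have trans: "(\<integral>\<^sup>+x. f (a + x) \<partial>?\<mu>) = (\<integral>\<^sup>+x. f x \<partial>?\<mu>)"
    if [measurable]: "f \<in> borel_measurable borel" for f :: "'a \<Rightarrow> ennreal" and a
  proof -
    obtain b where b: "T b = a" using surjT by (metis surj_def)
    have "(\<integral>\<^sup>+x. f (a + x) \<partial>?\<mu>) = (\<integral>\<^sup>+x. f (T (b + x)) \<partial>lborel)"
      by (subst nn_integral_distr) (auto simp: b linear_add[OF lin])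
    also have "\<dots> = (\<integral>\<^sup>+x. f (T x) \<partial>lborel)"
      by (rule nn_integral_lborel_translate[where f="\<lambda>x. f (T x)"]) simp
    finally show ?thesis by (subst nn_integral_distr) auto
  qed
  let ?B = "ball (0::'a) 1"
  have Beq: "emeasure ?\<mu> ?B = emeasure lborel ?B"
  proof -
    have "T -` ?B = ?B" by (auto simp: iso)
    then show ?thesis by (subst emeasure_distr) auto
  qed
  have sfin: "sigma_finite_measure ?\<mu>"
  proof (rule sigma_finite_measure.intro, intro exI conjI)
    let ?A = "range (\<lambda>n::nat. ball (0::'a) (real n))"
    show "countable ?A" by simp
    show "?A \<subseteq> sets ?\<mu>" by auto
    show "\<Union>?A = space ?\<mu>"
      by (auto simp: dist_norm) (meson reals_Archimedean2)
    have "emeasure ?\<mu> (ball 0 (real n)) \<noteq> \<infinity>" for n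
    proof -
      have "T -` ball 0 (real n) = ball 0 (real n)" by (auto simp: iso)
      then have "emeasure ?\<mu> (ball 0 (real n)) = emeasure lborel (ball (0::'a) (real n))"
        by (subst emeasure_distr) auto
      then show ?thesis using emeasure_lborel_ball_finite[of "0::'a" "real n"] by simp
    qed
    then show "\<forall>a\<in>?A. emeasure ?\<mu> a \<noteq> \<infinity>" by auto
  qed
  interpret pair_sigma_finite lborel ?\<mu>
    using sfin by (simp add: pair_sigma_finite_def lborel.sigma_finite_measure_axioms)
  fix X assume "X \<in> sets ?\<mu>"
  then have X[measurable]: "X \<in> sets borel" by simp
  have [measurable]: "?B \<in> sets borel" by simp
  have "emeasure ?\<mu> X * emeasure lborel ?B
      = (\<integral>\<^sup>+x. indicator X x * (\<integral>\<^sup>+y. indicator ?B y \<partial>lborel) \<partial>?\<mu>)"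
    by (subst nn_integral_multc) auto
  also have "\<dots> = (\<integral>\<^sup>+x. (\<integral>\<^sup>+y. indicator X x * indicator ?B (x + y) \<partial>lborel) \<partial>?\<mu>)"
  proof (rule nn_integral_cong)
    fix x :: 'a
    have "(\<integral>\<^sup>+y. indicator ?B (x + y) \<partial>lborel) = (\<integral>\<^sup>+y. indicator ?B y \<partial>lborel)"
      by (rule nn_integral_lborel_translate) simp
    then show "indicator X x * (\<integral>\<^sup>+y. indicator ?B y \<partial>lborel)
       = (\<integral>\<^sup>+y. indicator X x * indicator ?B (x + y) \<partial>lborel)"
      by (subst nn_integral_cmult) auto
  qed
  also have "\<dots> = (\<integral>\<^sup>+y. (\<integral>\<^sup>+x. indicator X x * indicator ?B (x + y) \<partial>?\<mu>) \<partial>lborel)"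
    by (rule Fubini') auto
  also have "\<dots> = (\<integral>\<^sup>+y. (\<integral>\<^sup>+x. indicator X (x - y) * indicator ?B x \<partial>?\<mu>) \<partial>lborel)"
  proof (rule nn_integral_cong)
    fix y :: 'a
    have "(\<integral>\<^sup>+x. indicator X (y + x - y) * indicator ?B (y + x) \<partial>?\<mu>)
        = (\<integral>\<^sup>+x. indicator X (x - y) * indicator ?B x \<partial>?\<mu>)"
      by (rule trans[where f="\<lambda>x. indicator X (x - y) * indicator ?B x"]) simp
    then show "(\<integral>\<^sup>+x. indicator X x * indicator ?B (x + y) \<partial>?\<mu>)
        = (\<integral>\<^sup>+x. indicator X (x - y) * indicator ?B x \<partial>?\<mu>)"
      by (simp add: add.commute)
  qed
  also have "\<dots> = (\<integral>\<^sup>+x. (\<integral>\<^sup>+y. indicator X (x - y) * indicator ?B x \<partial>lborel) \<partial>?\<mu>)"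
    by (rule Fubini'[symmetric]) auto
  also have "\<dots> = (\<integral>\<^sup>+x. emeasure lborel X * indicator ?B x \<partial>?\<mu>)"
  proof (rule nn_integral_cong)
    fix x :: 'a
    have "(\<integral>\<^sup>+y. indicator X (x - y) \<partial>lborel) = (\<integral>\<^sup>+y. indicator X (x + y) \<partial>(lborel::'a measure) :: ennreal)"
      using nn_integral_lborel_reflect[of "\<lambda>y. indicator X (x + y)"] by simp
    also have "\<dots> = (\<integral>\<^sup>+y. indicator X y \<partial>lborel)"
      by (rule nn_integral_lborel_translate) simp
    finally show "(\<integral>\<^sup>+y. indicator X (x - y) * indicator ?B x \<partial>lborel) = emeasure lborel X * indicator ?B x"
      by (subst nn_integral_multc) auto
  qed
  also have "\<dots> = emeasure lborel X * emeasure ?\<mu> ?B"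
    by (subst nn_integral_cmult) auto
  finally have "emeasure ?\<mu> X * emeasure lborel ?B = emeasure lborel X * emeasure lborel ?B"
    by (simp only: Beq)
  moreover have "emeasure lborel ?B \<noteq> 0" 
    using emeasure_lborel_ball_finite[of "0::'a" 1] content_ball_pos[of 1 "0::'a"]
    by (auto simp: measure_def)
  moreover have "emeasure lborel ?B \<noteq> top" using emeasure_lborel_ball_finite[of "0::'a" 1] by auto
  ultimately show "emeasure ?\<mu> X = emeasure lborel X"
    by (simp add: mult.commute[of _ "emeasure lborel ?B"] ennreal_mult_cancel_left)
qed simp


section \<open>The measure on the sphere\<close>

lemma sets_sphere_measure [measurable_cong]:
  "sets (sphere_measure :: (complex ^ 'n) measure) = sets (restrict_space borel (sphere 0 1))"
  unfolding sphere_measure_def by (intro sets_restrict_space_cong) simp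

lemma space_sphere_measure [simp]:
  "space (sphere_measure :: (complex ^ 'n) measure) = sphere 0 1"
  unfolding sphere_measure_def by (simp add: space_restrict_space)

lemma borel_measurable_normalize [measurable]:
  "(\<lambda>z::complex ^ 'n. z /\<^sub>R norm z) \<in> borel \<rightarrow>\<^sub>M borel"
  by measurable

lemma sphere_in_borel [measurable]: "sphere (0::'a::euclidean_space) r \<in> sets borel"
  by (simp add: borel_closed closed_sphere)

lemma nn_integral_sphere_measure:
  fixes u :: "complex ^ 'n \<Rightarrow> ennreal"
  assumes [measurable]: "u \<in> borel_measurable borel"
  shows "(\<integral>\<^sup>+\<zeta>. u \<zeta> \<partial>sphere_measure) =
    (\<integral>\<^sup>+z. indicator (ball 0 1) z * u (z /\<^sub>R norm z) * indicator (sphere 0 1) (z /\<^sub>R norm z) \<partial>lborel)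
      / emeasure lborel (ball (0 :: complex ^ 'n) 1)"
proof -
  have "(\<integral>\<^sup>+\<zeta>. u \<zeta> \<partial>sphere_measure) =
     (\<integral>\<^sup>+\<zeta>. u \<zeta> * indicator (sphere 0 1) \<zeta> \<partial>distr (uniform_measure lborel (ball 0 1)) borel (\<lambda>z. z /\<^sub>R norm z))"
    unfolding sphere_measure_def by (subst nn_integral_restrict_space) auto
  also have "\<dots> = (\<integral>\<^sup>+z. u (z /\<^sub>R norm z) * indicator (sphere 0 1) (z /\<^sub>R norm z) \<partial>uniform_measure lborel (ball 0 1))"
    by (subst nn_integral_distr) auto
  also have "\<dots> = (\<integral>\<^sup>+z. u (z /\<^sub>R norm z) * indicator (sphere 0 1) (z /\<^sub>R norm z) * indicator (ball 0 1) z \<partial>lborel)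
      / emeasure lborel (ball (0 :: complex ^ 'n) 1)"
    by (subst nn_integral_uniform_measure) auto
  finally show ?thesis by (simp add: mult_ac)
qed

lemma emeasure_sphere_measure_le_1:
  "emeasure sphere_measure (space (sphere_measure :: (complex ^ 'n) measure)) \<le> 1"
proof -
  have "emeasure sphere_measure (space (sphere_measure :: (complex ^ 'n) measure))
     = (\<integral>\<^sup>+\<zeta>. 1 \<partial>(sphere_measure :: (complex ^ 'n) measure))" by simp
  also have "\<dots> \<le> (\<integral>\<^sup>+z. indicator (ball 0 1) z \<partial>(lborel :: (complex ^ 'n) measure)) / emeasure lborel (ball (0 :: complex ^ 'n) 1)"
    by (subst nn_integral_sphere_measure)
       (auto intro!: divide_right_mono_ennreal nn_integral_mono split: split_indicator simp del: nn_integral_indicator)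
  also have "\<dots> \<le> 1"
    using emeasure_lborel_ball_finite[of "0::complex ^ 'n" 1]
    by (cases "emeasure lborel (ball (0::complex ^ 'n) 1) = 0") (auto simp: ennreal_divide_self)
  finally show ?thesis .
qed

lemma finite_measure_sphere_measure: "finite_measure (sphere_measure :: (complex ^ 'n) measure)"
  by (rule finite_measureI) (metis emeasure_sphere_measure_le_1 ennreal_one_less_top infinity_ennreal_def leD)

lemma sigma_finite_sphere_measure: "sigma_finite_measure (sphere_measure :: (complex ^ 'n) measure)"
  by (simp add: finite_measure.axioms(1) finite_measure_sphere_measure)

text \<open>
  A linear isometry preserves the unit ball and commutes with \<open>z \<mapsto> z / |z|\<close>, so the invariance of Lebesgue
  measure passes to \<open>\<sigma>\<close>.
\<close>

lemma nn_integral_sphere_measure_isometry: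
  fixes T :: "complex ^ 'n \<Rightarrow> complex ^ 'n" and u :: "complex ^ 'n \<Rightarrow> ennreal"
  assumes lin: "linear T" and iso: "\<And>x. norm (T x) = norm x"
    and u: "u \<in> borel_measurable sphere_measure"
  shows "(\<integral>\<^sup>+\<zeta>. u (T \<zeta>) \<partial>sphere_measure) = (\<integral>\<^sup>+\<zeta>. u \<zeta> \<partial>sphere_measure)"
proof -
  define v where "v = (\<lambda>z. if z \<in> sphere 0 1 then u z else 0)"
  have contT: "continuous_on UNIV T"
    using lin by (simp add: linear_continuous_on linear_linear)
  have Tm[measurable]: "T \<in> borel \<rightarrow>\<^sub>M borel"
    by (rule borel_measurable_continuous_onI[OF contT])
  have v[measurable]: "v \<in> borel_measurable borel"
  proof -
    have "u \<in> borel_measurable (restrict_space borel (sphere 0 1))"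
      using u by (simp add: measurable_cong_sets[OF sets_sphere_measure refl])
    then show ?thesis unfolding v_def
      by (subst (asm) measurable_restrict_space_iff[where c=0]) auto
  qed
  have vm: "(\<lambda>z. indicator (ball 0 1) z * v (z /\<^sub>R norm z) * indicator (sphere 0 1) (z /\<^sub>R norm z)) \<in> borel_measurable borel"
    by (intro borel_measurable_times_ennreal measurable_compose[OF borel_measurable_normalize] borel_measurable_indicator v) auto
  have "(\<integral>\<^sup>+\<zeta>. u (T \<zeta>) \<partial>sphere_measure) = (\<integral>\<^sup>+\<zeta>. v (T \<zeta>) \<partial>sphere_measure)"
    by (intro nn_integral_cong) (auto simp: v_def iso)
  also have "\<dots> = (\<integral>\<^sup>+z. indicator (ball 0 1) z * v (T (z /\<^sub>R norm z)) * indicator (sphere 0 1) (z /\<^sub>R norm z) \<partial>lborel)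
      / emeasure lborel (ball (0 :: complex ^ 'n) 1)"
    by (rule nn_integral_sphere_measure) simp
  also have "\<dots> = (\<integral>\<^sup>+z. indicator (ball 0 1) (T z) * v (T z /\<^sub>R norm (T z)) * indicator (sphere 0 1) (T z /\<^sub>R norm (T z)) \<partial>lborel)
      / emeasure lborel (ball (0 :: complex ^ 'n) 1)"
    by (simp add: iso indicator_def linear_cmul[OF lin])
  also have "\<dots> = (\<integral>\<^sup>+z. indicator (ball 0 1) z * v (z /\<^sub>R norm z) * indicator (sphere 0 1) (z /\<^sub>R norm z) \<partial>distr lborel borel T)
      / emeasure lborel (ball (0 :: complex ^ 'n) 1)"
    using vm by (subst nn_integral_distr) auto
  also have "\<dots> = (\<integral>\<^sup>+\<zeta>. v \<zeta> \<partial>sphere_measure)"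
    by (simp add: lborel_distr_linear_isometry[OF lin iso] nn_integral_sphere_measure)
  also have "\<dots> = (\<integral>\<^sup>+\<zeta>. u \<zeta> \<partial>sphere_measure)"
    by (intro nn_integral_cong) (auto simp: v_def)
  finally show ?thesis .
qed

section \<open>Minkowski's integral inequality\<close>

text \<open>
  The convex function \<open>y \<mapsto> y\<^sup>q\<close> lies above its tangent at \<open>c\<close>.
\<close>

lemma powr_tangent_le:
  fixes c y q :: real
  assumes "1 \<le> q" "0 \<le> y" "0 < c"
  shows "q * c powr (q - 1) * y \<le> y powr q + (q - 1) * c powr q"
proof (cases "q = 1 \<or> y = 0")
  case True
  then show ?thesis using assms by auto
next
  case False
  have "(y powr q) powr (1/q) * (c powr q) powr (1 - 1/q) \<le> 1/q * (y powr q) + (1 - 1/q) * (c powr q)"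
    using False assms by (intro Youngs_inequality_0) auto
  moreover have "(y powr q) powr (1/q) * (c powr q) powr (1 - 1/q) = y * c powr (q - 1)"
  proof -
    have "(1 - 1/q) * q = q - 1" using assms by (simp add: field_simps)
    then show ?thesis using False assms by (simp add: powr_powr mult.commute)
  qed
  ultimately have "q * (y * c powr (q - 1)) \<le> q * (1/q * (y powr q) + (1 - 1/q) * (c powr q))"
    using assms by (intro mult_left_mono) auto
  also have "\<dots> = y powr q + (q - 1) * c powr q" using assms by (simp add: field_simps)
  finally show ?thesis by (simp add: mult_ac)
qed

lemma nn_integral_powr_cmult_le:
  fixes u :: "'a \<Rightarrow> real"
  assumes [measurable]: "u \<in> borel_measurable M" and u: "\<And>x. 0 \<le> u x" and c: "0 \<le> c" "0 \<le> B"
    and le: "(\<integral>\<^sup>+x. ennreal (u x powr q) \<partial>M) \<le> ennreal (B powr q)"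
  shows "(\<integral>\<^sup>+x. ennreal ((c * u x) powr q) \<partial>M) \<le> ennreal ((c * B) powr q)"
proof -
  have "(\<integral>\<^sup>+x. ennreal ((c * u x) powr q) \<partial>M) = (\<integral>\<^sup>+x. ennreal (c powr q) * ennreal (u x powr q) \<partial>M)"
    using c u by (intro nn_integral_cong) (simp add: powr_mult ennreal_mult)
  also have "\<dots> = ennreal (c powr q) * (\<integral>\<^sup>+x. ennreal (u x powr q) \<partial>M)"
    by (intro nn_integral_cmult) simp
  also have "\<dots> \<le> ennreal (c powr q) * ennreal (B powr q)" by (intro mult_left_mono le) simp
  also have "\<dots> = ennreal ((c * B) powr q)" using c by (simp add: powr_mult ennreal_mult)
  finally show ?thesis .
qed

text \<open>
  At a fixed \<open>x\<close>, take the tangent inequality at \<open>c = u(x) / W\<close> for \<open>y = h(t, x) / A(t)\<close> and integrate it against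
  the weight \<open>A(t) / W\<close>, whose total mass is at most one. This bounds \<open>(u(x) / W)\<^sup>q\<close> by the weighted integral of
  \<open>(h(t, x) / A(t))\<^sup>q\<close>; integrating over \<open>x\<close> and exchanging the integrals yields at most one. Working with
  upper bounds \<open>A(t)\<close> instead of the norms themselves avoids any measurability question about the norms.
\<close>

lemma minkowski_integral_inequality:
  fixes h :: "'b \<Rightarrow> 'a \<Rightarrow> real" and A :: "'b \<Rightarrow> real" and u :: "'a \<Rightarrow> real"
  assumes nu: "sigma_finite_measure \<nu>" and M: "sigma_finite_measure M"
    and q: "1 \<le> q" and W: "0 < W"
    and h[measurable]: "(\<lambda>(t, x). h t x) \<in> borel_measurable (\<nu> \<Otimes>\<^sub>M M)"
    and h0: "\<And>t x. t \<in> space \<nu> \<Longrightarrow> x \<in> space M \<Longrightarrow> 0 \<le> h t x"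
    and A[measurable]: "A \<in> borel_measurable \<nu>" and A0: "\<And>t. t \<in> space \<nu> \<Longrightarrow> 0 < A t"
    and AW: "(\<integral>\<^sup>+t. ennreal (A t) \<partial>\<nu>) \<le> ennreal W"
    and hA: "\<And>t. t \<in> space \<nu> \<Longrightarrow> (\<integral>\<^sup>+x. ennreal (h t x powr q) \<partial>M) \<le> ennreal (A t powr q)"
    and u[measurable]: "u \<in> borel_measurable M" and u0: "\<And>x. x \<in> space M \<Longrightarrow> 0 \<le> u x"
    and uh: "\<And>x. x \<in> space M \<Longrightarrow> ennreal (u x) \<le> (\<integral>\<^sup>+t. ennreal (h t x) \<partial>\<nu>)"
  shows "(\<integral>\<^sup>+x. ennreal (u x powr q) \<partial>M) \<le> ennreal (W powr q)"
proof -
  interpret pair_sigma_finite \<nu> M using nu M by (simp add: pair_sigma_finite_def)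
  let ?w = "\<lambda>t. ennreal (A t / W)"
  have Wint: "(\<integral>\<^sup>+t. ?w t \<partial>\<nu>) \<le> 1"
  proof -
    have "(\<integral>\<^sup>+t. ?w t \<partial>\<nu>) = (\<integral>\<^sup>+t. ennreal (A t) * ennreal (1 / W) \<partial>\<nu>)"
      using A0 W by (intro nn_integral_cong) (auto simp: ennreal_mult[symmetric] less_imp_le)
    also have "\<dots> = (\<integral>\<^sup>+t. ennreal (A t) \<partial>\<nu>) * ennreal (1 / W)"
      by (rule nn_integral_multc) simp
    also have "\<dots> \<le> ennreal W * ennreal (1 / W)" by (intro mult_right_mono AW) simp
    also have "\<dots> = 1" using W by (simp add: ennreal_mult[symmetric])
    finally show ?thesis .
  qed
  \<comment> \<open>the pointwise Jensen inequality\<close>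
  have pt: "ennreal ((u x / W) powr q) \<le> (\<integral>\<^sup>+t. ennreal ((h t x / A t) powr q) * ?w t \<partial>\<nu>)"
    if x[measurable]: "x \<in> space M" for x
  proof (cases "u x = 0")
    case False
    define c where "c = u x / W"
    have c: "c > 0" using False u0[OF x] W by (auto simp: c_def)
    let ?I = "\<integral>\<^sup>+t. ennreal ((h t x / A t) powr q) * ?w t \<partial>\<nu>"
    have hx[measurable]: "(\<lambda>t. h t x) \<in> borel_measurable \<nu>"
      using measurable_compose[OF measurable_Pair2'[OF x] h] by simp
    have "ennreal (q * c powr q) = ennreal (q * c powr (q - 1) / W) * ennreal (u x)"
      using c W q u0[OF x] powr_add[of c "q - 1" 1]
      by (simp add: ennreal_mult[symmetric] c_def)
    also have "\<dots> \<le> ennreal (q * c powr (q - 1) / W) * (\<integral>\<^sup>+t. ennreal (h t x) \<partial>\<nu>)"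
      by (intro mult_left_mono uh x) simp
    also have "\<dots> = (\<integral>\<^sup>+t. ennreal (q * c powr (q - 1) / W) * ennreal (h t x) \<partial>\<nu>)"
      by (rule nn_integral_cmult[symmetric]) simp
    also have "\<dots> \<le> (\<integral>\<^sup>+t. ennreal ((h t x / A t) powr q) * ?w t + ennreal ((q - 1) * c powr q) * ?w t \<partial>\<nu>)"
    proof (rule nn_integral_mono)
      fix t assume t: "t \<in> space \<nu>"
      note [simp] = A0[OF t] h0[OF t x] less_imp_le[OF A0[OF t]]
      have "q * c powr (q - 1) * (h t x / A t) \<le> (h t x / A t) powr q + (q - 1) * c powr q"
        using q c by (intro powr_tangent_le) auto
      then have "q * c powr (q - 1) * (h t x / A t) * (A t / W) \<le> ((h t x / A t) powr q + (q - 1) * c powr q) * (A t / W)"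
        using W by (intro mult_right_mono) auto
      moreover have "q * c powr (q - 1) * (h t x / A t) * (A t / W) = q * c powr (q - 1) / W * h t x"
        using less_imp_neq[OF A0[OF t]] by (auto simp: field_simps)
      ultimately have "ennreal (q * c powr (q - 1) / W * h t x)
         \<le> ennreal (((h t x / A t) powr q + (q - 1) * c powr q) * (A t / W))"
        by (intro ennreal_leI) (simp only:)
      then show "ennreal (q * c powr (q - 1) / W) * ennreal (h t x)
         \<le> ennreal ((h t x / A t) powr q) * ?w t + ennreal ((q - 1) * c powr q) * ?w t"
        using q c W by (simp add: ennreal_mult[symmetric] ennreal_plus[symmetric] distrib_right add_divide_distrib del: ennreal_plus)
    qed
    also have "\<dots> = ?I + ennreal ((q - 1) * c powr q) * (\<integral>\<^sup>+t. ?w t \<partial>\<nu>)"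
      by (subst nn_integral_add) (auto simp: nn_integral_cmult)
    also have "\<dots> \<le> ?I + ennreal ((q - 1) * c powr q) * 1"
      by (intro add_left_mono mult_left_mono Wint) simp
    finally have le: "ennreal (q * c powr q) \<le> ?I + ennreal ((q - 1) * c powr q)" by simp
    show ?thesis
    proof (cases ?I rule: ennreal_cases)
      case (real r)
      then have "q * c powr q \<le> r + (q - 1) * c powr q"
        using le q by (simp add: ennreal_plus[symmetric] del: ennreal_plus)
      then show ?thesis using real by (simp add: c_def[symmetric] algebra_simps)
    qed simp
  qed (use q in auto)
  have "(\<integral>\<^sup>+x. ennreal (u x powr q) \<partial>M) = (\<integral>\<^sup>+x. ennreal (W powr q) * ennreal ((u x / W) powr q) \<partial>M)"
    using W u0 by (intro nn_integral_cong) (auto simp: ennreal_mult[symmetric] powr_mult[symmetric])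
  also have "\<dots> = ennreal (W powr q) * (\<integral>\<^sup>+x. ennreal ((u x / W) powr q) \<partial>M)"
    by (rule nn_integral_cmult) simp
  also have "\<dots> \<le> ennreal (W powr q) * (\<integral>\<^sup>+x. (\<integral>\<^sup>+t. ennreal ((h t x / A t) powr q) * ?w t \<partial>\<nu>) \<partial>M)"
    by (intro mult_left_mono nn_integral_mono pt) auto
  also have "(\<integral>\<^sup>+x. (\<integral>\<^sup>+t. ennreal ((h t x / A t) powr q) * ?w t \<partial>\<nu>) \<partial>M)
     = (\<integral>\<^sup>+t. (\<integral>\<^sup>+x. ennreal ((h t x / A t) powr q) * ?w t \<partial>M) \<partial>\<nu>)"
    by (rule Fubini') measurable
  also have "\<dots> \<le> (\<integral>\<^sup>+t. ?w t \<partial>\<nu>)"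
  proof (rule nn_integral_mono)
    fix t assume t: "t \<in> space \<nu>"
    have [measurable]: "(\<lambda>x. h t x) \<in> borel_measurable M"
      using measurable_compose[OF measurable_Pair1'[OF t] h] by simp
    have "(\<integral>\<^sup>+x. ennreal ((h t x / A t) powr q) * ?w t \<partial>M)
       = (\<integral>\<^sup>+x. ennreal (h t x powr q) * (ennreal (1 / A t powr q) * ?w t) \<partial>M)"
      using A0[OF t] h0[OF t] 
      by (intro nn_integral_cong) (auto simp: powr_divide ennreal_mult[symmetric] mult.assoc[symmetric])
    also have "\<dots> = (\<integral>\<^sup>+x. ennreal (h t x powr q) \<partial>M) * (ennreal (1 / A t powr q) * ?w t)"
      by (rule nn_integral_multc) simp
    also have "\<dots> \<le> ennreal (A t powr q) * (ennreal (1 / A t powr q) * ?w t)"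
      by (intro mult_right_mono hA t) simp
    also have "\<dots> = ?w t" using A0[OF t]
      by (simp add: ennreal_mult[symmetric] mult.assoc[symmetric])
    finally show "(\<integral>\<^sup>+x. ennreal ((h t x / A t) powr q) * ?w t \<partial>M) \<le> ?w t" .
  qed
  also have "\<dots> \<le> 1" by (rule Wint)
  finally show ?thesis by (simp add: mult_left_mono)
qed

section \<open>Integral means over spheres\<close>

abbreviation unit_ball :: "(complex ^ 'n) set" where "unit_ball \<equiv> ball 0 1"

text \<open>
  The inequality \<open>M\<^sub>q(r, g) \<le> A\<close>, raised to the power \<open>q\<close> so that no root of a possibly infinite integral occurs.
\<close>

definition mean_le :: "real \<Rightarrow> real \<Rightarrow> (complex ^ 'n \<Rightarrow> complex) \<Rightarrow> real \<Rightarrow> bool" where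
  "mean_le q r g A \<longleftrightarrow>
    (\<integral>\<^sup>+\<zeta>. ennreal (norm (g (r *\<^sub>R \<zeta>)) powr q) \<partial>sphere_measure) \<le> ennreal (A powr q)"

text \<open>
  Every holomorphic function on the ball belongs to this class, one-variable Cauchy arguments on complex lines
  apply to it, and it is closed under locally uniform limits. Hence it also contains the radial derivatives, which are
  given by series, without any discussion of their differentiability in several variables.
\<close>

definition line_holomorphic :: "(complex ^ 'n \<Rightarrow> complex) set" where
  "line_holomorphic = {g. continuous_on unit_ball g \<and>
     (\<forall>z v. (\<lambda>c. g (z + c *s v)) holomorphic_on {c. z + c *s v \<in> unit_ball})}"

lemma norm_vec_smult [simp]: "norm (c *s (z :: complex ^ 'n)) = norm c * norm z"
  by (simp add: norm_vec_def L2_set_def norm_mult power_mult_distrib sum_distrib_left[symmetric] real_sqrt_mult)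

lemma scaleR_eq_smult: "r *\<^sub>R (z :: complex ^ 'n) = complex_of_real r *s z"
  by (simp add: vec_eq_iff) (simp add: scaleR_conv_of_real)

lemma continuous_on_smult [continuous_intros]:
  fixes f :: "'a::topological_space \<Rightarrow> complex" and g :: "'a \<Rightarrow> complex ^ 'n"
  assumes "continuous_on S f" "continuous_on S g"
  shows "continuous_on S (\<lambda>x. f x *s g x)"
  unfolding vector_scalar_mult_def by (intro continuous_intros assms)

lemma measurable_sphere_measure:
  fixes h :: "complex ^ 'n \<Rightarrow> 'b::topological_space"
  assumes "continuous_on (sphere 0 1) h"
  shows "h \<in> borel_measurable sphere_measure"
  using borel_measurable_continuous_on_restrict[OF assms]
  by (simp add: measurable_cong_sets[OF sets_sphere_measure refl])

lemma continuous_on_sphere_dilate: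
  fixes g :: "complex ^ 'n \<Rightarrow> complex"
  assumes "continuous_on unit_ball g" "0 \<le> r" "r < 1"
  shows "continuous_on (sphere 0 1) (\<lambda>\<zeta>. g (r *\<^sub>R \<zeta>))"
  by (rule continuous_on_compose2[OF assms(1)]) (use assms in \<open>auto intro!: continuous_intros\<close>)

lemma borel_measurable_dilate:
  fixes g :: "complex ^ 'n \<Rightarrow> complex"
  assumes "continuous_on unit_ball g" "0 \<le> r" "r < 1"
  shows "(\<lambda>\<zeta>. g (r *\<^sub>R \<zeta>)) \<in> borel_measurable sphere_measure"
  by (intro measurable_sphere_measure continuous_on_sphere_dilate assms)

lemma measurable_pair_sphere_measure:
  fixes h :: "real \<Rightarrow> complex ^ 'n \<Rightarrow> real"
  assumes S: "S \<in> sets borel" and cont: "continuous_on (S \<times> sphere 0 1) (\<lambda>(t, x). h t x)"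
  shows "(\<lambda>(t, x). h t x) \<in> borel_measurable (restrict_space lborel S \<Otimes>\<^sub>M sphere_measure)"
proof -
  have "(\<lambda>(t, x). h t x) \<in> borel_measurable (restrict_space borel (S \<times> sphere 0 1))"
    by (rule borel_measurable_continuous_on_restrict[OF cont])
  moreover have "(\<lambda>p. p) \<in> restrict_space lborel S \<Otimes>\<^sub>M sphere_measure \<rightarrow>\<^sub>M restrict_space borel (S \<times> sphere (0::complex ^ 'n) 1)"
  proof (rule measurable_restrict_space2)
    show "(\<lambda>p. p) \<in> space (restrict_space lborel S \<Otimes>\<^sub>M sphere_measure) \<rightarrow> S \<times> sphere (0::complex ^ 'n) 1"
      by (auto simp: space_pair_measure space_restrict_space)
    have 1: "(\<lambda>p. fst p) \<in> restrict_space lborel S \<Otimes>\<^sub>M (sphere_measure :: (complex ^ 'n) measure) \<rightarrow>\<^sub>M borel"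
      by (rule measurable_compose[OF measurable_fst])
         (rule measurable_restrict_space1, simp)
    have 2: "(\<lambda>p. snd p) \<in> restrict_space lborel S \<Otimes>\<^sub>M (sphere_measure :: (complex ^ 'n) measure) \<rightarrow>\<^sub>M borel"
      by (rule measurable_compose[OF measurable_snd measurable_sphere_measure])
         (simp add: continuous_on_id)
    show "(\<lambda>p. p) \<in> restrict_space lborel S \<Otimes>\<^sub>M (sphere_measure :: (complex ^ 'n) measure) \<rightarrow>\<^sub>M borel"
      using borel_measurable_Pair[OF 1 2] by simp
  qed
  ultimately show ?thesis by (rule measurable_compose[rotated])
qed

text \<open>
  Minkowski's inequality for families with a real parameter: joint continuity supplies the measurability
  on the product with the sphere.
\<close>

lemma mean_le_integral:
  fixes h :: "real \<Rightarrow> complex ^ 'n \<Rightarrow> real" and A :: "real \<Rightarrow> real"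
  assumes q: "1 \<le> q" and W: "0 < W" and S[measurable]: "S \<in> sets borel"
    and h: "continuous_on (S \<times> sphere 0 1) (\<lambda>(t, x). h t x)"
    and h0: "\<And>t x. t \<in> S \<Longrightarrow> norm x = 1 \<Longrightarrow> 0 \<le> h t x"
    and A: "A \<in> borel_measurable borel" and A0: "\<And>t. t \<in> S \<Longrightarrow> 0 < A t"
    and AW: "(\<integral>\<^sup>+t. ennreal (A t) * indicator S t \<partial>lborel) \<le> ennreal W"
    and hA: "\<And>t. t \<in> S \<Longrightarrow> (\<integral>\<^sup>+x. ennreal (h t x powr q) \<partial>sphere_measure) \<le> ennreal (A t powr q)"
    and g: "continuous_on unit_ball g" and r: "0 \<le> r" "r < 1"
    and gh: "\<And>x. norm x = 1 \<Longrightarrow> ennreal (norm (g (r *\<^sub>R x))) \<le> (\<integral>\<^sup>+t. ennreal (h t x) * indicator S t \<partial>lborel)"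
  shows "mean_le q r g W"
  unfolding mean_le_def
proof (rule minkowski_integral_inequality[where \<nu>="restrict_space lborel S" and h=h and A=A])
  show "sigma_finite_measure (restrict_space lborel S)"
    by (intro sigma_finite_measure_restrict_space lborel.sigma_finite_measure_axioms) simp
  show "sigma_finite_measure (sphere_measure :: (complex ^ 'n) measure)"
    by (rule sigma_finite_sphere_measure)
  show "(\<lambda>(t, x). h t x) \<in> borel_measurable (restrict_space lborel S \<Otimes>\<^sub>M sphere_measure)"
    by (rule measurable_pair_sphere_measure[OF S h])
  show "A \<in> borel_measurable (restrict_space lborel S)"
    using A by (intro measurable_restrict_space1) simp
  show "(\<integral>\<^sup>+t. ennreal (A t) \<partial>restrict_space lborel S) \<le> ennreal W"
    using AW by (subst nn_integral_restrict_space) auto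
  show "(\<lambda>x. norm (g (r *\<^sub>R x))) \<in> borel_measurable sphere_measure"
    using borel_measurable_dilate[OF g r] by simp
  show "ennreal (norm (g (r *\<^sub>R x))) \<le> (\<integral>\<^sup>+t. ennreal (h t x) \<partial>restrict_space lborel S)"
    if "x \<in> space sphere_measure" for x
    using gh[of x] that by (subst nn_integral_restrict_space) auto
qed (use assms in \<open>auto simp: space_restrict_space\<close>)

lemma mean_le_mono:
  assumes "mean_le q r g A" "0 \<le> q" "0 \<le> A" "A \<le> B"
    and "\<And>\<zeta>. norm \<zeta> = 1 \<Longrightarrow> norm (k (r *\<^sub>R \<zeta>)) \<le> norm (g (r *\<^sub>R \<zeta>))"
  shows "mean_le q r k B"
  unfolding mean_le_def
proof -
  have "(\<integral>\<^sup>+\<zeta>. ennreal (norm (k (r *\<^sub>R \<zeta>)) powr q) \<partial>sphere_measure)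
      \<le> (\<integral>\<^sup>+\<zeta>. ennreal (norm (g (r *\<^sub>R \<zeta>)) powr q) \<partial>sphere_measure)"
    using assms by (intro nn_integral_mono ennreal_leI powr_mono2) auto
  also have "\<dots> \<le> ennreal (A powr q)" using assms by (simp add: mean_le_def)
  also have "\<dots> \<le> ennreal (B powr q)" using assms by (intro ennreal_leI powr_mono2) auto
  finally show "(\<integral>\<^sup>+\<zeta>. ennreal (norm (k (r *\<^sub>R \<zeta>)) powr q) \<partial>sphere_measure) \<le> ennreal (B powr q)" .
qed

lemma mean_le_const:
  assumes "0 \<le> q" "0 \<le> A" "\<And>\<zeta>. norm \<zeta> = 1 \<Longrightarrow> norm (g (r *\<^sub>R \<zeta>)) \<le> A"
  shows "mean_le q r (g :: complex ^ 'n \<Rightarrow> complex) A"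
proof -
  have "(\<integral>\<^sup>+\<zeta>. ennreal (norm (g (r *\<^sub>R \<zeta>)) powr q) \<partial>sphere_measure)
      \<le> (\<integral>\<^sup>+\<zeta>. ennreal (A powr q) \<partial>(sphere_measure :: (complex ^ 'n) measure))"
    using assms by (intro nn_integral_mono ennreal_leI powr_mono2) auto
  also have "\<dots> = ennreal (A powr q) * emeasure sphere_measure (space (sphere_measure :: (complex ^ 'n) measure))"
    by simp
  also have "\<dots> \<le> ennreal (A powr q) * 1"
    by (intro mult_left_mono emeasure_sphere_measure_le_1) simp
  finally show ?thesis by (simp add: mean_le_def)
qed

lemma mean_le_limit:
  assumes q: "1 \<le> q" and A: "0 \<le> A" and le: "\<And>\<epsilon>. 0 < \<epsilon> \<Longrightarrow> mean_le q r g (A + \<epsilon>)"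
  shows "mean_le q r g A"
  unfolding mean_le_def
proof (rule tendsto_lowerbound)
  have "((\<lambda>\<epsilon>. (A + \<epsilon>) powr q) \<longlongrightarrow> (A + 0) powr q) (at_right 0)"
    using q A by (intro tendsto_powr' tendsto_intros) (auto simp: eventually_at_right_less less_imp_le intro!: eventually_at_rightI[of 0 1])
  then show "((\<lambda>\<epsilon>. ennreal ((A + \<epsilon>) powr q)) \<longlongrightarrow> ennreal (A powr q)) (at_right 0)"
    by (auto intro: tendsto_ennrealI)
  show "\<forall>\<^sub>F \<epsilon> in at_right 0. (\<integral>\<^sup>+\<zeta>. ennreal (norm (g (r *\<^sub>R \<zeta>)) powr q) \<partial>sphere_measure) \<le> ennreal ((A + \<epsilon>) powr q)"
    using le by (intro eventually_at_rightI[of 0 1]) (auto simp: mean_le_def)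
qed simp

lemma mean_le_add:
  fixes g h k :: "complex ^ 'n \<Rightarrow> complex"
  assumes q: "1 \<le> q" and r: "0 \<le> r" "r < 1"
    and cont: "continuous_on unit_ball g" "continuous_on unit_ball h" "continuous_on unit_ball k"
    and A: "0 \<le> A" "mean_le q r g A" and B: "0 \<le> B" "mean_le q r h B"
    and k: "\<And>\<zeta>. norm \<zeta> = 1 \<Longrightarrow> norm (k (r *\<^sub>R \<zeta>)) \<le> norm (g (r *\<^sub>R \<zeta>)) + norm (h (r *\<^sub>R \<zeta>))"
  shows "mean_le q r k (A + B)"
proof (rule mean_le_limit)
  fix \<epsilon> :: real assume e: "0 < \<epsilon>"
  note [measurable] = borel_measurable_dilate[OF cont(1) r] borel_measurable_dilate[OF cont(2) r]
     borel_measurable_dilate[OF cont(3) r]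
  define H where "H = (\<lambda>(b::bool) \<zeta>. if b then norm (g (r *\<^sub>R \<zeta>)) else norm (h (r *\<^sub>R \<zeta>)))"
  define C where "C = (\<lambda>(b::bool). if b then A + \<epsilon>/2 else B + \<epsilon>/2)"
  \<comment> \<open>the triangle inequality is Minkowski's inequality for counting measure on two points\<close>
  have UN: "(UNIV :: bool set) = {True, False}" by auto
  show "mean_le q r k (A + B + \<epsilon>)"
    unfolding mean_le_def
  proof (rule minkowski_integral_inequality[where \<nu>="count_space (UNIV::bool set)" and h=H and A=C])
    show "sigma_finite_measure (count_space (UNIV :: bool set))"
      by (simp add: sigma_finite_measure_count_space)
    show "sigma_finite_measure (sphere_measure :: (complex ^ 'n) measure)"
      by (rule sigma_finite_sphere_measure)
    show "(\<lambda>(t, x). H t x) \<in> borel_measurable (count_space UNIV \<Otimes>\<^sub>M sphere_measure)"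
      by (rule measurable_pair_measure_countable1) (auto simp: H_def)
    show "(\<integral>\<^sup>+t. ennreal (C t) \<partial>count_space UNIV) \<le> ennreal (A + B + \<epsilon>)"
      using A B e by (simp add: nn_integral_count_space_finite UN C_def ennreal_plus[symmetric] del: ennreal_plus)
    show "(\<integral>\<^sup>+x. ennreal (H t x powr q) \<partial>sphere_measure) \<le> ennreal (C t powr q)" for t
      using mean_le_mono[OF A(2), of "A + \<epsilon>/2" g] mean_le_mono[OF B(2), of "B + \<epsilon>/2" h] A B e q
      by (auto simp: H_def C_def mean_le_def)
    show "ennreal (norm (k (r *\<^sub>R x))) \<le> (\<integral>\<^sup>+t. ennreal (H t x) \<partial>count_space UNIV)"
      if "x \<in> space sphere_measure" for x
      using k[of x] that by (simp add: nn_integral_count_space_finite UN H_def ennreal_plus[symmetric] ennreal_leI del: ennreal_plus)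
  qed (use q A B e in \<open>auto simp: H_def C_def\<close>)
qed (use assms in auto)

section \<open>Reduction to finite exponents\<close>

text \<open>
  A bound for the exponent \<open>\<infinity>\<close> is encoded as the same bound for all finite exponents. The equivalence is
  \<open>pmean_le_iff\<close>; it lets all estimates be carried out for finite \<open>q\<close>, with constants that do not depend on \<open>q\<close>.
\<close>

definition finite_exponents :: "ennreal \<Rightarrow> real set" where
  "finite_exponents p = (if p = \<infinity> then {1..} else {enn2real p})"

lemma finite_exponents_ge_1: "1 \<le> p \<Longrightarrow> q \<in> finite_exponents p \<Longrightarrow> 1 \<le> q"
  by (cases p) (auto simp: finite_exponents_def split: if_splits)

text \<open>
  If \<open>u\<close> exceeded some \<open>c > A\<close> on a set of mass \<open>m > 0\<close>, then \<open>m c\<^sup>q \<le> A\<^sup>q\<close> for every \<open>q\<close>, although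
  \<open>(A / c)\<^sup>q\<close> tends to zero.
\<close>

lemma esssup_le_if_mean_le:
  fixes u :: "'a \<Rightarrow> real"
  assumes M: "emeasure M (space M) \<le> 1" and u[measurable]: "u \<in> borel_measurable M"
    and u0: "\<And>x. 0 \<le> u x" and A: "0 \<le> A"
    and le: "\<And>q. 1 \<le> q \<Longrightarrow> (\<integral>\<^sup>+x. ennreal (u x powr q) \<partial>M) \<le> ennreal (A powr q)"
  shows "esssup M (\<lambda>x. ennreal (u x)) \<le> ennreal A"
proof (rule ccontr)
  assume "\<not> ?thesis"
  then obtain c' where c': "ennreal A < c'" "c' < esssup M (\<lambda>x. ennreal (u x))"
    by (meson dense not_le)
  then have "c' < top" by (simp add: less_le_trans[OF _ top_greatest])
  then obtain c where c: "c' = ennreal c" "0 \<le> c" by (cases c') auto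
  have Ac: "A < c" using c' A c by (simp add: ennreal_less_iff)
  define E where "E = {x \<in> space M. ennreal (u x) > ennreal c}"
  have [measurable]: "E \<in> sets M" unfolding E_def by measurable
  have pos: "emeasure M E > 0"
    using esssup_pos_measure[of "\<lambda>x. ennreal (u x)" M c'] c' c by (simp add: E_def)
  have "emeasure M E \<le> 1"
    using emeasure_space[of M E] M by (rule order_trans)
  then obtain m where m: "emeasure M E = ennreal m" "0 < m"
    using pos by (cases "emeasure M E") (auto simp: top_unique)
  have bound: "m \<le> (A / c) powr q" if q: "1 \<le> q" for q
  proof -
    have "ennreal (c powr q * m) = (\<integral>\<^sup>+x. ennreal (c powr q) * indicator E x \<partial>M)"
      by (subst nn_integral_cmult_indicator) (use m in \<open>auto simp: ennreal_mult less_imp_le\<close>)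
    also have "\<dots> \<le> (\<integral>\<^sup>+x. ennreal (u x powr q) \<partial>M)"
      using c q u0 by (intro nn_integral_mono)
        (auto simp: E_def indicator_def ennreal_less_iff intro!: ennreal_leI powr_mono2)
    also have "\<dots> \<le> ennreal (A powr q)" by (rule le[OF q])
    finally have "c powr q * m \<le> A powr q" by (simp add: ennreal_le_iff)
    then show ?thesis using Ac A by (simp add: powr_divide field_simps)
  qed
  have "(\<lambda>k. (A / c) ^ Suc k) \<longlonglongrightarrow> 0"
    using A Ac by (intro LIMSEQ_Suc LIMSEQ_power_zero) auto
  moreover have "m \<le> (A / c) ^ Suc k" for k
  proof (cases "A = 0")
    case True then show ?thesis using bound[of 1] m by simp
  next
    case False
    then show ?thesis using bound[of "real (Suc k)"] A Ac powr_realpow[of "A / c" "Suc k"] by simp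
  qed
  ultimately have "m \<le> 0" by (intro LIMSEQ_le_const) auto
  then show False using m by simp
qed

lemma pmean_le_iff:
  fixes g :: "complex ^ 'n \<Rightarrow> complex"
  assumes g: "continuous_on unit_ball g" and r: "0 \<le> r" "r < 1" and p: "1 \<le> p" and A: "0 \<le> A"
  shows "pmean p r g \<le> ennreal A \<longleftrightarrow> (\<forall>q\<in>finite_exponents p. mean_le q r g A)"
proof (cases "p = \<infinity>")
  case True
  let ?u = "\<lambda>\<zeta>. norm (g (r *\<^sub>R \<zeta>))"
  have [measurable]: "?u \<in> borel_measurable sphere_measure"
    using borel_measurable_dilate[OF g r] by simp
  have "\<forall>q\<ge>1. mean_le q r g A" if "esssup sphere_measure (\<lambda>\<zeta>. ennreal (?u \<zeta>)) \<le> ennreal A"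
  proof (intro allI impI)
    fix q :: real assume q: "1 \<le> q"
    have "AE \<zeta> in sphere_measure. ennreal (?u \<zeta>) \<le> ennreal A"
      using esssup_AE[of "\<lambda>\<zeta>. ennreal (?u \<zeta>)" sphere_measure] that by (auto elim!: eventually_mono)
    then have "(\<integral>\<^sup>+\<zeta>. ennreal (?u \<zeta> powr q) \<partial>sphere_measure) \<le> (\<integral>\<^sup>+\<zeta>. ennreal (A powr q) \<partial>(sphere_measure :: (complex ^ 'n) measure))"
      using A q by (intro nn_integral_mono_AE) (auto elim!: eventually_mono simp: ennreal_le_iff intro!: ennreal_leI powr_mono2)
    also have "\<dots> \<le> ennreal (A powr q)"
      using mult_left_mono[OF emeasure_sphere_measure_le_1, of "ennreal (A powr q)"] by simp
    finally show "mean_le q r g A" by (simp add: mean_le_def)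
  qed
  moreover have "esssup sphere_measure (\<lambda>\<zeta>. ennreal (?u \<zeta>)) \<le> ennreal A" if "\<forall>q\<ge>1. mean_le q r g A"
    using that A by (intro esssup_le_if_mean_le emeasure_sphere_measure_le_1) (auto simp: mean_le_def)
  ultimately show ?thesis using True by (auto simp: pmean_def finite_exponents_def)
next
  case False
  define q where "q = enn2real p"
  have q: "1 \<le> q" using finite_exponents_ge_1[OF p, of q] False by (simp add: finite_exponents_def q_def)
  define J where "J = (\<integral>\<^sup>+ \<zeta>. ennreal (norm (g (r *\<^sub>R \<zeta>)) powr q) \<partial>sphere_measure)"
  have P: "pmean p r g = (if J = \<infinity> then \<infinity> else ennreal (enn2real J powr (1 / q)))"
    using False by (simp add: pmean_def q_def J_def Let_def)
  have "(pmean p r g \<le> ennreal A) = (J \<le> ennreal (A powr q))"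
  proof (cases J rule: ennreal_cases)
    case (real j)
    have "j powr (1/q) \<le> A \<longleftrightarrow> j \<le> A powr q"
      using real q A powr_mono2[of q "j powr (1/q)" A] powr_mono2[of "1/q" j "A powr q"]
      by (auto simp: powr_powr)
    then show ?thesis using real A by (simp add: P ennreal_le_iff)
  qed (simp add: P top_unique)
  then show ?thesis using False by (simp add: finite_exponents_def mean_le_def J_def q_def)
qed

section \<open>Averages over circles\<close>

definition circle_point :: "real \<Rightarrow> complex" where
  "circle_point \<theta> = exp (2 * of_real pi * \<i> * of_real \<theta>)"

lemma norm_circle_point [simp]: "norm (circle_point \<theta>) = 1"
  by (simp add: circle_point_def norm_exp_eq_Re)

lemma continuous_on_circle_point [continuous_intros]:
  "continuous_on S f \<Longrightarrow> continuous_on S (\<lambda>x. circle_point (f x))"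
  unfolding circle_point_def by (intro continuous_intros)

lemma circlepath_integral_average:
  assumes "(f has_contour_integral I) (circlepath 0 R)"
  shows "((\<lambda>\<theta>. f (R * circle_point \<theta>) * (R * circle_point \<theta>)) has_integral I / (2 * of_real pi * \<i>)) {0..1}"
proof -
  have "((\<lambda>x. f (circlepath 0 R x) * vector_derivative (circlepath 0 R) (at x within {0..1})) has_integral I) {0..1}"
    using assms by (simp add: has_contour_integral_def)
  from has_integral_mult_right[OF this, of "1 / (2 * of_real pi * \<i>)"]
  have *: "((\<lambda>x. 1 / (2 * of_real pi * \<i>) * (f (circlepath 0 R x) * vector_derivative (circlepath 0 R) (at x within {0..1})))
      has_integral I / (2 * of_real pi * \<i>)) {0..1}" by simp
  show ?thesis
    by (rule has_integral_eq[OF _ *])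
       (simp add: vector_derivative_circlepath01 circle_point_def, simp add: circlepath field_simps)
qed

lemma Cauchy_circle_average:
  assumes S: "open S" "cball 0 R \<subseteq> S" and hol: "\<phi> holomorphic_on S" and R: "0 < R" and w: "norm w < R"
  shows "((\<lambda>\<theta>. \<phi> (R * circle_point \<theta>) * (R * circle_point \<theta>) / (R * circle_point \<theta> - w))
     has_integral \<phi> w) {0..1}"
proof -
  have "((\<lambda>u. \<phi> u / (u - w)) has_contour_integral (2 * of_real pi * \<i> * \<phi> w)) (circlepath 0 R)"
  proof (rule Cauchy_integral_circlepath)
    show "continuous_on (cball 0 R) \<phi>"
      using S hol by (meson holomorphic_on_imp_continuous_on holomorphic_on_subset)
    show "\<phi> holomorphic_on ball 0 R"
      using S hol by (meson ball_subset_cball holomorphic_on_subset subset_trans)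
    show "norm (w - 0) < R" using w by simp
  qed
  from circlepath_integral_average[OF this] show ?thesis by simp
qed

lemma circle_point_nonzero [simp]: "circle_point \<theta> \<noteq> 0"
  by (simp add: circle_point_def)

lemma circle_average:
  assumes "open S" "cball 0 1 \<subseteq> S" "\<phi> holomorphic_on S"
  shows "((\<lambda>\<theta>. \<phi> (circle_point \<theta>)) has_integral \<phi> 0) {0..1}"
  using Cauchy_circle_average[OF assms, of 0] by simp

lemma norm_integral_le_nn_integral:
  fixes f :: "real \<Rightarrow> complex"
  assumes f: "(f has_integral I) {a..b}" and cont: "continuous_on {a..b} f"
  shows "ennreal (norm I) \<le> (\<integral>\<^sup>+t. ennreal (norm (f t)) * indicator {a..b} t \<partial>lborel)"
proof -
  have si: "set_integrable lborel {a..b} f" by (rule borel_integrable_atLeastAtMost'[OF cont])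
  have "I = (LINT t:{a..b}|lborel. f t)"
    using set_borel_integral_eq_integral(2)[OF si] f by (simp add: integral_unique)
  then have "ennreal (norm I) \<le> (\<integral>\<^sup>+t. norm (indicator {a..b} t *\<^sub>R f t) \<partial>lborel)"
    using integral_norm_bound_ennreal si unfolding set_integrable_def set_lebesgue_integral_def by blast
  also have "\<dots> = (\<integral>\<^sup>+t. ennreal (norm (f t)) * indicator {a..b} t \<partial>lborel)"
    by (intro nn_integral_cong) (auto split: split_indicator)
  finally show ?thesis .
qed

section \<open>Integral means and contractions\<close>

lemma inner_vec_complex: "inner u v = Re (hprod u v)" for u v :: "complex ^ 'n"
  by (simp add: inner_vec_def hprod_def inner_complex_def)

lemma hprod_smult_left: "hprod (c *s u) v = c * hprod u v"
  by (simp add: hprod_def sum_distrib_left mult.assoc)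

lemma hprod_diff_left: "hprod (u - w) v = hprod u v - hprod w v"
  by (simp add: hprod_def sum_subtractf left_diff_distrib)

lemma hprod_self: "hprod u u = of_real ((norm u)\<^sup>2)"
  by (simp add: hprod_def complex_norm_square[symmetric] norm_vec_def L2_set_def sum_nonneg)

lemma matrix_vector_mult_scale_complex: "A *v (c *s z) = c *s (A *v z)" for A :: "complex ^ 'n ^ 'm"
  by (simp add: vector_scalar_commute)

definition rank_one :: "complex ^ 'n \<Rightarrow> complex ^ 'n \<Rightarrow> complex ^ 'n ^ 'n" where
  "rank_one b x = (\<chi> i j. b $ i * cnj (x $ j))"

lemma rank_one_mult: "rank_one b x *v z = hprod z x *s b"
  by (simp add: rank_one_def matrix_vector_mult_def hprod_def vec_eq_iff sum_distrib_left mult_ac)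

lemma norm_add_sq_orthogonal:
  fixes u v :: "'a::real_inner"
  assumes "inner u v = 0"
  shows "(norm (u + v))\<^sup>2 = (norm u)\<^sup>2 + (norm v)\<^sup>2"
  using assms by (simp add: power2_norm_eq_inner inner_add inner_commute)

text \<open>
  A contraction that is not an isometry is the centre of a complex disc of contractions. Let \<open>x\<close> be a unit vector at
  which \<open>|Ax|\<close> attains its minimum \<open>m\<close>; then \<open>m < 1\<close>. Minimality forces \<open>A\<close> to map the orthogonal complement of \<open>x\<close>
  into that of \<open>Ax\<close>. Hence the image of \<open>x\<close> alone may be moved by \<open>1 - m\<close> along \<open>Ax\<close>, or along a vector orthogonal
  to the range of \<open>A\<close> if \<open>m = 0\<close>, without leaving the contractions.
\<close>

lemma contraction_rank_one_perturbation:
  fixes A :: "complex ^ 'n ^ 'n"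
  assumes contr: "\<And>z. norm (A *v z) \<le> norm z" and not_iso: "norm (A *v z0) \<noteq> norm z0"
  obtains b x where "b \<noteq> 0" "x \<noteq> 0" 
    "\<And>l z. norm l \<le> 1 \<Longrightarrow> norm (A *v z + (l * hprod z x) *s b) \<le> norm z"
proof -
  have contA: "continuous_on UNIV (\<lambda>z. A *v z)"
    by (simp add: linear_continuous_on)
  have "\<exists>x\<in>sphere 0 1. \<forall>y\<in>sphere 0 1. norm (A *v x) \<le> norm (A *v y)"
  proof (rule continuous_attains_inf)
    show "sphere (0::complex ^ 'n) 1 \<noteq> {}" by (simp add: sphere_eq_empty)
    show "continuous_on (sphere 0 1) (\<lambda>x. norm (A *v x))"
      by (intro continuous_intros continuous_on_subset[OF contA]) auto
  qed simp
  then obtain x where x: "norm x = 1" and xmin: "\<And>y. norm y = 1 \<Longrightarrow> norm (A *v x) \<le> norm (A *v y)"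
    by auto
  define m where "m = norm (A *v x)"
  have m0: "0 \<le> m" by (simp add: m_def)
  have mle: "m * norm z \<le> norm (A *v z)" for z
  proof (cases "z = 0")
    case False
    have "m \<le> norm (A *v ((1 / norm z) *\<^sub>R z))" unfolding m_def by (rule xmin) (use False in auto)
    also have "\<dots> = norm (A *v z) / norm z"
      by (simp only: scaleR_eq_smult matrix_vector_mult_scale_complex norm_vec_smult) (simp add: norm_divide)
    finally show ?thesis using False by (simp add: field_simps)
  qed simp
  have m1: "m < 1"
  proof (rule ccontr)
    assume "\<not> m < 1"
    then have "norm z0 \<le> m * norm z0" by (simp add: mult_le_cancel_right1)
    then show False using mle[of z0] contr[of z0] not_iso by linarith
  qed
  \<comment> \<open>the first-order condition for the minimum of \<open>|A(x + ty)|\<^sup>2 - m\<^sup>2 |x + ty|\<^sup>2\<close> at \<open>t = 0\<close>\<close>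
  have orth: "inner (A *v x) (A *v y) = 0" if y: "hprod y x = 0" for y
  proof (rule ccontr)
    define c where "c = inner (A *v x) (A *v y)"
    assume "inner (A *v x) (A *v y) \<noteq> 0"
    then have c: "c \<noteq> 0" by (simp add: c_def)
    have xy: "inner x y = 0" using y by (simp add: inner_vec_complex[of y x] inner_commute[of x y])
    define K where "K = (norm (A *v y))\<^sup>2"
    have *: "0 \<le> 2 * t * c + t\<^sup>2 * K" for t
    proof -
      have 1: "(norm (x + t *\<^sub>R y))\<^sup>2 = 1 + t\<^sup>2 * (norm y)\<^sup>2"
        using x xy by (subst norm_add_sq_orthogonal) (auto simp: power_mult_distrib)
      have "A *v (x + t *\<^sub>R y) = A *v x + t *\<^sub>R (A *v y)"
        by (simp add: matrix_vector_right_distrib scaleR_eq_smult matrix_vector_mult_scale_complex)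
      then have 2: "(norm (A *v (x + t *\<^sub>R y)))\<^sup>2 = m\<^sup>2 + 2 * t * c + t\<^sup>2 * K"
        unfolding m_def K_def c_def
        by (simp add: power2_norm_eq_inner inner_add inner_commute algebra_simps power2_eq_square[of t])
      have "m\<^sup>2 \<le> m\<^sup>2 * (norm (x + t *\<^sub>R y))\<^sup>2" unfolding 1 by (simp add: distrib_left)
      also have "\<dots> \<le> (norm (A *v (x + t *\<^sub>R y)))\<^sup>2"
        using mle[of "x + t *\<^sub>R y"] m0 by (metis norm_ge_zero power_mono power_mult_distrib zero_le_mult_iff)
      finally show ?thesis unfolding 2 by simp
    qed
    show False
    proof (cases "K = 0")
      case True
      then show False using *[of "-c"] c by (simp add: mult_less_0_iff) (metis mult_le_0_iff not_le zero_less_mult_iff linorder_neqE_linordered_idom less_eq_real_def)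
    next
      case False
      then have K: "K > 0" by (simp add: K_def)
      have "2 * (-c/K) * c + (-c/K)\<^sup>2 * K = - c\<^sup>2 / K" using K by (simp add: field_simps power2_eq_square)
      moreover have "c\<^sup>2 / K > 0" using K c by simp
      ultimately show False using *[of "-c/K"] by simp
    qed
  qed
  \<comment> \<open>a unit vector along \<open>Ax\<close>, or orthogonal to the range of \<open>A\<close> when \<open>Ax = 0\<close>\<close>
  obtain b where b: "norm b = 1" "A *v x = of_real m *s b"
    and borth: "\<And>y c. hprod y x = 0 \<Longrightarrow> inner (c *s b) (A *v y) = 0"
  proof (cases "m = 0")
    case True
    have lin: "linear (\<lambda>z. A *v z)" by (simp add: bounded_linear.linear)
    have "A *v x = 0" using True by (simp add: m_def)
    then have "\<not> inj (\<lambda>z. A *v z)" using x by (metis injD matrix_vector_mult_0_right norm_zero zero_neq_one)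
    then have "\<not> surj (\<lambda>z. A *v z)" using lin linear_surjective_imp_injective by blast
    moreover have sub: "subspace (range (\<lambda>z. A *v z))" using lin by (simp add: linear_subspace_image)
    ultimately have "dim (range (\<lambda>z. A *v z)) \<noteq> DIM(complex ^ 'n)"
      by (metis dim_eq_full span_eq_iff)
    then have "dim (range (\<lambda>z. A *v z)) < DIM(complex ^ 'n)"
      using dim_subset_UNIV[of "range (\<lambda>z. A *v z)"] by linarith
    then obtain b where b: "b \<noteq> 0" "\<And>y. y \<in> span (range (\<lambda>z. A *v z)) \<Longrightarrow> orthogonal b y"
      using orthogonal_to_subspace_exists by blast
    have ob: "inner (c *s b) (A *v y) = 0" for c y
    proof -
      have "inner (c *s b) (A *v y) = inner b (cnj c *s (A *v y))"
        by (simp add: inner_vec_complex hprod_def mult_ac)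
      also have "\<dots> = inner b (A *v (cnj c *s y))" by (simp add: matrix_vector_mult_scale_complex)
      also have "\<dots> = 0" using b(2) by (simp add: orthogonal_def span_base)
      finally show ?thesis .
    qed
    show thesis
    proof (rule that[of "(1 / norm b) *\<^sub>R b"])
      show "inner (c *s ((1 / norm b) *\<^sub>R b)) (A *v y) = 0" for y c
        using ob[of "c * of_real (1 / norm b)" y] by (simp add: scaleR_eq_smult)
    qed (use b True in \<open>auto simp: m_def\<close>)
  next
    case False
    show thesis
    proof (rule that[of "(1 / m) *\<^sub>R (A *v x)"])
      show "norm ((1 / m) *\<^sub>R (A *v x)) = 1" using False m0 by (simp add: m_def)
      show "A *v x = complex_of_real m *s ((1 / m) *\<^sub>R (A *v x))"
        using False by (simp add: scaleR_eq_smult vector_smult_assoc)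
      fix y c assume y: "hprod y x = 0"
      have "hprod ((cnj c * of_real (1/m)) *s y) x = 0" using y by (simp only: hprod_smult_left) simp
      then have "inner (A *v x) (A *v ((cnj c * of_real (1/m)) *s y)) = 0" by (rule orth)
      moreover have "inner (c *s ((1 / m) *\<^sub>R (A *v x))) (A *v y) = inner (A *v x) (A *v ((cnj c * of_real (1/m)) *s y))"
        by (simp add: matrix_vector_mult_scale_complex scaleR_eq_smult inner_vec_complex hprod_def mult_ac)
      ultimately show "inner (c *s ((1 / m) *\<^sub>R (A *v x))) (A *v y) = 0" by simp
    qed
  qed
  show thesis
  proof (rule that[of "of_real (1 - m) *s b" x])
    show "of_real (1 - m) *s b \<noteq> 0" using b(1) m1
      by (metis norm_vec_smult norm_zero mult_cancel_left2 norm_of_real abs_eq_0 less_irrefl diff_gt_0_iff_gt)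
    show "x \<noteq> 0" using x by auto
    fix l :: complex and z :: "complex ^ 'n" assume l: "norm l \<le> 1"
    define a where "a = hprod z x"
    define y where "y = z - a *s x"
    have z: "z = a *s x + y" by (simp add: y_def)
    have y0: "hprod y x = 0" using x by (simp add: y_def hprod_diff_left hprod_smult_left hprod_self a_def)
    define \<mu> where "\<mu> = of_real m + l * of_real (1 - m)"
    have eq: "A *v z + (l * hprod z x) *s (of_real (1 - m) *s b) = (a * \<mu>) *s b + A *v y"
      unfolding a_def[symmetric]
      by (subst z) (simp add: matrix_vector_right_distrib matrix_vector_mult_scale_complex b(2) \<mu>_def vec_eq_iff algebra_simps)
    have "norm \<mu> \<le> m + norm l * (1 - m)"
      unfolding \<mu>_def using m0 m1 norm_triangle_ineq[of "of_real m" "l * of_real (1 - m)"]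
      by (simp only: norm_mult norm_of_real)
    also have "\<dots> \<le> m + 1 * (1 - m)" using l m1 by (intro add_left_mono mult_right_mono) auto
    finally have mu: "norm \<mu> \<le> 1" by simp
    have "inner (a *s x) y = Re (cnj (hprod y (a *s x)))"
      by (subst inner_commute) (simp add: inner_vec_complex)
    also have "hprod y (a *s x) = cnj a * hprod y x" by (simp add: hprod_def sum_distrib_left mult_ac)
    finally have o2: "inner (a *s x) y = 0" by (simp add: y0)
    have "(norm ((a * \<mu>) *s b + A *v y))\<^sup>2 = (norm a * norm \<mu>)\<^sup>2 + (norm (A *v y))\<^sup>2"
      by (subst norm_add_sq_orthogonal[OF borth[OF y0]]) (simp add: b(1) norm_mult)
    also have "\<dots> \<le> (norm a * 1)\<^sup>2 + (norm y)\<^sup>2"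
      using mu by (intro add_mono power_mono mult_left_mono contr) auto
    also have "\<dots> = (norm z)\<^sup>2"
      unfolding z norm_add_sq_orthogonal[OF o2] by (simp add: x)
    finally show "norm (A *v z + (l * hprod z x) *s (of_real (1 - m) *s b)) \<le> norm z"
      unfolding eq by (rule power2_le_imp_le) simp
  qed
qed


definition contractions :: "(complex ^ 'n ^ 'n) set" where
  "contractions = {A. \<forall>z. norm (A *v z) \<le> norm z}"

lemma continuous_on_matrix_vector_mult:
  fixes f :: "'a::topological_space \<Rightarrow> complex ^ 'n ^ 'm"
  assumes "continuous_on S f" "continuous_on S g"
  shows "continuous_on S (\<lambda>x. f x *v g x)"
  unfolding matrix_vector_mult_def by (intro continuous_intros assms)

lemma compact_contractions: "compact (contractions :: (complex ^ 'n ^ 'n) set)"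
proof -
  have "closed {A :: complex ^ 'n ^ 'n. norm (A *v z) \<le> norm z}" for z
    by (intro closed_Collect_le continuous_intros continuous_on_matrix_vector_mult)
  then have "closed (\<Inter>z. {A :: complex ^ 'n ^ 'n. norm (A *v z) \<le> norm z})" by blast
  moreover have "(\<Inter>z. {A :: complex ^ 'n ^ 'n. norm (A *v z) \<le> norm z}) = contractions"
    by (auto simp: contractions_def)
  moreover have "bounded (contractions :: (complex ^ 'n ^ 'n) set)"
  proof (rule boundedI)
    fix A :: "complex ^ 'n ^ 'n" assume A: "A \<in> contractions"
    have "norm (A $ i $ j) \<le> 1" for i j
    proof -
      have "A $ i $ j = (A *v axis j 1) $ i"
        by (simp add: matrix_vector_mult_def axis_def if_distrib cong: if_cong)
      also have "norm \<dots> \<le> norm (A *v axis j 1)" by (rule Finite_Cartesian_Product.norm_nth_le)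
      also have "\<dots> \<le> norm (axis j (1::complex))" using A unfolding contractions_def by blast
      also have "\<dots> = 1" by (simp add: norm_axis_1)
      finally show ?thesis .
    qed
    then have "norm (A $ i) \<le> CARD('n)" for i
      unfolding norm_vec_def by (intro order_trans[OF L2_set_le_sum]) (auto intro!: sum_bounded_above[where K=1, simplified])
    then show "norm A \<le> (\<Sum>i\<in>(UNIV::'n set). real CARD('n))"
      unfolding norm_vec_def[of A] by (intro order_trans[OF L2_set_le_sum] sum_mono) auto
  qed
  ultimately show ?thesis by (simp add: compact_eq_bounded_closed)
qed

lemma line_holomorphicD:
  assumes "g \<in> line_holomorphic"
  shows "continuous_on unit_ball g"
    and "(\<lambda>c. g (z + c *s v)) holomorphic_on {c. z + c *s v \<in> unit_ball}"
  using assms by (auto simp: line_holomorphic_def)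

lemma open_line_slice: "open {c. z + c *s (v :: complex ^ 'n) \<in> unit_ball}"
proof -
  have "open ((\<lambda>c. z + c *s v) -` unit_ball)"
    by (intro open_vimage continuous_intros) auto
  then show ?thesis by (simp add: vimage_def)
qed

text \<open>
  A maximum principle in the space of matrices. The mean \<open>v(T)\<close> of \<open>g \<circ> T\<close> is continuous in \<open>T\<close> and lies below its
  averages over circles of matrices. Adding \<open>\<epsilon> |T|\<^sup>2\<close> makes this inequality strict, so the maximum over the compact
  set of contractions is not attained at the centre of a disc of contractions. By \<open>contraction_rank_one_perturbation\<close>
  it is attained at an isometry, where \<open>v\<close> takes the value \<open>v(1)\<close> because \<open>\<sigma>\<close> is invariant. Letting \<open>\<epsilon>\<close> tend to zero
  gives \<open>v(T) \<le> v(1)\<close>.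
\<close>

lemma nn_integral_contraction_le:
  fixes g :: "complex ^ 'n \<Rightarrow> complex" and T :: "complex ^ 'n ^ 'n"
  assumes g: "g \<in> line_holomorphic" and \<rho>: "0 \<le> \<rho>" "\<rho> < 1" and q: "1 \<le> q"
    and T: "T \<in> contractions" and C: "0 \<le> C" "mean_le q \<rho> g C"
  shows "(\<integral>\<^sup>+\<zeta>. ennreal (norm (g (\<rho> *\<^sub>R (T *v \<zeta>))) powr q) \<partial>sphere_measure) \<le> ennreal (C powr q)"
proof -
  interpret finite_measure "sphere_measure :: (complex ^ 'n) measure" by (rule finite_measure_sphere_measure)
  note gc = line_holomorphicD(1)[OF g]
  have sub: "cball 0 \<rho> \<subseteq> (unit_ball :: (complex ^ 'n) set)" using \<rho> by auto
  have "bounded (g ` cball 0 \<rho>)"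
    by (intro compact_imp_bounded compact_continuous_image continuous_on_subset[OF gc sub]) simp
  then obtain M where M: "\<And>z. norm z \<le> \<rho> \<Longrightarrow> norm (g z) \<le> M"
    by (force simp: bounded_iff)
  have inball: "norm (\<rho> *\<^sub>R (A *v \<zeta>)) \<le> \<rho>" if "A \<in> contractions" "norm \<zeta> = 1" for A and \<zeta> :: "complex ^ 'n"
  proof -
    have "norm (A *v \<zeta>) \<le> 1" using that by (metis (mono_tags) contractions_def mem_Collect_eq)
    then show ?thesis using \<rho> by (simp add: mult_left_le)
  qed
  have inball': "\<rho> *\<^sub>R (A *v \<zeta>) \<in> unit_ball" if "A \<in> contractions" "norm \<zeta> = 1" for A and \<zeta> :: "complex ^ 'n"
    using inball[OF that] \<rho> by simp
  define F where "F = (\<lambda>(A :: complex ^ 'n ^ 'n) \<zeta>. norm (g (\<rho> *\<^sub>R (A *v \<zeta>))) powr q)"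
  define I where "I = (\<lambda>A. LINT \<zeta>|sphere_measure. F A \<zeta>)"
  have gAc: "continuous_on (contractions \<times> sphere 0 1) (\<lambda>(A, \<zeta>). g (\<rho> *\<^sub>R (A *v \<zeta>)))"
    unfolding split_def
    by (rule continuous_on_compose2[OF gc])
       (auto intro!: continuous_intros continuous_on_matrix_vector_mult inball' simp del: mem_ball_0 norm_scaleR)
  have gA1: "continuous_on (sphere 0 1) (\<lambda>\<zeta>. g (\<rho> *\<^sub>R (A *v \<zeta>)))" if "A \<in> contractions" for A
    using continuous_on_compose2[OF gAc continuous_on_Pair[OF continuous_on_const[of _ A] continuous_on_id], of "sphere 0 1"] that
    by auto
  have Fm[measurable]: "F A \<in> borel_measurable sphere_measure" if "A \<in> contractions" for A
    using measurable_sphere_measure[OF gA1[OF that]] by (simp add: F_def)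
  have Fle: "F A \<zeta> \<le> M powr q" if "A \<in> contractions" "norm \<zeta> = 1" for A \<zeta>
    using M[OF inball[OF that]] q by (auto simp: F_def intro!: powr_mono2)
  have Fint: "integrable sphere_measure (F A)" if "A \<in> contractions" for A
    by (rule integrable_const_bound[where B="M powr q"])
       (use Fle that Fm in \<open>auto simp: F_def intro!: AE_I2\<close>)
  have I: "(\<integral>\<^sup>+\<zeta>. ennreal (F A \<zeta>) \<partial>sphere_measure) = ennreal (I A)" "0 \<le> I A" if "A \<in> contractions" for A
    using nn_integral_eq_integral[OF Fint[OF that]] by (auto simp: I_def F_def)
  have Icont: "continuous_on contractions I"
    unfolding continuous_on_sequentially comp_def I_def
  proof (intro allI ballI impI, elim conjE)
    fix x and a :: "complex ^ 'n ^ 'n"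
    assume a: "a \<in> contractions" and x: "\<forall>n. x n \<in> contractions" and lim: "x \<longlonglongrightarrow> a"
    show "(\<lambda>n. LINT \<zeta>|sphere_measure. F (x n) \<zeta>) \<longlonglongrightarrow> (LINT \<zeta>|sphere_measure. F a \<zeta>)"
    proof (rule integral_dominated_convergence[where w="\<lambda>_. M powr q"])
      show "AE \<zeta> in sphere_measure. (\<lambda>i. F (x i) \<zeta>) \<longlonglongrightarrow> F a \<zeta>"
      proof (rule AE_I2)
        fix \<zeta> :: "complex ^ 'n" assume "\<zeta> \<in> space sphere_measure"
        then have z: "norm \<zeta> = 1" by simp
        have "continuous_on contractions (\<lambda>A. F A \<zeta>)"
          unfolding F_def using q
          by (intro continuous_on_powr' continuous_intros continuous_on_compose2[OF gc] continuous_on_matrix_vector_mult)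
             (use z in \<open>auto intro!: inball' simp del: mem_ball_0 norm_scaleR\<close>)
        then show "(\<lambda>i. F (x i) \<zeta>) \<longlonglongrightarrow> F a \<zeta>"
          using a x lim unfolding continuous_on_sequentially comp_def by blast
      qed
    qed (use a x Fle Fm in \<open>auto simp: F_def intro!: AE_I2\<close>)
  qed
  define v where "v = (\<lambda>A. I A powr (1/q))"
  have vcont: "continuous_on contractions v"
    unfolding v_def using I q by (intro continuous_on_powr' continuous_intros Icont) auto
  have v0: "0 \<le> v A" for A by (simp add: v_def)
  have vq: "v A powr q = I A" if "A \<in> contractions" for A
    using I(2)[OF that] q by (simp add: v_def powr_powr)
  have v_iff: "I A \<le> c powr q \<longleftrightarrow> v A \<le> c" if "A \<in> contractions" "0 \<le> c" for A c
    using vq[OF that(1)] v0[of A] that q powr_mono2[of q "v A" c] powr_less_mono2[of q c "v A"]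
    by (metis less_le_trans not_less zero_less_one zero_le_one order_trans less_eq_real_def)
  have one: "mat 1 \<in> contractions" by (simp add: contractions_def)
  have max_iso: "v A \<le> v (mat 1)" if A: "A \<in> contractions" "\<And>z. norm (A *v z) = norm z" for A
  proof -
    have m: "(\<lambda>\<zeta>. ennreal (F (mat 1) \<zeta>)) \<in> borel_measurable sphere_measure" using Fm[OF one] by simp
    have "(\<integral>\<^sup>+\<zeta>. ennreal (F (mat 1) (A *v \<zeta>)) \<partial>sphere_measure) = (\<integral>\<^sup>+\<zeta>. ennreal (F (mat 1) \<zeta>) \<partial>sphere_measure)"
      by (rule nn_integral_sphere_measure_isometry[OF _ A(2) m]) (simp add: bounded_linear.linear)
    moreover have "F (mat 1) (A *v \<zeta>) = F A \<zeta>" for \<zeta> by (simp add: F_def)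
    ultimately have "ennreal (I A) = ennreal (I (mat 1))" using I(1)[OF A(1)] I(1)[OF one] by simp
    then show ?thesis using I(2)[OF A(1)] I(2)[OF one] by (simp add: v_def)
  qed
  \<comment> \<open>a common bound for \<open>|A|\<^sup>2\<close>, which makes the penalty vanish with \<open>\<epsilon>\<close>\<close>
  define N where "N = (SOME N. \<forall>A\<in>(contractions :: (complex ^ 'n ^ 'n) set). (norm A)\<^sup>2 \<le> N)"
  have N: "(norm A)\<^sup>2 \<le> N" if "A \<in> contractions" for A :: "complex ^ 'n ^ 'n"
  proof -
    obtain B where "\<forall>A\<in>(contractions :: (complex ^ 'n ^ 'n) set). norm A \<le> B"
      using compact_imp_bounded[OF compact_contractions] by (auto simp: bounded_iff)
    then have "\<exists>N. \<forall>A\<in>(contractions :: (complex ^ 'n ^ 'n) set). (norm A)\<^sup>2 \<le> N"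
      by (intro exI[of _ "B\<^sup>2"]) (auto intro!: power_mono)
    from someI_ex[OF this] that show ?thesis unfolding N_def by blast
  qed
  have key: "v T + \<epsilon> * (norm T)\<^sup>2 \<le> v (mat 1) + \<epsilon> * N" if e: "0 < \<epsilon>" for \<epsilon>
  proof -
    have "\<exists>A\<in>contractions. \<forall>B\<in>contractions. v B + \<epsilon> * (norm B)\<^sup>2 \<le> v A + \<epsilon> * (norm A)\<^sup>2"
      using one by (intro continuous_attains_sup compact_contractions continuous_intros vcont) auto
    then obtain A where A: "A \<in> contractions" 
      and max: "\<And>B. B \<in> contractions \<Longrightarrow> v B + \<epsilon> * (norm B)\<^sup>2 \<le> v A + \<epsilon> * (norm A)\<^sup>2" by blast
    have "norm (A *v z0) = norm z0" for z0
    proof (rule ccontr)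
      assume nz: "norm (A *v z0) \<noteq> norm z0"
      obtain b x where bx: "b \<noteq> 0" "x \<noteq> 0"
        and pert: "\<And>l z. norm l \<le> 1 \<Longrightarrow> norm (A *v z + (l * hprod z x) *s b) \<le> norm z"
        using contraction_rank_one_perturbation[of A z0] A nz by (auto simp: contractions_def)
      define L where "L = (\<lambda>l. rank_one (l *s b) x)"
      have Lv: "(A + L l) *v z = A *v z + (l * hprod z x) *s b" for l z
        by (simp add: L_def matrix_vector_mult_add_rdistrib rank_one_mult vec_eq_iff)
      have Lin: "A + L l \<in> contractions" if "norm l \<le> 1" for l
        using pert[OF that] by (simp add: contractions_def Lv)
      have Llin: "bounded_linear L"
        by (rule linear_conv_bounded_linear[THEN iffD1], rule linearI)
           (auto simp: L_def rank_one_def vec_eq_iff algebra_simps)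
      have normL: "(norm (L l))\<^sup>2 = (norm l)\<^sup>2 * (norm (L 1))\<^sup>2" for l
        by (simp add: L_def rank_one_def norm_vec_def L2_set_def norm_mult power_mult_distrib sum_nonneg sum_distrib_left mult_ac)
      have "L 1 *v x \<noteq> 0" using bx by (simp add: L_def rank_one_mult hprod_self vec_eq_iff)
      then have L1: "norm (L 1) > 0" by auto
      define \<kappa> where "\<kappa> = \<epsilon> * (norm (L 1))\<^sup>2"
      have \<kappa>: "\<kappa> > 0" using e L1 by (simp add: \<kappa>_def)
      \<comment> \<open>maximality bounds \<open>v\<close> on the circle by \<open>a - \<kappa>/2\<close>; the linear term averages to zero, and \<open>\<kappa>/2\<close> of the gain is kept to make \<open>a\<close> positive\<close>
      define a where "a = (\<lambda>\<theta>. v A - \<kappa> / 2 - 2 * \<epsilon> * inner A (L (circle_point \<theta>)))"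
      have va: "v (A + L (circle_point \<theta>)) + \<kappa> / 2 \<le> a \<theta>" for \<theta>
        using max[OF Lin[of "circle_point \<theta>"]] normL[of "circle_point \<theta>"]
        by (simp add: a_def \<kappa>_def power2_norm_eq_inner inner_add inner_commute algebra_simps)
      have a0: "a \<theta> > 0" for \<theta> using va[of \<theta>] v0[of "A + L (circle_point \<theta>)"] \<kappa> by linarith
      have "((\<lambda>\<theta>. circle_point \<theta>) has_integral 0) {0..1}"
        using circle_average[of UNIV "\<lambda>z. z"] by simp
      from has_integral_linear[OF this bounded_linear_inner_right_comp[OF Llin, of A]]
      have "((\<lambda>\<theta>. inner A (L (circle_point \<theta>))) has_integral 0) {0..1}"
        by (simp add: comp_def linear_0[OF bounded_linear.linear[OF Llin]])
      from has_integral_diff[OF has_integral_const_real[of "v A - \<kappa> / 2" 0 1] has_integral_mult_right[OF this, of "2 * \<epsilon>"]]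
      have aint: "(a has_integral (v A - \<kappa> / 2)) {0..1}"
        by (simp add: a_def[abs_def])
      have acont: "continuous_on UNIV a"
        unfolding a_def by (intro continuous_intros bounded_linear.continuous_on[OF Llin])
      have "\<kappa> / 2 \<le> a \<theta>" for \<theta> using va[of \<theta>] v0[of "A + L (circle_point \<theta>)"] by linarith
      then have "\<kappa> / 2 \<le> v A - \<kappa> / 2"
        using has_integral_le[OF has_integral_const_real[of "\<kappa> / 2" 0 1] aint] by simp
      then have W: "v A - \<kappa> / 2 > 0" using \<kappa> by linarith
      have "mean_le q \<rho> (\<lambda>z. g (A *v z)) (v A - \<kappa> / 2)"
      proof (rule mean_le_integral[where S="{0..1}" and h="\<lambda>\<theta> \<zeta>. norm (g (\<rho> *\<^sub>R ((A + L (circle_point \<theta>)) *v \<zeta>)))" and A=a])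
        show "continuous_on ({0..1} \<times> sphere 0 1) (\<lambda>(\<theta>, \<zeta>). norm (g (\<rho> *\<^sub>R ((A + L (circle_point \<theta>)) *v \<zeta>))))"
        proof -
          have 1: "continuous_on ({0..1::real} \<times> sphere (0::complex ^ 'n) 1) (\<lambda>p. (A + L (circle_point (fst p)), snd p))"
            by (intro continuous_intros bounded_linear.continuous_on[OF Llin])
          have 2: "(\<lambda>p. (A + L (circle_point (fst p)), snd p)) ` ({0..1::real} \<times> sphere (0::complex ^ 'n) 1) \<subseteq> contractions \<times> sphere 0 1"
            by (auto intro!: Lin)
          show ?thesis
            using continuous_on_norm[OF continuous_on_compose2[OF gAc 1 2]] by (simp add: split_def)
        qed
        show "a \<in> borel_measurable borel" by (rule borel_measurable_continuous_onI[OF acont])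
        show "(\<integral>\<^sup>+\<theta>. ennreal (a \<theta>) * indicator {0..1} \<theta> \<partial>lborel) \<le> ennreal (v A - \<kappa> / 2)"
          using nn_integral_has_integral_lebesgue'[OF _ aint] a0 by (simp add: less_imp_le)
        show "(\<integral>\<^sup>+\<zeta>. ennreal (norm (g (\<rho> *\<^sub>R ((A + L (circle_point \<theta>)) *v \<zeta>))) powr q) \<partial>sphere_measure) \<le> ennreal (a \<theta> powr q)"
          for \<theta>
        proof -
          have B: "A + L (circle_point \<theta>) \<in> contractions" by (rule Lin) simp
          have "I (A + L (circle_point \<theta>)) \<le> a \<theta> powr q"
            using v_iff[OF B, of "a \<theta>"] a0[of \<theta>] va[of \<theta>] \<kappa> by linarith
          then show ?thesis using I(1)[OF B] by (simp add: F_def ennreal_leI)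
        qed
        show "continuous_on unit_ball (\<lambda>z. g (A *v z))"
        proof (rule continuous_on_compose2[OF gc])
          show "continuous_on unit_ball ((*v) A)" by (simp add: linear_continuous_on)
          have "norm (A *v z) < 1" if "norm z < 1" for z
            using A that unfolding contractions_def by (metis (mono_tags) le_less_trans mem_Collect_eq)
          then show "(*v) A ` unit_ball \<subseteq> unit_ball" by auto
        qed
        fix \<zeta> :: "complex ^ 'n" assume z: "norm \<zeta> = 1"
        let ?z = "\<rho> *\<^sub>R (A *v \<zeta>)" and ?w = "\<rho> *\<^sub>R (hprod \<zeta> x *s b)"
        have shift: "?z + l *s ?w = \<rho> *\<^sub>R ((A + L l) *v \<zeta>)" for l
          unfolding Lv by (simp add: scaleR_eq_smult vec_eq_iff algebra_simps)
        define S where "S = {l. ?z + l *s ?w \<in> unit_ball}"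
        have "?z + l *s ?w \<in> unit_ball" if "norm l \<le> 1" for l
          unfolding shift by (rule inball'[OF Lin[OF that] z])
        then have S: "cball 0 1 \<subseteq> S" by (auto simp: S_def simp del: mem_ball_0)
        have hol: "(\<lambda>l. g (?z + l *s ?w)) holomorphic_on S"
          unfolding S_def by (rule line_holomorphicD(2)[OF g])
        have "((\<lambda>\<theta>. g (?z + circle_point \<theta> *s ?w)) has_integral g ?z) {0..1}"
          using circle_average[OF _ S hol] open_line_slice[of ?z ?w] by (simp add: S_def)
        moreover have "continuous_on {0..1} (\<lambda>\<theta>. g (?z + circle_point \<theta> *s ?w))"
          by (rule continuous_on_compose2[OF holomorphic_on_imp_continuous_on[OF hol]])
             (use S in \<open>auto intro!: continuous_intros\<close>)
        ultimately have "ennreal (norm (g ?z)) \<le> (\<integral>\<^sup>+\<theta>. ennreal (norm (g (?z + circle_point \<theta> *s ?w))) * indicator {0..1} \<theta> \<partial>lborel)"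
          by (rule norm_integral_le_nn_integral)
        then show "ennreal (norm (g (A *v (\<rho> *\<^sub>R \<zeta>))))
            \<le> (\<integral>\<^sup>+\<theta>. ennreal (norm (g (\<rho> *\<^sub>R ((A + L (circle_point \<theta>)) *v \<zeta>)))) * indicator {0..1} \<theta> \<partial>lborel)"
          by (simp add: shift scaleR_eq_smult[of \<rho> \<zeta>] matrix_vector_mult_scale_complex flip: scaleR_eq_smult[of \<rho> "A *v \<zeta>"])
      qed (use q W \<rho> a0 in auto)
      then have "ennreal (I A) \<le> ennreal ((v A - \<kappa> / 2) powr q)"
        using I(1)[OF A]
        by (simp add: mean_le_def F_def scaleR_eq_smult matrix_vector_mult_scale_complex)
      then have "I A \<le> (v A - \<kappa> / 2) powr q" by (simp add: ennreal_le_iff)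
      then show False using v_iff[OF A, of "v A - \<kappa> / 2"] W \<kappa> by linarith
    qed
    then have "v A \<le> v (mat 1)" by (rule max_iso[OF A])
    moreover have "\<epsilon> * (norm A)\<^sup>2 \<le> \<epsilon> * N" using N[OF A] e by simp
    ultimately show ?thesis using max[OF T] by linarith
  qed
  have "v T \<le> v (mat 1)"
  proof (rule field_le_epsilon)
    fix e :: real assume e: "0 < e"
    have N0: "0 \<le> N" using N[OF one] zero_le_power2 order_trans by blast
    have "v T \<le> v (mat 1) + e / (N + 1) * N" using key[of "e / (N + 1)"] e N0
      by (smt (verit) divide_pos_pos zero_le_mult_iff zero_le_power2)
    also have "e / (N + 1) * N \<le> e" using e N0 by (simp add: field_simps)
    finally show "v T \<le> v (mat 1) + e" by simp
  qed
  also have "v (mat 1) \<le> C"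
  proof -
    have "ennreal (I (mat 1)) \<le> ennreal (C powr q)"
      using C(2) I(1)[OF one] by (simp add: mean_le_def F_def)
    then show ?thesis using v_iff[OF one C(1)] by (simp add: ennreal_le_iff)
  qed
  finally have "I T \<le> C powr q" using v_iff[OF T C(1)] by simp
  then show ?thesis using I(1)[OF T] by (simp add: F_def ennreal_leI)
qed

section \<open>Homogeneous expansions\<close>

lemma power_series_coefficients_unique:
  fixes a b :: "nat \<Rightarrow> complex"
  assumes r: "0 < r" and a: "\<And>c. norm c < r \<Longrightarrow> (\<lambda>k. a k * c ^ k) sums h c"
    and b: "\<And>c. norm c < r \<Longrightarrow> (\<lambda>k. b k * c ^ k) sums h c"
  shows "a = b"
proof -
  define z :: complex where "z = of_real (r / 2)"
  have z: "norm z < r" "0 < norm z" using r by (auto simp: z_def)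
  have ev: "eval_fps (Abs_fps u) c = h c"
    if u: "\<And>c. norm c < r \<Longrightarrow> (\<lambda>k. u k * c ^ k) sums h c" and c: "norm c < r" for u c
    using u[OF c] by (simp add: eval_fps_def sums_iff)
  have rad: "fps_conv_radius (Abs_fps u) > 0"
    if u: "\<And>c. norm c < r \<Longrightarrow> (\<lambda>k. u k * c ^ k) sums h c" for u
  proof -
    have "ereal (norm z) \<le> fps_conv_radius (Abs_fps u)"
      using u[OF z(1)] unfolding fps_conv_radius_def by (intro conv_radius_geI) (simp add: sums_iff)
    moreover have "0 < ereal (norm z)" using z by simp
    ultimately show ?thesis by (rule less_le_trans[rotated])
  qed
  have "\<forall>\<^sub>F c in nhds 0. norm c < r"
    using r by (auto simp: eventually_nhds_metric dist_norm)
  then have "\<forall>\<^sub>F c in nhds 0. eval_fps (Abs_fps a) c = eval_fps (Abs_fps b) c"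
    by eventually_elim (simp add: ev[OF a] ev[OF b])
  then have "Abs_fps a = Abs_fps b" by (intro eval_fps_eqD rad) (use a b in auto)
  then show ?thesis by (simp add: fps_eq_iff fun_eq_iff)
qed

text \<open>
  The coefficient of \<open>c\<^sup>k\<close> in the Taylor series of \<open>c \<mapsto> f(cz)\<close>. It is defined for all \<open>z\<close>, since only
  small \<open>c\<close> matter, and \<open>hom_part_eq_slice_coeff\<close> shows that it is the homogeneous part of degree \<open>k\<close>.
\<close>

definition slice_coeff :: "(complex ^ 'n \<Rightarrow> complex) \<Rightarrow> nat \<Rightarrow> complex ^ 'n \<Rightarrow> complex" where
  "slice_coeff f k z = (deriv ^^ k) (\<lambda>c. f (c *s z)) 0 / fact k"

lemma slice_holomorphic:
  assumes "f \<in> line_holomorphic"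
  shows "(\<lambda>c. f (c *s z)) holomorphic_on {c. c *s z \<in> unit_ball}"
  using line_holomorphicD(2)[OF assms, of 0 z] by simp

lemma open_slice: "open {c. c *s (z :: complex ^ 'n) \<in> unit_ball}"
  using open_line_slice[of 0 z] by simp

lemma slice_coeff_sums:
  assumes f: "f \<in> line_holomorphic" and c: "norm (c *s z) < 1"
  shows "(\<lambda>k. slice_coeff f k z * c ^ k) sums f (c *s z)"
proof -
  define r where "r = (if z = 0 then norm c + 1 else 1 / norm z)"
  have sub: "ball 0 r \<subseteq> {c. c *s z \<in> unit_ball}"
    by (auto simp: r_def field_simps split: if_splits)
  have "c \<in> ball 0 r" using c by (auto simp: r_def field_simps)
  from holomorphic_power_series[OF holomorphic_on_subset[OF slice_holomorphic[OF f] sub] this]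
  have "(\<lambda>k. (deriv ^^ k) (\<lambda>c. f (c *s z)) 0 / fact k * (c - 0) ^ k) sums f (c *s z)" .
  then show ?thesis by (simp add: slice_coeff_def)
qed

lemma slice_coeff_homogeneous:
  assumes f: "f \<in> line_holomorphic"
  shows "slice_coeff f k (a *s z) = a ^ k * slice_coeff f k z"
proof -
  have "(deriv ^^ k) (\<lambda>c. f ((a * c) *s z)) 0 = a ^ k * (deriv ^^ k) (\<lambda>c. f (c *s z)) (a * 0)"
    by (rule higher_deriv_compose_linear[OF slice_holomorphic[OF f] open_slice[of "a *s z"] open_slice])
       (auto simp: vector_smult_assoc norm_mult mult_ac)
  then show ?thesis by (simp add: slice_coeff_def vector_smult_assoc mult.commute)
qed

text \<open>
  Cauchy's inequality on the unit circle gives the bound for \<open>|z| = \<rho>\<close>; homogeneity extends it to all \<open>z\<close>.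
\<close>

lemma slice_coeff_bound:
  assumes f: "f \<in> line_holomorphic" and \<rho>: "0 < \<rho>" "\<rho> < 1"
    and M: "\<And>z. norm z \<le> \<rho> \<Longrightarrow> norm (f z) \<le> M"
  shows "norm (slice_coeff f k z) \<le> M * (norm z / \<rho>) ^ k"
proof (cases "z = 0")
  case True
  have "slice_coeff f k (0 *s 0) = 0 ^ k * slice_coeff f k 0" by (rule slice_coeff_homogeneous[OF f])
  moreover have "slice_coeff f 0 0 = f 0" by (simp add: slice_coeff_def)
  ultimately show ?thesis using M[of 0] \<rho> True by (cases k) auto
next
  case False
  define w where "w = of_real (\<rho> / norm z) *s z"
  have w: "norm w = \<rho>" using False \<rho> by (simp add: w_def norm_divide)
  have z: "z = of_real (norm z / \<rho>) *s w" using False \<rho> by (simp add: w_def vector_smult_assoc)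
  have sub: "cball 0 1 \<subseteq> {c. c *s w \<in> unit_ball}" using \<rho> w
    by (auto simp: intro: le_less_trans[OF mult_left_le_one_le])
  have hol: "(\<lambda>c. f (c *s w)) holomorphic_on cball 0 1"
    by (rule holomorphic_on_subset[OF slice_holomorphic[OF f] sub])
  have "norm ((deriv ^^ k) (\<lambda>c. f (c *s w)) 0) \<le> fact k * M / 1 ^ k"
    by (rule Cauchy_inequality)
       (use w \<rho> in \<open>auto intro!: holomorphic_on_imp_continuous_on[OF hol] holomorphic_on_subset[OF hol] M\<close>)
  then have "norm (slice_coeff f k w) \<le> M" by (simp add: slice_coeff_def norm_divide field_simps)
  then have "(norm z / \<rho>) ^ k * norm (slice_coeff f k w) \<le> (norm z / \<rho>) ^ k * M"
    using \<rho> by (intro mult_left_mono) auto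
  moreover have "norm (slice_coeff f k z) = (norm z / \<rho>) ^ k * norm (slice_coeff f k w)"
    by (subst z, subst slice_coeff_homogeneous[OF f]) (use \<rho> in \<open>simp add: norm_mult norm_power norm_divide\<close>)
  ultimately show ?thesis by (simp add: mult.commute)
qed

lemma line_holomorphic_bounded:
  assumes f: "f \<in> line_holomorphic" and "\<rho> < 1"
  obtains M where "0 \<le> M" "\<And>z. norm z \<le> \<rho> \<Longrightarrow> norm (f z) \<le> M"
proof -
  have "bounded (f ` cball 0 \<rho>)"
    by (intro compact_imp_bounded compact_continuous_image continuous_on_subset[OF line_holomorphicD(1)[OF f]])
       (use assms in auto)
  then obtain M where "\<And>z. norm z \<le> \<rho> \<Longrightarrow> norm (f z) \<le> M" by (force simp: bounded_iff)
  then show thesis by (intro that[of "max M 0"]) (auto simp: le_max_iff_disj)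
qed

definition entire_lines :: "(complex ^ 'n \<Rightarrow> complex) set" where
  "entire_lines = {g. continuous_on UNIV g \<and> (\<forall>z v. (\<lambda>c. g (z + c *s v)) holomorphic_on UNIV)}"

lemma line_holomorphic_uniform_limit:
  fixes H :: "nat \<Rightarrow> complex ^ 'n \<Rightarrow> complex"
  assumes H: "\<And>j. continuous_on (ball 0 R) (H j)" "\<And>j z v. (\<lambda>c. H j (z + c *s v)) holomorphic_on {c. z + c *s v \<in> ball 0 R}"
    and lim: "\<And>r. r < R \<Longrightarrow> uniform_limit (cball 0 r) H G sequentially"
  shows "continuous_on (ball 0 R) G" "(\<lambda>c. G (z + c *s v)) holomorphic_on {c. z + c *s v \<in> ball 0 R}"
proof -
  show "continuous_on (ball 0 R) G"
  proof (rule continuous_at_imp_continuous_on, rule ballI)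
    fix x :: "complex ^ 'n" assume x: "x \<in> ball 0 R"
    define r where "r = (norm x + R) / 2"
    have r: "norm x < r" "r < R" using x by (auto simp: r_def field_simps)
    have "continuous_on (cball 0 r) G"
      by (rule uniform_limit_theorem[OF _ lim[OF r(2)]])
         (use r in \<open>auto intro!: always_eventually continuous_on_subset[OF H(1)]\<close>)
    then have "continuous_on (ball 0 r) G" by (rule continuous_on_subset) auto
    then show "isCont G x" using r by (simp add: continuous_on_eq_continuous_at)
  qed
  let ?S = "{c. z + c *s v \<in> ball 0 R}"
  have opn: "open {c. z + c *s v \<in> ball 0 r}" for r
  proof -
    have "open ((\<lambda>c. z + c *s v) -` ball 0 r)" by (intro open_vimage continuous_intros) auto
    then show ?thesis by (simp add: vimage_def)
  qed
  show "(\<lambda>c. G (z + c *s v)) holomorphic_on ?S"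
  proof (rule holomorphic_uniform_sequence[where f="\<lambda>j c. H j (z + c *s v)"])
    fix c assume c: "c \<in> ?S"
    define r where "r = (norm (z + c *s v) + R) / 2"
    have r: "norm (z + c *s v) < r" "r < R" using c by (auto simp: r_def field_simps)
    obtain d where d: "0 < d" "cball c d \<subseteq> {c. z + c *s v \<in> ball 0 r}"
      using opn[of r] r by (auto simp: open_contains_cball)
    have sub: "cball c d \<subseteq> ?S" using d(2) r by (auto simp: dist_norm subset_iff)
    have "uniform_limit (cball c d) (\<lambda>j c. H j (z + c *s v)) (\<lambda>c. G (z + c *s v)) sequentially"
    proof (rule uniform_limitI)
      fix e :: real assume "0 < e"
      from uniform_limitD[OF lim[OF r(2)] this]
      show "\<forall>\<^sub>F n in sequentially. \<forall>x\<in>cball c d. dist (H n (z + x *s v)) (G (z + x *s v)) < e"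
        by eventually_elim (use d(2) in \<open>force simp: subset_iff\<close>)
    qed
    with d(1) sub show "\<exists>d>0. cball c d \<subseteq> ?S \<and> uniform_limit (cball c d) (\<lambda>j c. H j (z + c *s v)) (\<lambda>c. G (z + c *s v)) sequentially"
      by blast
  qed (use opn H(2) in auto)
qed

lemma entire_linesD:
  assumes "g \<in> entire_lines"
  shows "continuous_on S g" "(\<lambda>c. g (z + c *s v)) holomorphic_on A"
  using assms by (auto simp: entire_lines_def intro: continuous_on_subset holomorphic_on_subset)

text \<open>
  Near a given point, dividing by a large \<open>t\<close> moves everything into the ball of radius \<open>R\<close>, at the
  expense of the constant factor \<open>t\<^sup>k\<close>.
\<close>

lemma entire_lines_homogeneous_extension:
  fixes G :: "complex ^ 'n \<Rightarrow> complex"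
  assumes R: "0 < R" and hom: "\<And>a z. G (a *s z) = a ^ k * G z"
    and G: "continuous_on (ball 0 R) G" "\<And>z v. (\<lambda>c. G (z + c *s v)) holomorphic_on {c. z + c *s v \<in> ball 0 R}"
  shows "G \<in> entire_lines"
proof -
  have scale: "G z = of_real t ^ k * G (of_real (1/t) *s z)" if "0 < t" for t z
    using that by (subst hom[symmetric]) (simp add: vector_smult_assoc)
  have "continuous_on UNIV G"
  proof (rule continuous_at_imp_continuous_on, rule ballI)
    fix x :: "complex ^ 'n"
    define t where "t = norm x / R + 1"
    have t: "0 < t" using R by (simp add: t_def add_nonneg_pos)
    have img: "(\<lambda>z. of_real (1/t) *s z) ` ball 0 (t * R) \<subseteq> (ball 0 R :: (complex ^ 'n) set)"
      using t by (auto simp: norm_divide divide_less_eq mult.commute)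
    have "continuous_on (ball 0 (t * R)) (\<lambda>z. of_real t ^ k * G (of_real (1/t) *s z))"
      by (intro continuous_on_mult continuous_on_const continuous_on_compose2[OF G(1) _ img]
           continuous_on_smult continuous_on_id)
    then have "continuous_on (ball 0 (t * R)) G" unfolding scale[OF t, symmetric] .
    moreover have "norm x < t * R" using R by (simp add: t_def field_simps)
    ultimately show "isCont G x" by (simp add: continuous_on_eq_continuous_at)
  qed
  moreover have "(\<lambda>c. G (z + c *s v)) holomorphic_on UNIV" for z v
  proof (rule holomorphic_on_open[THEN iffD2], simp, rule ballI)
    fix c0 :: complex
    define t where "t = norm (z + c0 *s v) / R + 1"
    have t: "0 < t" using R by (simp add: t_def add_nonneg_pos)
    let ?S = "{c. of_real (1/t) *s z + c *s (of_real (1/t) *s v) \<in> ball 0 R}"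
    have S: "open ?S"
    proof -
      have "open ((\<lambda>c. of_real (1/t) *s z + c *s (of_real (1/t) *s v)) -` ball 0 R)"
        by (intro open_vimage continuous_intros) auto
      then show ?thesis by (simp add: vimage_def)
    qed
    have eq: "of_real (1/t) *s z + c *s (of_real (1/t) *s v) = of_real (1/t) *s (z + c *s v)" for c
      by (simp add: vec_eq_iff algebra_simps)
    have "norm (z + c0 *s v) < t * R" using R by (simp add: t_def field_simps)
    then have "norm (complex_of_real (1/t) *s (z + c0 *s v)) < R"
      unfolding norm_vec_smult using t by (simp add: norm_divide field_simps)
    then have c0: "c0 \<in> ?S" by (simp only: mem_Collect_eq eq mem_ball_0)
    have "(\<lambda>c. of_real t ^ k * G (of_real (1/t) *s z + c *s (of_real (1/t) *s v))) holomorphic_on ?S"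
      by (intro holomorphic_intros G(2))
    then have "(\<lambda>c. G (z + c *s v)) holomorphic_on ?S" unfolding eq scale[OF t, symmetric] .
    then show "\<exists>f'. ((\<lambda>c. G (z + c *s v)) has_field_derivative f') (at c0)"
      using c0 S holomorphic_on_open by blast
  qed
  ultimately show ?thesis by (simp add: entire_lines_def)
qed

text \<open>
  Induction on \<open>k\<close>: on \<open>|z| < 1/2\<close> the coefficient is the uniform limit, as \<open>c\<close> tends to zero, of the difference
  quotients \<open>(f(cz) - \<Sum>\<^sub>m\<^sub><\<^sub>k c\<^sup>m f\<^sub>m(z)) / c\<^sup>k\<close>, which are continuous and holomorphic on complex lines.
\<close>

lemma slice_coeff_entire_lines:
  assumes f: "f \<in> line_holomorphic"
  shows "slice_coeff f k \<in> entire_lines"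
proof (induction k rule: less_induct)
  case (less k)
  obtain M where M: "0 \<le> M" "\<And>z. norm z \<le> 1/2 \<Longrightarrow> norm (f z) \<le> M"
    using line_holomorphic_bounded[OF f, of "1/2"] by auto
  \<comment> \<open>the values of \<open>c\<close>; at most \<open>1/2\<close>, so that the tail is dominated by a geometric series\<close>
  define s where "s = (\<lambda>j::nat. 1 / real (j + 2))"
  have s: "0 < s j" "s j \<le> 1/2" for j by (auto simp: s_def field_simps)
  define H where "H = (\<lambda>j z. (f (of_real (s j) *s z) - (\<Sum>m<k. slice_coeff f m z * of_real (s j) ^ m)) / of_real (s j) ^ k)"
  have inb: "of_real (s j) *s z \<in> unit_ball" if "z \<in> ball 0 (1/2)" for j and z :: "complex ^ 'n"
    using that s[of j] mult_mono[of "s j" "1/2" "norm z" "1/2"] by (simp add: norm_mult)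
  have lim: "uniform_limit (cball 0 r) H (slice_coeff f k) sequentially" if r: "r < 1/2" for r
  proof (rule uniform_limitI)
    fix e :: real assume e: "0 < e"
    have est: "norm (H j z - slice_coeff f k z) \<le> s j * (2 * M)" if z: "norm z \<le> 1/2" for z j
    proof -
      have "norm (of_real (s j) *s z) \<le> 1/2 * (1/2)"
        unfolding norm_vec_smult by (rule mult_mono) (use s[of j] z in auto)
      then have "(\<lambda>m. slice_coeff f m z * of_real (s j) ^ m) sums f (of_real (s j) *s z)"
        by (intro slice_coeff_sums[OF f]) simp
      from sums_split_initial_segment[OF this, of "Suc k"]
      have "(\<lambda>m. slice_coeff f (m + Suc k) z * of_real (s j) ^ (m + Suc k)) sums
         (f (of_real (s j) *s z) - (\<Sum>m<Suc k. slice_coeff f m z * of_real (s j) ^ m))" .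
      from sums_divide[OF this, of "of_real (s j) ^ k"]
      have sums: "(\<lambda>m. slice_coeff f (m + Suc k) z * of_real (s j) ^ Suc m) sums (H j z - slice_coeff f k z)"
        using s(1)[of j] by (simp add: H_def diff_divide_distrib power_add mult.assoc[symmetric] add_divide_distrib diff_diff_eq)
      have bd: "norm (slice_coeff f (m + Suc k) z * of_real (s j) ^ Suc m) \<le> M * s j * (1/2) ^ m" for m
      proof -
        have "norm (slice_coeff f (m + Suc k) z) \<le> M * (norm z / (1/2)) ^ (m + Suc k)"
          by (rule slice_coeff_bound[OF f _ _ M(2)]) auto
        also have "\<dots> \<le> M * 1" using z M(1) by (intro mult_left_mono power_le_one) auto
        finally have "norm (slice_coeff f (m + Suc k) z) \<le> M" by simp
        moreover have "norm ((of_real (s j) :: complex) ^ Suc m) \<le> s j * (1/2) ^ m"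
          using s[of j] by (simp add: norm_mult norm_power mult_left_mono power_mono)
        ultimately show ?thesis
          unfolding norm_mult mult.assoc using M(1) by (intro mult_mono) auto
      qed
      have gs: "(\<lambda>m. M * s j * (1/2) ^ m) sums (M * s j * (1 / (1 - 1/2)))"
        by (intro sums_mult geometric_sums) simp
      have "norm (\<Sum>m. slice_coeff f (m + Suc k) z * of_real (s j) ^ Suc m) \<le> (\<Sum>m. M * s j * (1/2) ^ m)"
        by (rule norm_suminf_le) (use bd gs in \<open>auto simp: sums_iff\<close>)
      then show ?thesis using sums gs by (simp add: sums_iff mult_ac)
    qed
    have "s \<longlonglongrightarrow> 0" unfolding s_def
      by (rule LIMSEQ_ignore_initial_segment[OF lim_1_over_n])
    then have "(\<lambda>j. s j * (2 * M)) \<longlonglongrightarrow> 0 * (2 * M)" by (intro tendsto_intros)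
    then have "\<forall>\<^sub>F j in sequentially. s j * (2 * M) < e" using e by (simp add: order_tendsto_iff)
    then show "\<forall>\<^sub>F j in sequentially. \<forall>z\<in>cball 0 r. dist (H j z) (slice_coeff f k z) < e"
    proof eventually_elim
      case (elim j)
      have "dist (H j z) (slice_coeff f k z) < e" if "norm z \<le> r" for z
        using est[of z j] that r elim by (simp add: dist_norm)
      then show ?case by simp
    qed
  qed
  have Hc: "continuous_on (ball 0 (1/2)) (H j)" for j
  proof -
    have img: "(\<lambda>z. of_real (s j) *s z) ` ball 0 (1/2) \<subseteq> (unit_ball :: (complex ^ 'a) set)" using inb by blast
    show ?thesis unfolding H_def using s(1)[of j]
      by (intro continuous_on_divide continuous_on_diff continuous_on_sum continuous_on_mult continuous_on_const
           continuous_on_compose2[OF line_holomorphicD(1)[OF f] _ img] continuous_on_smult continuous_on_id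
           entire_linesD(1)[OF less.IH]) auto
  qed
  have Hh: "(\<lambda>c. H j (z + c *s v)) holomorphic_on {c. z + c *s v \<in> ball 0 (1/2)}" for j z v
  proof -
    have eq: "of_real (s j) *s (z + c *s v) = of_real (s j) *s z + c *s (of_real (s j) *s v)" for c
      by (simp add: vec_eq_iff algebra_simps)
    have "(\<lambda>c. f (of_real (s j) *s (z + c *s v))) holomorphic_on {c. z + c *s v \<in> ball 0 (1/2)}"
      unfolding eq
    proof (rule holomorphic_on_subset[OF line_holomorphicD(2)[OF f]], rule subsetI)
      fix c assume "c \<in> {c. z + c *s v \<in> ball 0 (1/2)}"
      then have "of_real (s j) *s (z + c *s v) \<in> unit_ball" by (intro inb) (simp only: mem_Collect_eq)
      then show "c \<in> {c. of_real (s j) *s z + c *s (of_real (s j) *s v) \<in> unit_ball}"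
        by (simp only: mem_Collect_eq eq)
    qed
    then show ?thesis unfolding H_def using s(1)[of j]
      by (intro holomorphic_intros entire_linesD(2)[OF less.IH]) auto
  qed
  show ?case
    by (rule entire_lines_homogeneous_extension[where R="1/2" and k=k])
       (use line_holomorphic_uniform_limit[OF Hc Hh lim] slice_coeff_homogeneous[OF f] in auto)
qed


text \<open>
  Generated from monomials by addition, so that closure under products and the grading by degree follow by
  induction instead of by rearranging families of coefficients.
\<close>

inductive polynomial_fun :: "(complex ^ 'n \<Rightarrow> complex) \<Rightarrow> bool" where
  monomial: "polynomial_fun (\<lambda>z. c * (\<Prod>i\<in>UNIV. (z $ i) ^ a i))"
| add: "polynomial_fun P \<Longrightarrow> polynomial_fun Q \<Longrightarrow> polynomial_fun (\<lambda>z. P z + Q z)"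

lemma polynomial_fun_const: "polynomial_fun (\<lambda>z :: complex ^ 'n. c)"
  using polynomial_fun.monomial[of c "\<lambda>_. 0"] by simp

lemma polynomial_fun_coord: "polynomial_fun (\<lambda>z :: complex ^ 'n. z $ i)"
proof -
  have "(\<Prod>j\<in>UNIV. (z $ j) ^ (if j = i then 1 else 0)) = z $ i" for z :: "complex ^ 'n"
    by (simp add: if_distrib[of "(^) _"] cong: if_cong)
  then show ?thesis using polynomial_fun.monomial[of 1 "\<lambda>j. if j = i then 1 else 0"] by simp
qed

lemma polynomial_fun_mult:
  assumes "polynomial_fun P" "polynomial_fun Q"
  shows "polynomial_fun (\<lambda>z. P z * Q z)"
  using assms
proof (induction P rule: polynomial_fun.induct)
  case (monomial c a)
  show ?case using \<open>polynomial_fun Q\<close>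
  proof (induction Q rule: polynomial_fun.induct)
    case (monomial d b)
    show ?case using polynomial_fun.monomial[of "c * d" "\<lambda>i. a i + b i"]
      by (simp add: power_add prod.distrib mult_ac)
  next
    case (add P Q)
    then show ?case using polynomial_fun.add by (fastforce simp: distrib_left)
  qed
next
  case (add P R)
  then show ?case using polynomial_fun.add by (fastforce simp: distrib_right)
qed

lemma polynomial_fun_sum:
  "finite A \<Longrightarrow> (\<And>x. x \<in> A \<Longrightarrow> polynomial_fun (P x)) \<Longrightarrow> polynomial_fun (\<lambda>z. \<Sum>x\<in>A. P x z)"
  by (induction A rule: finite_induct) (auto intro: polynomial_fun_const polynomial_fun.add)

lemma polynomial_fun_prod:
  "finite A \<Longrightarrow> (\<And>x. x \<in> A \<Longrightarrow> polynomial_fun (P x)) \<Longrightarrow> polynomial_fun (\<lambda>z. \<Prod>x\<in>A. P x z)"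
  by (induction A rule: finite_induct) (auto intro: polynomial_fun_const polynomial_fun_mult)

definition lagrange_basis :: "nat \<Rightarrow> nat \<Rightarrow> complex \<Rightarrow> complex" where
  "lagrange_basis k a w = (\<Prod>b\<in>{..k} - {a}. (w - of_nat b) / (of_nat a - of_nat b))"

lemma lagrange_interpolation:
  fixes c :: "nat \<Rightarrow> complex"
  assumes u: "\<And>w. u w = (\<Sum>j\<le>k. c j * w ^ j)"
  shows "u w = (\<Sum>a\<le>k. u (of_nat a) * lagrange_basis k a w)"
proof -
  define p where "p = (\<Sum>j\<le>k. monom (c j) j)"
  define q where "q = (\<Sum>a\<le>k. smult (u (of_nat a)) (\<Prod>b\<in>{..k} - {a}. smult (1 / (of_nat a - of_nat b)) [:- of_nat b, 1:]))"
  have p: "poly p x = u x" for x by (simp add: p_def u poly_sum poly_monom)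
  have q: "poly q x = (\<Sum>a\<le>k. u (of_nat a) * lagrange_basis k a x)" for x
    by (simp add: q_def poly_sum poly_prod lagrange_basis_def diff_divide_distrib)
  have "p = q"
  proof (rule poly_eqI_degree[where A="of_nat ` {..k}"])
    fix x :: complex assume "x \<in> of_nat ` {..k}"
    then obtain m where m: "x = of_nat m" "m \<le> k" by auto
    have "lagrange_basis k a x = (if a = m then 1 else 0)" if "a \<le> k" for a
      using that m by (auto simp: lagrange_basis_def prod_zero_iff)
    then have "poly q x = (\<Sum>a\<le>k. u (of_nat a) * (if a = m then 1 else 0))" unfolding q by (intro sum.cong) auto
    also have "\<dots> = u x" using m by (simp add: if_distrib cong: if_cong)
    finally show "poly p x = poly q x" by (simp add: p)
  next
    have card: "card (of_nat ` {..k} :: complex set) = k + 1" by (subst card_image) (auto intro: inj_onI)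
    have "degree p \<le> k" unfolding p_def by (intro degree_sum_le) (auto intro: order_trans[OF degree_monom_le])
    then show "degree p < card (of_nat ` {..k} :: complex set)" unfolding card by simp
    have "degree q \<le> k" unfolding q_def
    proof (intro degree_sum_le)
      fix a assume a: "a \<in> {..k}"
      have "degree (\<Prod>b\<in>{..k} - {a}. smult (1 / (of_nat a - of_nat b)) [:- of_nat b, 1 :: complex:])
          \<le> (\<Sum>b\<in>{..k} - {a}. degree (smult (1 / (of_nat a - of_nat b)) [:- of_nat b, 1 :: complex:]))"
        by (rule order_trans[OF degree_prod_sum_le]) (simp_all only: comp_def finite_Diff finite_atMost order_refl)
      also have "\<dots> \<le> (\<Sum>b\<in>{..k} - {a}. 1)" by (intro sum_mono order_trans[OF degree_smult_le]) simp
      also have "\<dots> = k" using a by simp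
      finally show "degree (smult (u (of_nat a)) (\<Prod>b\<in>{..k} - {a}. smult (1 / (of_nat a - of_nat b)) [:- of_nat b, 1:])) \<le> k"
        by (meson degree_smult_le order_trans)
    qed simp
    then show "degree q < card (of_nat ` {..k} :: complex set)" unfolding card by simp
  qed
  then show ?thesis using p q by metis
qed

definition set_coord :: "'n \<Rightarrow> complex \<Rightarrow> complex ^ 'n \<Rightarrow> complex ^ 'n" where
  "set_coord i w z = (\<chi> j. if j = i then w else z $ j)"

lemma set_coord_nth: "set_coord i w z $ j = (if j = i then w else z $ j)"
  by (simp add: set_coord_def)

text \<open>
  Interpolation at \<open>0, \<dots>, k\<close> in one coordinate expresses \<open>P\<close> by functions that no longer depend on this coordinate,
  multiplied by polynomials in it. The induction removes one coordinate at a time.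
\<close>

lemma polynomial_fun_if_coordinatewise:
  fixes P :: "complex ^ 'n \<Rightarrow> complex"
  assumes "finite S" and "\<And>i z. \<exists>c. \<forall>w. P (set_coord i w z) = (\<Sum>j\<le>k. c j * w ^ j)"
    and "\<And>z z'. (\<forall>j\<in>S. z $ j = z' $ j) \<Longrightarrow> P z = P z'"
  shows "polynomial_fun P"
  using assms
proof (induction S arbitrary: P rule: finite_induct)
  case empty
  have "P z = P 0" for z by (rule empty.prems(2)) simp
  then have "P = (\<lambda>z. P 0)" by blast
  then show ?case by (rule ssubst[where P=polynomial_fun]) (rule polynomial_fun_const)
next
  case (insert i S)
  have lag: "P z = (\<Sum>a\<le>k. P (set_coord i (of_nat a) z) * lagrange_basis k a (z $ i))" for z
  proof -
    obtain c where c: "\<And>w. P (set_coord i w z) = (\<Sum>j\<le>k. c j * w ^ j)" using insert.prems(1) by blast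
    have "set_coord i (z $ i) z = z" by (simp add: set_coord_def vec_eq_iff)
    then show ?thesis using lagrange_interpolation[OF c, of "z $ i"] by simp
  qed
  have "polynomial_fun (\<lambda>z. P (set_coord i (of_nat a) z))" for a :: nat
  proof (rule insert.IH)
    fix i' and z :: "complex ^ 'n"
    show "\<exists>c. \<forall>w. P (set_coord i (of_nat a) (set_coord i' w z)) = (\<Sum>j\<le>k. c j * w ^ j)"
    proof (cases "i' = i")
      case True
      then have "set_coord i (of_nat a) (set_coord i' w z) = set_coord i (of_nat a) z" for w
        by (simp add: set_coord_def vec_eq_iff)
      moreover have "(\<Sum>j\<le>k. (if j = 0 then C else 0) * w ^ j) = C" for C w :: complex
        by (simp add: if_distrib[of "\<lambda>x. x * _"] cong: if_cong)
      ultimately show ?thesis 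
        by (intro exI[of _ "\<lambda>j. if j = 0 then P (set_coord i (of_nat a) z) else 0"]) simp
    next
      case False
      then have "set_coord i (of_nat a) (set_coord i' w z) = set_coord i' w (set_coord i (of_nat a) z)" for w
        by (auto simp: set_coord_def vec_eq_iff)
      then show ?thesis using insert.prems(1) by simp
    qed
  next
    fix z z' :: "complex ^ 'n" assume "\<forall>j\<in>S. z $ j = z' $ j"
    then show "P (set_coord i (of_nat a) z) = P (set_coord i (of_nat a) z')"
      by (intro insert.prems(2)) (auto simp: set_coord_nth)
  qed
  moreover have "polynomial_fun (\<lambda>z :: complex ^ 'n. lagrange_basis k a (z $ i))" for a
    unfolding lagrange_basis_def diff_conv_add_uminus divide_inverse
    by (intro polynomial_fun_prod polynomial_fun_mult polynomial_fun.add polynomial_fun_coord polynomial_fun_const) simp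
  ultimately have "polynomial_fun (\<lambda>z. \<Sum>a\<le>k. P (set_coord i (of_nat a) z) * lagrange_basis k a (z $ i))"
    by (intro polynomial_fun_sum polynomial_fun_mult) auto
  moreover have "P = (\<lambda>z. \<Sum>a\<le>k. P (set_coord i (of_nat a) z) * lagrange_basis k a (z $ i))" using lag by blast
  ultimately show ?case by (rule ssubst[where P=polynomial_fun, rotated])
qed

lemma finite_multi_index: "finite {a :: 'n::finite \<Rightarrow> nat. (\<Sum>i\<in>UNIV. a i) = k}"
proof -
  have "{a :: 'n \<Rightarrow> nat. (\<Sum>i\<in>UNIV. a i) = k} \<subseteq> PiE UNIV (\<lambda>_. {..k})"
    by (auto simp: PiE_def extensional_def intro: member_le_sum)
  then show ?thesis by (rule finite_subset) (simp add: finite_PiE)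
qed

lemma homogeneous_poly_add:
  assumes "homogeneous_poly k P" "homogeneous_poly k Q"
  shows "homogeneous_poly k (\<lambda>z. P z + Q z)"
proof -
  from assms obtain c d where "\<forall>z. P z = (\<Sum>a\<in>{a. (\<Sum>i\<in>UNIV. a i) = k}. c a * (\<Prod>i\<in>UNIV. (z $ i) ^ a i))"
    "\<forall>z. Q z = (\<Sum>a\<in>{a. (\<Sum>i\<in>UNIV. a i) = k}. d a * (\<Prod>i\<in>UNIV. (z $ i) ^ a i))"
    unfolding homogeneous_poly_def by blast
  then show ?thesis unfolding homogeneous_poly_def
    by (intro exI[of _ "\<lambda>a. c a + d a"]) (simp add: sum.distrib distrib_right)
qed

lemma homogeneous_poly_zero: "homogeneous_poly k (\<lambda>z. 0)"
  unfolding homogeneous_poly_def by (intro exI[of _ "\<lambda>_. 0"]) simp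

lemma homogeneous_poly_scale:
  assumes "homogeneous_poly k P"
  shows "P (t *s z) = t ^ k * P z"
proof -
  obtain c where c: "\<And>z. P z = (\<Sum>a\<in>{a. (\<Sum>i\<in>UNIV. a i) = k}. c a * (\<Prod>i\<in>UNIV. (z $ i) ^ a i))"
    using assms unfolding homogeneous_poly_def by blast
  have "(\<Prod>i\<in>UNIV. ((t *s z) $ i) ^ a i) = t ^ k * (\<Prod>i\<in>UNIV. (z $ i) ^ a i)" if "(\<Sum>i\<in>UNIV. a i) = k" for a
    using that by (simp add: power_mult_distrib prod.distrib power_sum[symmetric])
  then show ?thesis unfolding c sum_distrib_left by (intro sum.cong) (auto simp: mult_ac)
qed

lemma polynomial_fun_graded:
  assumes "polynomial_fun P"
  shows "\<exists>K G. (\<forall>z. P z = (\<Sum>k\<le>K. G k z)) \<and> (\<forall>k. homogeneous_poly k (G k)) \<and> (\<forall>k>K. G k = (\<lambda>z. 0))"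
  using assms
proof induction
  case (monomial c a)
  define K where "K = (\<Sum>i\<in>UNIV. a i)"
  define m where "m = (\<lambda>z :: complex ^ 'a. c * (\<Prod>i\<in>UNIV. (z $ i) ^ a i))"
  have m: "homogeneous_poly K m"
    unfolding homogeneous_poly_def m_def
    by (intro exI[of _ "\<lambda>b. if b = a then c else 0"])
       (simp add: finite_multi_index K_def if_distrib[of "\<lambda>x. x * _"] cong: if_cong)
  define G where "G = (\<lambda>k. if k = K then m else (\<lambda>z. 0))"
  have "homogeneous_poly k (G k)" for k using m by (simp add: G_def homogeneous_poly_zero)
  moreover have "m z = (\<Sum>k\<le>K. G k z)" for z
    by (simp add: G_def if_distrib[of "\<lambda>f. f _"] cong: if_cong)
  moreover have "\<forall>k>K. G k = (\<lambda>z. 0)" by (simp add: G_def)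
  ultimately show ?case unfolding m_def by blast
next
  case (add P Q)
  then obtain K G L H where 1: "\<And>z. P z = (\<Sum>k\<le>K. G k z)" "\<And>k. homogeneous_poly k (G k)" "\<And>k. k > K \<Longrightarrow> G k = (\<lambda>z. 0)"
    and 2: "\<And>z. Q z = (\<Sum>k\<le>L. H k z)" "\<And>k. homogeneous_poly k (H k)" "\<And>k. k > L \<Longrightarrow> H k = (\<lambda>z. 0)" by auto
  have P: "P z = (\<Sum>k\<le>max K L. G k z)" for z
    unfolding 1(1) by (rule sum.mono_neutral_left) (use 1(3) in auto)
  have Q: "Q z = (\<Sum>k\<le>max K L. H k z)" for z
    unfolding 2(1) by (rule sum.mono_neutral_left) (use 2(3) in auto)
  show ?case
    by (intro exI[of _ "max K L"] exI[of _ "\<lambda>k z. G k z + H k z"])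
       (auto simp: P Q sum.distrib 1(3) 2(3) intro: homogeneous_poly_add 1(2) 2(2))
qed

text \<open>
  Comparing the coefficients of \<open>t\<^sup>k\<close> in \<open>P(tz) = t\<^sup>k P(z)\<close> singles out the component of degree \<open>k\<close>.
\<close>

lemma polynomial_fun_homogeneous:
  assumes P: "polynomial_fun P" and hom: "\<And>t z. P (t *s z) = t ^ k * P z"
  shows "homogeneous_poly k P"
proof -
  obtain K G where 1: "\<And>z. P z = (\<Sum>k\<le>K. G k z)" "\<And>k. homogeneous_poly k (G k)" "\<And>k. k > K \<Longrightarrow> G k = (\<lambda>z. 0)"
    using polynomial_fun_graded[OF P] by blast
  have "P z = G k z" for z
  proof -
    have a: "(\<lambda>j. G j z * t ^ j) sums (t ^ k * P z)" for t
    proof -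
      have "(\<lambda>j. G j z * t ^ j) sums (\<Sum>j\<le>K. G j z * t ^ j)"
        by (rule sums_finite) (use 1(3) in auto)
      moreover have "(\<Sum>j\<le>K. G j z * t ^ j) = P (t *s z)"
        unfolding 1(1) by (simp add: homogeneous_poly_scale[OF 1(2)] mult.commute)
      ultimately show ?thesis by (simp add: hom)
    qed
    have b: "(\<lambda>j. (if j = k then P z else 0) * t ^ j) sums (t ^ k * P z)" for t
    proof -
      have "(\<lambda>j. (if j = k then P z else 0) * t ^ j) = (\<lambda>j. if j = k then t ^ j * P z else 0)" by auto
      then show ?thesis using sums_single[of k "\<lambda>j. t ^ j * P z"] by simp
    qed
    have "(\<lambda>j. G j z) = (\<lambda>j. if j = k then P z else 0)"
      by (rule power_series_coefficients_unique[of 1 _ "\<lambda>t. t ^ k * P z"]) (use a b in auto)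
    then show ?thesis by (metis (full_types))
  qed
  then have "P = G k" by blast
  then show ?thesis using 1(2) by simp
qed

text \<open>
  Along a coordinate direction the coefficient is an entire function of one variable that grows at most like
  \<open>|w|\<^sup>k\<close>; by Liouville's theorem it is a polynomial of degree at most \<open>k\<close> there.
\<close>

lemma homogeneous_poly_slice_coeff:
  fixes f :: "complex ^ 'n \<Rightarrow> complex"
  assumes f: "f \<in> line_holomorphic"
  shows "homogeneous_poly k (slice_coeff f k)"
proof (rule polynomial_fun_homogeneous)
  show "polynomial_fun (slice_coeff f k)"
  proof (rule polynomial_fun_if_coordinatewise[where S=UNIV and k=k])
    fix i and z :: "complex ^ 'n"
    obtain M where M: "0 \<le> M" "\<And>z. norm z \<le> 1/2 \<Longrightarrow> norm (f z) \<le> M"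
      using line_holomorphic_bounded[OF f, of "1/2"] by auto
    define z0 where "z0 = set_coord i 0 z"
    define g where "g = (\<lambda>w. slice_coeff f k (z0 + w *s axis i 1))"
    have eq: "set_coord i w z = z0 + w *s axis i 1" for w
      by (simp add: z0_def set_coord_def vec_eq_iff axis_def)
    have "g holomorphic_on UNIV" unfolding g_def by (rule entire_linesD(2)[OF slice_coeff_entire_lines[OF f]])
    moreover have "norm (g w) \<le> (M * 4 ^ k) * norm w ^ k" if "norm z0 \<le> norm w" for w
    proof -
      have "norm (z0 + w *s axis i 1) \<le> 2 * norm w"
        using norm_triangle_ineq[of z0 "w *s axis i 1"] that by (simp add: norm_axis_1)
      have "norm (g w) \<le> M * (norm (z0 + w *s axis i 1) / (1/2)) ^ k"
        unfolding g_def by (rule slice_coeff_bound[OF f _ _ M(2)]) auto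
      also have "\<dots> \<le> M * (4 * norm w) ^ k"
        using \<open>norm (z0 + w *s axis i 1) \<le> 2 * norm w\<close> M(1) by (intro mult_left_mono power_mono) auto
      finally show ?thesis by (simp add: power_mult_distrib mult_ac)
    qed
    ultimately have "g w = (\<Sum>j\<le>k. (deriv ^^ j) g 0 / fact j * w ^ j)" for w
      by (rule Liouville_polynomial)
    moreover have "slice_coeff f k (set_coord i w z) = g w" for w by (simp only: eq g_def)
    ultimately have "\<forall>w. slice_coeff f k (set_coord i w z) = (\<Sum>j\<le>k. (deriv ^^ j) g 0 / fact j * w ^ j)" by metis
    then show "\<exists>c. \<forall>w. slice_coeff f k (set_coord i w z) = (\<Sum>j\<le>k. c j * w ^ j)"
      by (rule exI[of _ "\<lambda>j. (deriv ^^ j) g 0 / fact j"])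
  next
    fix z z' :: "complex ^ 'n" assume "\<forall>j\<in>UNIV. z $ j = z' $ j"
    then have "z = z'" by (simp add: vec_eq_iff)
    then show "slice_coeff f k z = slice_coeff f k z'" by simp
  qed simp
qed (rule slice_coeff_homogeneous[OF f])

theorem hom_part_eq_slice_coeff:
  fixes f :: "complex ^ 'n \<Rightarrow> complex"
  assumes f: "f \<in> line_holomorphic"
  shows "hom_part f = slice_coeff f"
  unfolding hom_part_def
proof (rule the_equality)
  show "homogeneous_expansion f (slice_coeff f)"
    unfolding homogeneous_expansion_def
    using slice_coeff_sums[OF f, of 1] by (auto intro: homogeneous_poly_slice_coeff[OF f])
next
  fix G assume G: "homogeneous_expansion f G"
  have "G k z = slice_coeff f k z" for k z
  proof -
    define r where "r = 1 / (norm z + 1)"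
    have r: "r > 0" by (simp add: r_def add_nonneg_pos)
    have small: "norm (c *s z) < 1" if "norm c < r" for c
    proof -
      have "norm c * norm z \<le> norm c * (norm z + 1)" by (intro mult_left_mono) auto
      also have "\<dots> < 1" using that by (simp add: r_def pos_less_divide_eq add_nonneg_pos)
      finally show ?thesis by simp
    qed
    have "(\<lambda>k. G k z) = (\<lambda>k. slice_coeff f k z)"
    proof (rule power_series_coefficients_unique[OF r])
      fix c :: complex assume c: "norm c < r"
      show "(\<lambda>k. slice_coeff f k z * c ^ k) sums f (c *s z)" by (rule slice_coeff_sums[OF f small[OF c]])
      have "(\<lambda>k. G k (c *s z)) sums f (c *s z)" "\<And>k. G k (c *s z) = c ^ k * G k z"
        using G small[OF c] unfolding homogeneous_expansion_def
        by (auto intro: homogeneous_poly_scale simp del: norm_vec_smult)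
      then show "(\<lambda>k. G k z * c ^ k) sums f (c *s z)" by (simp add: mult.commute)
    qed
    then show ?thesis by (rule fun_cong)
  qed
  then show "G = slice_coeff f" by blast
qed

section \<open>Differences along operators of the ball\<close>

lemma clinear_op_bounded_linear:
  assumes "clinear_op U"
  shows "bounded_linear U"
proof -
  have "linear U"
    using assms by (intro linearI) (auto simp: clinear_op_def Vector_Spaces.linear_iff scaleR_eq_smult)
  then show ?thesis by (simp add: linear_conv_bounded_linear)
qed

lemma clinear_op_simps:
  assumes "clinear_op U"
  shows "U (x + y) = U x + U y" "U (x - y) = U x - U y" "U (c *s x) = c *s U x" "U (r *\<^sub>R x) = r *\<^sub>R U x" "U 0 = 0"
  using assms linear_diff[OF bounded_linear.linear[OF clinear_op_bounded_linear[OF assms]]]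
    linear_0[OF bounded_linear.linear[OF clinear_op_bounded_linear[OF assms]]]
  by (auto simp: clinear_op_def Vector_Spaces.linear_iff scaleR_eq_smult)

text \<open>
  The contraction principle with radii: \<open>r U\<close> is \<open>\<rho>\<close> times a contraction. If \<open>\<rho> = 0\<close>, then \<open>r U = 0\<close>, in
  agreement with the convention \<open>r / 0 = 0\<close>.
\<close>

lemma mean_le_compose:
  fixes g :: "complex ^ 'n \<Rightarrow> complex"
  assumes g: "g \<in> line_holomorphic" and U: "clinear_op U" and r: "0 \<le> r" and \<rho>: "0 \<le> \<rho>" "\<rho> < 1"
    and contr: "\<And>z. r * norm (U z) \<le> \<rho> * norm z" and q: "1 \<le> q" and C: "0 \<le> C" "mean_le q \<rho> g C"
  shows "mean_le q r (\<lambda>z. g (U z)) C"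
proof -
  define A where "A = matrix (\<lambda>z. of_real (r / \<rho>) *s U z)"
  have "Vector_Spaces.linear (*s) (*s) (\<lambda>z. of_real (r / \<rho>) *s U z)"
    using U by (auto simp: clinear_op_def Vector_Spaces.linear_iff vec_eq_iff algebra_simps)
  then have A: "A *v z = of_real (r / \<rho>) *s U z" for z
    unfolding A_def by (rule matrix_works)
  have "norm (A *v z) \<le> norm z" for z
  proof (cases "\<rho> = 0")
    case False
    then show ?thesis using contr[of z] r \<rho> by (simp add: A norm_mult norm_divide field_simps)
  qed (simp add: A)
  then have Ac: "A \<in> contractions" by (simp add: contractions_def)
  have "\<rho> *\<^sub>R (A *v z) = U (r *\<^sub>R z)" for z
  proof (cases "\<rho> = 0")
    case True
    then have "r * norm (U z) = 0" using contr[of z] r by (intro antisym) auto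
    then have "r *\<^sub>R U z = 0" by auto
    then show ?thesis using True by (simp add: clinear_op_simps[OF U])
  next
    case False
    then show ?thesis by (simp add: A clinear_op_simps[OF U] scaleR_eq_smult vector_smult_assoc)
  qed
  then show ?thesis
    using nn_integral_contraction_le[OF g \<rho> q Ac C] by (simp add: mean_le_def)
qed

lemma clinear_op_scale: "clinear_op (\<lambda>z :: complex ^ 'n. c *s z)"
  by (auto simp: clinear_op_def Vector_Spaces.linear_iff vec_eq_iff algebra_simps intro: vec.vector_space_axioms)

lemma ball_opsD:
  assumes "U \<in> ball_ops"
  shows "clinear_op U" and "norm (U z) \<le> norm z"
proof -
  show lin: "clinear_op U" using assms by (simp add: ball_ops_def)
  show "norm (U z) \<le> norm z"
  proof (rule ccontr)
    assume neg: "\<not> norm (U z) \<le> norm z"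
    define c where "c = norm (U z)"
    have c: "0 < c" "norm z < c" using neg by (auto simp: c_def)
    have "(1 / c) *\<^sub>R z \<in> ball 0 1" using c by (simp add: field_simps)
    then have "U ((1 / c) *\<^sub>R z) \<in> ball 0 1" using assms unfolding ball_ops_def by blast
    then show False using c by (simp add: clinear_op_simps[OF lin] c_def[symmetric])
  qed
qed

lemma line_holomorphic_compose:
  assumes g: "g \<in> line_holomorphic" and U: "U \<in> ball_ops"
  shows "(\<lambda>z. g (U z)) \<in> line_holomorphic"
  unfolding line_holomorphic_def
proof (intro CollectI conjI allI)
  have img: "U z \<in> unit_ball" if "z \<in> unit_ball" for z using ball_opsD(2)[OF U, of z] that by simp
  show "continuous_on unit_ball (\<lambda>z. g (U z))"
    by (rule continuous_on_compose2[OF line_holomorphicD(1)[OF g]])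
       (use img in \<open>auto intro: linear_continuous_on clinear_op_bounded_linear ball_opsD(1)[OF U] simp del: mem_ball_0\<close>)
  fix z v
  have eq: "U (z + c *s v) = U z + c *s U v" for c by (simp add: clinear_op_simps[OF ball_opsD(1)[OF U]])
  have "(\<lambda>c. g (U z + c *s U v)) holomorphic_on {c. z + c *s v \<in> unit_ball}"
    by (rule holomorphic_on_subset[OF line_holomorphicD(2)[OF g]])
       (use img[of "z + _ *s v"] in \<open>auto simp only: eq mem_Collect_eq\<close>)
  then show "(\<lambda>c. g (U (z + c *s v))) holomorphic_on {c. z + c *s v \<in> unit_ball}" by (simp only: eq)
qed

lemma line_holomorphic_diff:
  "g \<in> line_holomorphic \<Longrightarrow> h \<in> line_holomorphic \<Longrightarrow> (\<lambda>z. g z - h z) \<in> line_holomorphic"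
  by (auto simp: line_holomorphic_def intro!: continuous_intros holomorphic_intros)

lemma op_diff_0 [simp]: "op_diff 0 U f = f"
  by (simp add: op_diff_def)

lemma op_diff_Suc: "op_diff (Suc n) U f = (\<lambda>z. op_diff n U f (U z) - op_diff n U f z)"
  by (simp add: op_diff_def)

lemma op_diff_line_holomorphic:
  "f \<in> line_holomorphic \<Longrightarrow> U \<in> ball_ops \<Longrightarrow> op_diff n U f \<in> line_holomorphic"
  by (induction n) (auto simp: op_diff_Suc intro: line_holomorphic_diff line_holomorphic_compose)

lemma mean_le_op_diff_trivial:
  assumes f: "f \<in> line_holomorphic" and U: "U \<in> ball_ops" and r: "0 \<le> r" "r < 1" and q: "1 \<le> q"
    and C: "0 \<le> C" "mean_le q r f C"
  shows "mean_le q r (op_diff n U f) (2 ^ n * C)"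
proof (induction n)
  case (Suc n)
  note h = op_diff_line_holomorphic[OF f U, of n]
  have "mean_le q r (\<lambda>z. op_diff n U f (U z)) (2 ^ n * C)"
    by (rule mean_le_compose[OF h ball_opsD(1)[OF U]]) (use Suc r q C ball_opsD(2)[OF U] in \<open>auto intro: mult_left_mono\<close>)
  from mean_le_add[OF q r line_holomorphicD(1)[OF line_holomorphic_compose[OF h U]] line_holomorphicD(1)[OF h]
      line_holomorphicD(1)[OF op_diff_line_holomorphic[OF f U, of "Suc n"]] _ this _ Suc]
  show ?case using C by (simp add: op_diff_Suc norm_triangle_ineq4 mult_ac)
qed (use C in simp)

text \<open>
  Let \<open>B = U - I\<close>. The function \<open>c \<mapsto> g(z + c Bz)\<close> is holomorphic on a disc of radius larger than \<open>R\<close>, and subtracting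
  Cauchy's formulas at \<open>1\<close> and \<open>0\<close> gives \<open>g(Uz) - g(z) = \<integral> g(z + R e(\<theta>) Bz) / (R e(\<theta>) - 1) d\<theta>\<close>, where \<open>e(\<theta>)\<close> runs
  through the unit circle. The linear maps \<open>I + R e(\<theta>) B\<close> have norm at most \<open>1 + R \<delta>\<close>, so the contraction
  principle controls the means of the integrand.
\<close>

lemma mean_le_op_diff_step:
  fixes g :: "complex ^ 'n \<Rightarrow> complex"
  assumes g: "g \<in> line_holomorphic" and U: "U \<in> ball_ops" and near: "\<And>z. norm (U z - z) \<le> \<delta> * norm z"
    and \<delta>: "0 \<le> \<delta>" and R: "1 < R" and r: "0 \<le> r" "r * (1 + R * \<delta>) < 1"
    and q: "1 \<le> q" and C: "0 \<le> C" "mean_le q (r * (1 + R * \<delta>)) g C"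
  shows "mean_le q r (\<lambda>z. g (U z) - g z) (C / (R - 1))"
proof (rule mean_le_limit[OF q])
  show "0 \<le> C / (R - 1)" using C R by simp
  fix \<epsilon> :: real assume \<epsilon>: "0 < \<epsilon>"
  have rle: "r \<le> r * (1 + R * \<delta>)" using r R \<delta> by (simp add: mult_le_cancel_left1)
  have r1: "r < 1" using rle r by linarith
  note lin = ball_opsD(1)[OF U]
  define T where "T = (\<lambda>\<theta> z. z + (R * circle_point \<theta>) *s (U z - z))"
  have Tlin: "clinear_op (T \<theta>)" for \<theta>
    using lin by (auto simp: clinear_op_def Vector_Spaces.linear_iff T_def vec_eq_iff algebra_simps)
  have Tnorm: "norm (T \<theta> z) \<le> (1 + R * \<delta>) * norm z" for \<theta> z
  proof -
    have "norm ((R * circle_point \<theta>) *s (U z - z)) = R * norm (U z - z)"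
      unfolding norm_vec_smult using R by (simp add: norm_mult)
    then have "norm (T \<theta> z) \<le> norm z + R * norm (U z - z)"
      unfolding T_def using norm_triangle_ineq[of z "(R * circle_point \<theta>) *s (U z - z)"] by (simp only:)
    also have "\<dots> \<le> norm z + R * (\<delta> * norm z)" using R near by (intro add_left_mono mult_left_mono) auto
    finally show ?thesis by (simp add: algebra_simps)
  qed
  have Trnorm: "norm (T \<theta> (r *\<^sub>R \<zeta>)) < 1" if "norm \<zeta> = 1" for \<theta> \<zeta>
    using Tnorm[of \<theta> "r *\<^sub>R \<zeta>"] that r by (simp add: mult.commute)
  have Tm: "mean_le q r (\<lambda>z. g (T \<theta> z)) C" for \<theta>
    by (rule mean_le_compose[OF g Tlin, of r "r * (1 + R * \<delta>)"])
       (use r \<delta> R q C Tnorm in \<open>auto simp: mult.assoc intro!: mult_left_mono mult_nonneg_nonneg\<close>)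
  let ?W = "C / (R - 1) + \<epsilon>"
  have W: "0 < ?W" using C R \<epsilon> by (simp add: add_nonneg_pos)
  show "mean_le q r (\<lambda>z. g (U z) - g z) ?W"
  proof (rule mean_le_integral[where S="{0..1}" and h="\<lambda>\<theta> \<zeta>. norm (g (T \<theta> (r *\<^sub>R \<zeta>))) / (R - 1)" and A="\<lambda>_. ?W"])
    show "continuous_on ({0..1} \<times> sphere 0 1) (\<lambda>(\<theta>, \<zeta>). norm (g (T \<theta> (r *\<^sub>R \<zeta>))) / (R - 1))"
    proof -
      have "continuous_on ({0..1::real} \<times> sphere (0 :: complex ^ 'n) 1) (\<lambda>p. T (fst p) (r *\<^sub>R snd p))"
        unfolding T_def
        by (intro continuous_intros bounded_linear.continuous_on[OF clinear_op_bounded_linear[OF lin]])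
      moreover have "(\<lambda>p. T (fst p) (r *\<^sub>R snd p)) ` ({0..1::real} \<times> sphere (0 :: complex ^ 'n) 1) \<subseteq> unit_ball"
        using Trnorm by auto
      ultimately have "continuous_on ({0..1::real} \<times> sphere (0 :: complex ^ 'n) 1) (\<lambda>p. g (T (fst p) (r *\<^sub>R snd p)))"
        by (rule continuous_on_compose2[OF line_holomorphicD(1)[OF g]])
      then show ?thesis unfolding split_def using R by (intro continuous_intros) auto
    qed
    show "(\<integral>\<^sup>+\<theta>. ennreal ?W * indicator {0..1::real} \<theta> \<partial>lborel) \<le> ennreal ?W"
      by (subst nn_integral_cmult_indicator) auto
    show "(\<integral>\<^sup>+\<zeta>. ennreal ((norm (g (T \<theta> (r *\<^sub>R \<zeta>))) / (R - 1)) powr q) \<partial>sphere_measure) \<le> ennreal (?W powr q)" for \<theta>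
    proof -
      have gm: "(\<lambda>\<zeta>. g (T \<theta> (r *\<^sub>R \<zeta>))) \<in> borel_measurable sphere_measure"
      proof (rule measurable_sphere_measure, rule continuous_on_compose2[OF line_holomorphicD(1)[OF g]])
        show "continuous_on (sphere 0 1) (\<lambda>\<zeta>. T \<theta> (r *\<^sub>R \<zeta>))"
          by (intro bounded_linear.continuous_on[OF clinear_op_bounded_linear[OF Tlin]] continuous_intros)
      qed (use Trnorm in auto)
      have "(\<integral>\<^sup>+\<zeta>. ennreal ((norm (g (T \<theta> (r *\<^sub>R \<zeta>))) / (R - 1)) powr q) \<partial>sphere_measure) \<le> ennreal ((C / (R - 1)) powr q)"
        using nn_integral_powr_cmult_le[of "\<lambda>\<zeta>. norm (g (T \<theta> (r *\<^sub>R \<zeta>)))" sphere_measure "1 / (R - 1)" C q] gm Tm[of \<theta>] R C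
        by (simp add: mean_le_def)
      also have "\<dots> \<le> ennreal (?W powr q)" using C R \<epsilon> q by (intro ennreal_leI powr_mono2) auto
      finally show ?thesis .
    qed
    show "continuous_on unit_ball (\<lambda>z. g (U z) - g z)"
      by (rule line_holomorphicD(1)[OF line_holomorphic_diff[OF line_holomorphic_compose[OF g U] g]])
    fix \<zeta> :: "complex ^ 'n" assume z: "norm \<zeta> = 1"
    let ?z = "r *\<^sub>R \<zeta>" and ?w = "U (r *\<^sub>R \<zeta>) - r *\<^sub>R \<zeta>"
    define S where "S = {c. ?z + c *s ?w \<in> unit_ball}"
    have w: "norm ?w \<le> r * \<delta>" using near[of ?z] z r by (simp add: mult.commute)
    have S: "cball 0 R \<subseteq> S"
    proof
      fix c :: complex assume c: "c \<in> cball 0 R"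
      have "norm (?z + c *s ?w) \<le> r + R * (r * \<delta>)"
      proof -
        have "norm (c *s ?w) \<le> R * (r * \<delta>)"
          unfolding norm_vec_smult by (rule mult_mono) (use c w R in auto)
        moreover have "norm ?z = r" using z r by simp
        ultimately show ?thesis using norm_triangle_ineq[of ?z "c *s ?w"] by linarith
      qed
      also have "\<dots> < 1" using r by (simp add: algebra_simps)
      finally show "c \<in> S" by (simp add: S_def)
    qed
    have opS: "open S" unfolding S_def by (rule open_line_slice)
    have hol: "(\<lambda>c. g (?z + c *s ?w)) holomorphic_on S"
      unfolding S_def by (rule line_holomorphicD(2)[OF g])
    have ne: "complex_of_real R * circle_point \<theta> \<noteq> 1" for \<theta>
    proof
      assume "complex_of_real R * circle_point \<theta> = 1"
      then have "norm (complex_of_real R * circle_point \<theta>) = 1" by simp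
      then show False using R by (simp add: norm_mult)
    qed
    define G where "G = (\<lambda>\<theta>. g (?z + (R * circle_point \<theta>) *s ?w))"
    have GT: "G \<theta> = g (T \<theta> (r *\<^sub>R \<zeta>))" for \<theta> by (simp add: G_def T_def)
    have i1: "((\<lambda>\<theta>. G \<theta> * (R * circle_point \<theta>) / (R * circle_point \<theta> - 1)) has_integral g (?z + 1 *s ?w)) {0..1}"
      unfolding G_def by (rule Cauchy_circle_average[OF opS S hol]) (use R in auto)
    have i2: "((\<lambda>\<theta>. G \<theta> * (R * circle_point \<theta>) / (R * circle_point \<theta> - 0)) has_integral g (?z + 0 *s ?w)) {0..1}"
      unfolding G_def by (rule Cauchy_circle_average[OF opS S hol]) (use R in auto)
    have kernel: "G \<theta> * (R * circle_point \<theta>) / (R * circle_point \<theta> - 1) -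
        G \<theta> * (R * circle_point \<theta>) / (R * circle_point \<theta> - 0) = G \<theta> / (R * circle_point \<theta> - 1)" for \<theta>
      using ne[of \<theta>] R by (simp add: field_simps)
    have ends: "?z + 1 *s ?w = U ?z" "?z + 0 *s ?w = ?z" by simp_all
    have int: "((\<lambda>\<theta>. G \<theta> / (R * circle_point \<theta> - 1)) has_integral (g (U ?z) - g ?z)) {0..1}"
      using has_integral_diff[OF i1 i2] unfolding kernel ends .
    have "complex_of_real R * circle_point \<theta> \<in> cball 0 R" for \<theta> using R by (simp add: norm_mult)
    then have img: "(\<lambda>\<theta>. complex_of_real R * circle_point \<theta>) ` {0..1} \<subseteq> S" using S by blast
    have "continuous_on {0..1} G"
      unfolding G_def
      by (rule continuous_on_compose2[OF holomorphic_on_imp_continuous_on[OF hol] _ img]) (intro continuous_intros)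
    then have cont: "continuous_on {0..1} (\<lambda>\<theta>. G \<theta> / (R * circle_point \<theta> - 1))"
      using ne by (intro continuous_intros) auto
    have "ennreal (norm (g (U ?z) - g ?z)) \<le> (\<integral>\<^sup>+\<theta>. ennreal (norm (G \<theta> / (R * circle_point \<theta> - 1))) * indicator {0..1} \<theta> \<partial>lborel)"
      by (rule norm_integral_le_nn_integral[OF int cont])
    also have "\<dots> \<le> (\<integral>\<^sup>+\<theta>. ennreal (norm (g (T \<theta> ?z)) / (R - 1)) * indicator {0..1} \<theta> \<partial>lborel)"
    proof (intro nn_integral_mono mult_right_mono ennreal_leI)
      fix \<theta>
      have "R - 1 \<le> norm (R * circle_point \<theta> - 1)"
        using norm_triangle_ineq2[of "R * circle_point \<theta>" 1] R by (simp add: norm_mult)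
      then show "norm (G \<theta> / (R * circle_point \<theta> - 1)) \<le> norm (g (T \<theta> ?z)) / (R - 1)"
        using R by (simp add: norm_divide GT frac_le)
    qed simp
    finally show "ennreal (norm (g (U ?z) - g ?z)) \<le> \<dots>" .
  qed (use q W r r1 R in auto)
qed

lemma mean_le_op_diff_Cauchy:
  assumes g: "g \<in> line_holomorphic" and U: "U \<in> ball_ops" and near: "\<And>z. norm (U z - z) \<le> \<delta> * norm z"
    and \<delta>: "0 \<le> \<delta>" and R: "1 < R" and r: "0 \<le> r" "r * (1 + R * \<delta>) ^ n < 1"
    and q: "1 \<le> q" and C: "0 \<le> C" "mean_le q (r * (1 + R * \<delta>) ^ n) g C"
  shows "mean_le q r (op_diff n U g) (C / (R - 1) ^ n)"
  using r C(2)
proof (induction n arbitrary: r)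
  case (Suc n)
  let ?\<rho> = "r * (1 + R * \<delta>)"
  have \<rho>: "0 \<le> ?\<rho>" "?\<rho> * (1 + R * \<delta>) ^ n < 1" using Suc.prems \<delta> R by (auto simp: mult_ac)
  have "1 \<le> (1 + R * \<delta>) ^ n" using \<delta> R by (intro one_le_power) simp
  then have "?\<rho> \<le> ?\<rho> * (1 + R * \<delta>) ^ n" using \<rho>(1) by (simp add: mult_le_cancel_left1)
  then have "?\<rho> < 1" using \<rho>(2) by linarith
  moreover have "mean_le q ?\<rho> (op_diff n U g) (C / (R - 1) ^ n)"
    by (rule Suc.IH[OF \<rho>]) (use Suc.prems in \<open>simp add: mult_ac\<close>)
  ultimately have "mean_le q r (\<lambda>z. op_diff n U g (U z) - op_diff n U g z) (C / (R - 1) ^ n / (R - 1))"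
    using Suc.prems C R by (intro mean_le_op_diff_step[OF op_diff_line_holomorphic[OF g U] U near \<delta> R _ _ q]) auto
  then show ?case by (simp add: op_diff_Suc mult.commute)
qed simp

section \<open>Radial derivatives and the reproducing formula\<close>

lemma summable_nat_power_times_geometric:
  fixes x :: real
  assumes "norm x < 1"
  shows "summable (\<lambda>k. real k ^ s * x ^ k)"
  using assms
proof (induction s arbitrary: x)
  case 0
  then show ?case by (simp add: summable_geometric)
next
  case (Suc s)
  have "summable (\<lambda>k. diffs (\<lambda>k. real k ^ s) k * x ^ k)"
    by (rule termdiff_converges[OF Suc.prems]) (rule Suc.IH)
  then have "summable (\<lambda>k. x * (diffs (\<lambda>k. real k ^ s) k * x ^ k))" by (rule summable_mult)
  then have "summable (\<lambda>k. real (Suc k) ^ Suc s * x ^ Suc k)"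
    by (simp add: diffs_def mult_ac)
  then show ?case by (rule summable_Suc_iff[THEN iffD1])
qed

lemma radial_deriv_nat:
  assumes f: "f \<in> line_holomorphic"
  shows "radial_deriv (real s) f z = (\<Sum>k. of_nat (Suc k) ^ s * slice_coeff f (Suc k) z)"
  unfolding radial_deriv_def hom_part_eq_slice_coeff[OF f]
  by (simp add: powr_realpow del: of_nat_Suc)

lemma slice_coeff_power_bound:
  fixes f :: "complex ^ 'n \<Rightarrow> complex"
  assumes f: "f \<in> line_holomorphic" and r: "0 \<le> r" "r < 1"
  obtains B where "summable B" "\<And>k z. norm z \<le> r \<Longrightarrow> norm (of_nat (Suc k) ^ s * slice_coeff f (Suc k) z) \<le> B k"
proof -
  define \<rho> where "\<rho> = (r + 1) / 2"
  have \<rho>: "0 < \<rho>" "\<rho> < 1" "r < \<rho>" using r by (auto simp: \<rho>_def)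
  obtain M where M: "0 \<le> M" "\<And>z. norm z \<le> \<rho> \<Longrightarrow> norm (f z) \<le> M"
    using line_holomorphic_bounded[OF f \<rho>(2)] by blast
  show thesis
  proof (rule that[of "\<lambda>k. M * (real (Suc k) ^ s * (r / \<rho>) ^ Suc k)"])
    have "summable (\<lambda>k. real k ^ s * (r / \<rho>) ^ k)"
      using r \<rho> by (intro summable_nat_power_times_geometric) auto
    then show "summable (\<lambda>k. M * (real (Suc k) ^ s * (r / \<rho>) ^ Suc k))"
      by (intro summable_mult summable_Suc_iff[THEN iffD2])
    fix k and z :: "complex ^ 'n" assume z: "norm z \<le> r"
    have "norm (slice_coeff f (Suc k) z) \<le> M * (norm z / \<rho>) ^ Suc k"
      by (rule slice_coeff_bound[OF f \<rho>(1,2) M(2)])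
    also have "\<dots> \<le> M * (r / \<rho>) ^ Suc k"
      using z \<rho> M(1) by (intro mult_left_mono power_mono divide_right_mono) auto
    finally have "real (Suc k) ^ s * norm (slice_coeff f (Suc k) z) \<le> real (Suc k) ^ s * (M * (r / \<rho>) ^ Suc k)"
      by (rule mult_left_mono) simp
    then show "norm (of_nat (Suc k) ^ s * slice_coeff f (Suc k) z) \<le> M * (real (Suc k) ^ s * (r / \<rho>) ^ Suc k)"
      by (simp add: norm_mult norm_power mult_ac del: of_nat_Suc power_Suc)
  qed
qed

lemma radial_deriv_summable:
  assumes f: "f \<in> line_holomorphic" and z: "norm z < 1"
  shows "summable (\<lambda>k. norm (of_nat (Suc k) ^ s * slice_coeff f (Suc k) z))"
proof -
  obtain B where B: "summable B" "\<And>k w. norm w \<le> norm z \<Longrightarrow> norm (of_nat (Suc k) ^ s * slice_coeff f (Suc k) w) \<le> B k"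
    using slice_coeff_power_bound[OF f norm_ge_zero z] by blast
  show ?thesis by (rule summable_comparison_test'[OF B(1), of 0]) (simp only: real_norm_def abs_norm_cancel B(2) order_refl)
qed

lemma radial_deriv_line_holomorphic:
  fixes f :: "complex ^ 'n \<Rightarrow> complex"
  assumes f: "f \<in> line_holomorphic"
  shows "radial_deriv (real s) f \<in> line_holomorphic"
proof -
  define H where "H = (\<lambda>n z. \<Sum>k<n. of_nat (Suc k) ^ s * slice_coeff f (Suc k) z)"
  have H1: "continuous_on (ball 0 1) (H j)" for j
    unfolding H_def by (intro continuous_intros entire_linesD(1)[OF slice_coeff_entire_lines[OF f]])
  have H2: "(\<lambda>c. H j (z + c *s v)) holomorphic_on {c. z + c *s v \<in> ball 0 1}" for j z v
    unfolding H_def by (intro holomorphic_intros entire_linesD(2)[OF slice_coeff_entire_lines[OF f]])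
  have lim: "uniform_limit (cball 0 r) H (radial_deriv (real s) f) sequentially" if r1: "r < 1" for r
  proof (cases "0 \<le> r")
    case True
    obtain B where B: "summable B" "\<And>k w. norm w \<le> r \<Longrightarrow> norm (of_nat (Suc k) ^ s * slice_coeff f (Suc k) w) \<le> B k"
      using slice_coeff_power_bound[OF f True r1] by blast
    have "uniform_limit (cball 0 r) (\<lambda>n z. \<Sum>k<n. of_nat (Suc k) ^ s * slice_coeff f (Suc k) z)
       (\<lambda>z. \<Sum>k. of_nat (Suc k) ^ s * slice_coeff f (Suc k) z) sequentially"
      by (rule Weierstrass_m_test[OF _ B(1)]) (use B(2) in auto)
    then show ?thesis unfolding H_def radial_deriv_nat[OF f, abs_def] .
  qed (simp add: uniform_limit_iff)
  show ?thesis
    unfolding line_holomorphic_def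
    using line_holomorphic_uniform_limit[OF H1 H2 lim] by auto
qed

text \<open>
  The density \<open>t\<^sup>s\<^sup>-\<^sup>1 / \<Gamma>(s)\<close> of integration of order \<open>s\<close>, extended by zero so that integrals run over the line.
\<close>

definition fractional_kernel :: "nat \<Rightarrow> real \<Rightarrow> real" where
  "fractional_kernel s t = (if t < 0 then 0 else t ^ (s - 1) / fact (s - 1))"

lemma fractional_kernel_nonneg: "0 \<le> fractional_kernel s t"
  by (simp add: fractional_kernel_def)

lemma integral_erlang_density:
  assumes "0 < l"
  shows "integrable lborel (erlang_density k l)" "(LINT t|lborel. erlang_density k l t) = 1"
proof -
  have 1: "(\<integral>\<^sup>+ t. ennreal (erlang_density k l t) \<partial>lborel) = ennreal 1"
    using nn_integral_erlang_ith_moment[OF assms, of k 0] by simp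
  then have "has_bochner_integral lborel (erlang_density k l) 1"
    using assms by (intro has_bochner_integral_nn_integral) (auto intro!: AE_I2)
  then show "integrable lborel (erlang_density k l)" "(LINT t|lborel. erlang_density k l t) = 1"
    by (auto simp: has_bochner_integral_iff)
qed

text \<open>
  On the homogeneous part of degree \<open>k\<close> the formula reads \<open>\<integral> t\<^sup>s\<^sup>-\<^sup>1 k\<^sup>s e\<^sup>-\<^sup>k\<^sup>t dt = \<Gamma>(s)\<close>, the
  normalisation of the Erlang density. Absolute convergence of the homogeneous expansion at \<open>z\<close> permits the exchange
  of sum and integral.
\<close>

lemma radial_deriv_reproducing:
  fixes f :: "complex ^ 'n \<Rightarrow> complex"
  assumes f: "f \<in> line_holomorphic" and s: "1 \<le> s" and z: "norm z < 1"
  defines "G \<equiv> radial_deriv (real s) f"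
  shows "integrable lborel (\<lambda>t. fractional_kernel s t *\<^sub>R G (exp (- t) *\<^sub>R z))"
    and "(LINT t|lborel. fractional_kernel s t *\<^sub>R G (exp (- t) *\<^sub>R z)) = f z - f 0"
proof -
  define e where "e = (\<lambda>k t. erlang_density (s - 1) (real (Suc k)) t *\<^sub>R slice_coeff f (Suc k) z)"
  have e_eq: "e k t = fractional_kernel s t *\<^sub>R (of_nat (Suc k) ^ s * slice_coeff f (Suc k) (exp (- t) *\<^sub>R z))" for k t
  proof -
    have "slice_coeff f (Suc k) (exp (- t) *\<^sub>R z) = of_real (exp (- t)) ^ Suc k * slice_coeff f (Suc k) z"
      unfolding scaleR_eq_smult by (rule slice_coeff_homogeneous[OF f])
    moreover have "exp (- real (Suc k) * t) = exp (- t) ^ Suc k"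
      by (simp only: exp_of_nat_mult[symmetric]) (simp add: algebra_simps)
    moreover have "Suc (s - 1) = s" using s by simp
    ultimately show ?thesis
      by (simp add: e_def erlang_density_def fractional_kernel_def scaleR_conv_of_real mult_ac del: of_nat_Suc power_Suc)
  qed
  have absz: "summable (\<lambda>k. norm (slice_coeff f (Suc k) z))"
    using radial_deriv_summable[OF f z, of 0] by simp
  have int: "integrable lborel (e k)" for k
    unfolding e_def by (intro integrable_scaleR_left integral_erlang_density) simp
  have sumn: "summable (\<lambda>k. norm (e k t))" for t
  proof (cases "t < 0")
    case False
    then have "norm (exp (- t) *\<^sub>R z) < 1" using z
      by (simp add: le_less_trans[OF mult_left_le_one_le])
    from summable_mult[OF radial_deriv_summable[OF f this, of s], of "fractional_kernel s t"]
    show ?thesis by (simp add: e_eq fractional_kernel_nonneg)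
  qed (simp add: e_eq fractional_kernel_def)
  have intn: "(LINT t|lborel. norm (e k t)) = norm (slice_coeff f (Suc k) z)" for k
  proof -
    have "(LINT t|lborel. norm (e k t)) = (LINT t|lborel. erlang_density (s - 1) (real (Suc k)) t * norm (slice_coeff f (Suc k) z))"
      by (simp add: e_def del: of_nat_Suc)
    also have "\<dots> = norm (slice_coeff f (Suc k) z)"
      using integral_erlang_density[of "real (Suc k)" "s - 1"] by (simp del: of_nat_Suc)
    finally show ?thesis .
  qed
  have sumI: "(\<Sum>k. e k t) = fractional_kernel s t *\<^sub>R G (exp (- t) *\<^sub>R z)" for t
  proof (cases "t < 0")
    case False
    then have "norm (exp (- t) *\<^sub>R z) < 1" using z
      by (simp add: le_less_trans[OF mult_left_le_one_le])
    from summable_norm_cancel[OF radial_deriv_summable[OF f this, of s]]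
    show ?thesis unfolding e_eq G_def radial_deriv_nat[OF f] by (rule suminf_scaleR_right[symmetric])
  qed (simp add: e_eq fractional_kernel_def)
  have *: "AE t in lborel. summable (\<lambda>k. norm (e k t))" "summable (\<lambda>k. LINT t|lborel. norm (e k t))"
    using sumn absz by (auto simp: intn)
  show "integrable lborel (\<lambda>t. fractional_kernel s t *\<^sub>R G (exp (- t) *\<^sub>R z))"
    using integrable_suminf[OF int *] by (simp add: sumI)
  have "(LINT t|lborel. fractional_kernel s t *\<^sub>R G (exp (- t) *\<^sub>R z)) = (\<Sum>k. LINT t|lborel. e k t)"
    using integral_suminf[OF int *] by (simp add: sumI)
  also have "\<dots> = (\<Sum>k. slice_coeff f (Suc k) z)"
    using integral_erlang_density by (simp add: e_def del: of_nat_Suc)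
  also have "\<dots> = f z - f 0"
  proof -
    have "(\<lambda>k. slice_coeff f k z) sums f z" using slice_coeff_sums[OF f, of 1 z] z by simp
    from sums_split_initial_segment[OF this, of 1] show ?thesis
      by (simp add: sums_iff slice_coeff_def)
  qed
  finally show "(LINT t|lborel. fractional_kernel s t *\<^sub>R G (exp (- t) *\<^sub>R z)) = f z - f 0" .
qed

text \<open>
  Differences of positive order annihilate the constant \<open>f(0)\<close>, and they commute with dilations because \<open>U\<close> is linear.
\<close>

lemma op_diff_reproducing:
  fixes f :: "complex ^ 'n \<Rightarrow> complex"
  assumes f: "f \<in> line_holomorphic" and s: "1 \<le> s" and U: "U \<in> ball_ops" and z: "norm z < 1"
  defines "G \<equiv> radial_deriv (real s) f"
  shows "integrable lborel (\<lambda>t. fractional_kernel s t *\<^sub>R op_diff n U G (exp (- t) *\<^sub>R z)) \<and>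
    (LINT t|lborel. fractional_kernel s t *\<^sub>R op_diff n U G (exp (- t) *\<^sub>R z)) = op_diff n U f z - (if n = 0 then f 0 else 0)"
  using z
proof (induction n arbitrary: z)
  case 0
  then show ?case using radial_deriv_reproducing[OF f s] by (simp add: G_def)
next
  case (Suc n)
  have Uz: "norm (U z) < 1" using ball_opsD(2)[OF U, of z] Suc.prems by simp
  have eq: "fractional_kernel s t *\<^sub>R op_diff (Suc n) U G (exp (- t) *\<^sub>R z)
     = fractional_kernel s t *\<^sub>R op_diff n U G (exp (- t) *\<^sub>R U z) - fractional_kernel s t *\<^sub>R op_diff n U G (exp (- t) *\<^sub>R z)" for t
    by (simp add: op_diff_Suc clinear_op_simps[OF ball_opsD(1)[OF U]] scaleR_diff_right)
  show ?case unfolding eq using Suc.IH[OF Uz] Suc.IH[OF Suc.prems] by (simp add: op_diff_Suc)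
qed

lemma op_diff_norm_le:
  fixes f :: "complex ^ 'n \<Rightarrow> complex"
  assumes f: "f \<in> line_holomorphic" and s: "1 \<le> s" and U: "U \<in> ball_ops" and z: "norm z < 1" and n: "1 \<le> n"
  shows "ennreal (norm (op_diff n U f z)) \<le>
    (\<integral>\<^sup>+t. ennreal (t ^ (s - 1) * norm (op_diff n U (radial_deriv (real s) f) (exp (- t) *\<^sub>R z))) * indicator {0<..} t \<partial>lborel)"
proof -
  let ?H = "op_diff n U (radial_deriv (real s) f)"
  note rep = op_diff_reproducing[OF f s U z, of n]
  have "ennreal (norm (op_diff n U f z)) \<le> (\<integral>\<^sup>+t. ennreal (norm (fractional_kernel s t *\<^sub>R ?H (exp (- t) *\<^sub>R z))) \<partial>lborel)"
    using integral_norm_bound_ennreal[OF rep[THEN conjunct1]] rep[THEN conjunct2] n by simp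
  also have "\<dots> \<le> (\<integral>\<^sup>+t. ennreal (t ^ (s - 1) * norm (?H (exp (- t) *\<^sub>R z))) * indicator {0<..} t \<partial>lborel)"
  proof (rule nn_integral_mono_AE)
    have "AE t in lborel. t \<noteq> (0::real)" by (rule AE_lborel_singleton)
    then show "AE t in lborel. ennreal (norm (fractional_kernel s t *\<^sub>R ?H (exp (- t) *\<^sub>R z)))
       \<le> ennreal (t ^ (s - 1) * norm (?H (exp (- t) *\<^sub>R z))) * indicator {0<..} t"
    proof eventually_elim
      case (elim t)
      show ?case
      proof (cases "t < 0")
        case False
        then have "t > 0" using elim by simp
        moreover have "t ^ (s - 1) / fact (s - 1) \<le> t ^ (s - 1)"
          using \<open>t > 0\<close> by (simp add: divide_le_eq mult_le_cancel_left1 fact_ge_1)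
        then have "t ^ (s - 1) / fact (s - 1) * norm (?H (exp (- t) *\<^sub>R z)) \<le> t ^ (s - 1) * norm (?H (exp (- t) *\<^sub>R z))"
          by (rule mult_right_mono) simp
        ultimately show ?thesis by (simp add: fractional_kernel_def ennreal_leI)
      qed (simp add: fractional_kernel_def)
    qed
  qed
  finally show ?thesis .
qed

section \<open>Differences are controlled by radial derivatives\<close>

lemma one_minus_exp_lower: "0 \<le> t \<Longrightarrow> t / (1 + t) \<le> 1 - exp (- t)" for t :: real
proof -
  assume t: "0 \<le> t"
  have "exp (- t) \<le> 1 / (1 + t)"
    using exp_ge_add_one_self[of t] t by (simp add: exp_minus field_simps)
  then show ?thesis using t by (simp add: field_simps)
qed

lemma one_minus_exp_powr_le:
  fixes t \<beta> :: real
  assumes t: "0 < t" and \<beta>: "0 \<le> \<beta>" "\<beta> \<le> 1"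
  shows "(1 - exp (- t)) powr (- \<beta>) \<le> (1 + t) * t powr (- \<beta>)"
proof -
  have pos: "0 < t / (1 + t)" using t by simp
  have "(1 - exp (- t)) powr (- \<beta>) \<le> (t / (1 + t)) powr (- \<beta>)"
    using one_minus_exp_lower[of t] t pos \<beta> by (intro powr_mono2') auto
  also have "\<dots> = (1 + t) powr \<beta> * t powr (- \<beta>)"
    using t by (simp add: powr_divide powr_minus field_simps)
  also have "\<dots> \<le> (1 + t) powr 1 * t powr (- \<beta>)"
    using t \<beta> by (intro mult_right_mono powr_mono) auto
  finally show ?thesis using t by simp
qed

text \<open>
  The factor \<open>1 + t\<close> is gained for large \<open>t\<close>; it compensates the factor \<open>1 + t\<close> in \<open>one_minus_exp_powr_le\<close>.
\<close>

lemma exp_minus_one_lower: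
  fixes t :: real and n :: nat
  assumes t: "0 \<le> t" and n: "1 \<le> n"
  shows "t * (1 + t) / (8 * real n ^ 2) \<le> exp (t / (2 * real n)) - 1"
proof -
  define x where "x = t / (2 * real n)"
  have x: "0 \<le> x" "t = 2 * real n * x" using t n by (auto simp: x_def)
  have "t * (1 + t) \<le> 8 * real n ^ 2 * (x + x\<^sup>2 / 2)"
  proof -
    have "2 * real n * x \<le> 8 * (real n)\<^sup>2 * x"
      using n x(1) by (intro mult_right_mono) (auto simp: power2_eq_square)
    moreover have "8 * (real n)\<^sup>2 * (x\<^sup>2 / 2) = (2 * real n * x)\<^sup>2" by (simp add: power2_eq_square)
    ultimately show ?thesis unfolding x(2) by (simp add: power2_eq_square algebra_simps)
  qed
  then have "t * (1 + t) / (8 * real n ^ 2) \<le> x + x\<^sup>2 / 2"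
    using n by (simp add: divide_le_eq mult.commute)
  also have "\<dots> \<le> exp x - 1" using exp_lower_Taylor_quadratic[OF x(1)] by simp
  finally show ?thesis by (simp add: x_def)
qed

lemma mean_le_cmult:
  fixes H :: "complex ^ 'n \<Rightarrow> complex"
  assumes H: "continuous_on unit_ball H" and \<rho>: "0 \<le> \<rho>" "\<rho> < 1" and c: "0 \<le> c" and B: "0 \<le> B" "mean_le q \<rho> H B"
  shows "(\<integral>\<^sup>+\<zeta>. ennreal ((c * norm (H (\<rho> *\<^sub>R \<zeta>))) powr q) \<partial>sphere_measure) \<le> ennreal ((c * B) powr q)"
  using nn_integral_powr_cmult_le[of "\<lambda>\<zeta>. norm (H (\<rho> *\<^sub>R \<zeta>))"] borel_measurable_dilate[OF H \<rho>] c B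
  by (simp add: mean_le_def)

lemma nn_integral_powr_split:
  fixes \<alpha> L d :: real and n :: nat
  assumes \<alpha>: "0 < \<alpha>" "\<alpha> < real n" and L: "0 < L" and d: "0 \<le> d"
  shows "(\<integral>\<^sup>+t. ennreal (if t < L then t powr (\<alpha> - 1) else d * t powr (\<alpha> - 1 - real n)) * indicator {0<..} t \<partial>lborel)
    \<le> ennreal (L powr \<alpha> / \<alpha> + d * (L powr (\<alpha> - real n) / (real n - \<alpha>)))"
proof -
  have 1: "(\<integral>\<^sup>+t. ennreal (t powr (\<alpha> - 1)) * indicator {0..L} t \<partial>lborel) = ennreal (L powr \<alpha> / \<alpha>)"
    using nn_integral_has_integral_lebesgue'[OF _ has_integral_powr_from_0[of "\<alpha> - 1" L]] \<alpha> L by simp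
  have 2: "(\<integral>\<^sup>+t. ennreal (t powr (\<alpha> - 1 - real n)) * indicator {L..} t \<partial>lborel) = ennreal (L powr (\<alpha> - real n) / (real n - \<alpha>))"
  proof -
    have "- (L powr (\<alpha> - 1 - real n + 1)) / (\<alpha> - 1 - real n + 1) = L powr (\<alpha> - real n) / (real n - \<alpha>)"
      using \<alpha> by (simp add: field_simps)
    then show ?thesis
      using nn_integral_has_integral_lebesgue'[OF _ has_integral_powr_to_inf[of "\<alpha> - 1 - real n" L]] \<alpha> L by simp
  qed
  have "(\<integral>\<^sup>+t. ennreal (if t < L then t powr (\<alpha> - 1) else d * t powr (\<alpha> - 1 - real n)) * indicator {0<..} t \<partial>lborel)
    \<le> (\<integral>\<^sup>+t. ennreal (t powr (\<alpha> - 1)) * indicator {0..L} t + ennreal d * (ennreal (t powr (\<alpha> - 1 - real n)) * indicator {L..} t) \<partial>lborel)"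
    using d by (intro nn_integral_mono) (auto simp: ennreal_mult split: split_indicator)
  also have "\<dots> = (\<integral>\<^sup>+t. ennreal (t powr (\<alpha> - 1)) * indicator {0..L} t \<partial>lborel)
      + ennreal d * (\<integral>\<^sup>+t. ennreal (t powr (\<alpha> - 1 - real n)) * indicator {L..} t \<partial>lborel)"
    by (subst nn_integral_add) (auto simp: nn_integral_cmult)
  also have "\<dots> = ennreal (L powr \<alpha> / \<alpha> + d * (L powr (\<alpha> - real n) / (real n - \<alpha>)))"
    unfolding 1 2 using \<alpha> L d by (simp add: ennreal_mult[symmetric] ennreal_plus[symmetric] del: ennreal_plus)
  finally show ?thesis .
qed

text \<open>
  The first factor adds the constants for small and for large \<open>t\<close> in \<open>mean_le_op_diff_kernel\<close>; the second one is
  the bound of \<open>nn_integral_powr_split\<close> for \<open>L = 4n\<close> and \<open>d = 1\<close>.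
\<close>

definition difference_constant :: "nat \<Rightarrow> real \<Rightarrow> real" where
  "difference_constant n \<alpha> = (2 ^ n * (1 + 4 * real n) + (16 * (real n)\<^sup>2) ^ n) *
     ((4 * real n) powr \<alpha> / \<alpha> + (4 * real n) powr (\<alpha> - real n) / (real n - \<alpha>))"

text \<open>
  For \<open>t < 4n\<delta>\<close> the difference is bounded by \<open>2\<^sup>n\<close> times the mean of \<open>G\<close>. For larger \<open>t\<close> the Cauchy estimate is used
  with \<open>R\<close> such that \<open>(1 + R\<delta>)\<^sup>n = e\<^sup>t\<^sup>/\<^sup>2\<close>: half of the dilation \<open>e\<^sup>-\<^sup>t\<close> is spent on the Cauchy estimate, the other half
  keeps the argument away from the sphere. The threshold guarantees \<open>R \<ge> 2\<close>, so \<open>R - 1\<close> is comparable to \<open>R\<close>, and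
  \<open>R\<close> is at least a multiple of \<open>t / \<delta>\<close>.
\<close>

lemma mean_le_op_diff_kernel:
  fixes f :: "complex ^ 'n \<Rightarrow> complex"
  assumes G: "G \<in> line_holomorphic" and n: "1 \<le> n" and \<alpha>: "0 < \<alpha>"
    and s: "\<alpha> < real s" "real s \<le> \<alpha> + 1" and q: "1 \<le> q" and A: "0 < A"
    and Gb: "\<And>r. 0 \<le> r \<Longrightarrow> r < 1 \<Longrightarrow> mean_le q r G (A * (1 - r\<^sup>2) powr (\<alpha> - real s))"
    and U: "U \<in> ball_ops" and near: "\<And>z. norm (U z - z) \<le> \<delta> * norm z" and \<delta>: "0 < \<delta>" "\<delta> < 1"
    and r: "0 \<le> r" "r < 1" and t: "0 < t"
  shows "mean_le q (r * exp (- t)) (op_diff n U G)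
    ((2 ^ n * (1 + 4 * real n) + (16 * (real n)\<^sup>2) ^ n) * A *
       (if t < 4 * real n * \<delta> then t powr (\<alpha> - real s) else \<delta> ^ n * t powr (\<alpha> - real s - real n)))"
proof -
  define \<beta> where "\<beta> = real s - \<alpha>"
  have \<beta>: "0 \<le> \<beta>" "\<beta> \<le> 1" "\<alpha> - real s = - \<beta>" using s by (auto simp: \<beta>_def)
  have Gb': "mean_le q \<rho> G (A * ((1 + t) * t powr (- \<beta>)))" if \<rho>: "0 \<le> \<rho>" "\<rho>\<^sup>2 \<le> exp (- t)" for \<rho>
  proof -
    have "exp (- t) < 1" using t by simp
    then have \<rho>1: "\<rho>\<^sup>2 < 1" using \<rho> by linarith
    then have "\<rho> < 1" using \<rho>(1) by (simp add: power_less_one_iff)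
    then have m: "mean_le q \<rho> G (A * (1 - \<rho>\<^sup>2) powr (- \<beta>))" using Gb[of \<rho>] \<rho> \<beta>(3) by simp
    have "(1 - \<rho>\<^sup>2) powr (- \<beta>) \<le> (1 - exp (- t)) powr (- \<beta>)"
      using \<rho> \<rho>1 \<beta> t by (intro powr_mono2') auto
    also have "\<dots> \<le> (1 + t) * t powr (- \<beta>)" by (rule one_minus_exp_powr_le[OF t \<beta>(1,2)])
    finally show ?thesis using A q by (intro mean_le_mono[OF m]) (auto intro: mult_left_mono)
  qed
  have n0: "0 < real n" using n by simp
  show ?thesis
  proof (cases "t < 4 * real n * \<delta>")
    case True
    let ?\<rho> = "r * exp (- t)"
    have \<rho>: "0 \<le> ?\<rho>" "?\<rho> < 1"
      using r t mult_le_one[of r "exp (- t)"] by (auto intro: le_less_trans[OF mult_left_le])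
    have "?\<rho>\<^sup>2 \<le> (exp (- t))\<^sup>2"
      using r by (intro power_mono) (auto intro: mult_left_le_one_le)
    also have "\<dots> \<le> exp (- t)" using t by (simp add: power2_eq_square mult_left_le)
    finally have "mean_le q ?\<rho> G (A * ((1 + t) * t powr (- \<beta>)))" by (rule Gb'[OF \<rho>(1)])
    then have m: "mean_le q ?\<rho> (op_diff n U G) (2 ^ n * (A * ((1 + t) * t powr (- \<beta>))))"
      using A t by (intro mean_le_op_diff_trivial[OF G U \<rho> q]) auto
    have "1 + t \<le> 1 + 4 * real n" using True \<delta> n0 mult_left_le[of \<delta> "4 * real n"] by linarith
    then have "2 ^ n * (A * ((1 + t) * t powr (- \<beta>))) \<le> 2 ^ n * (A * ((1 + 4 * real n) * t powr (- \<beta>)))"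
      using A by (intro mult_left_mono mult_right_mono) auto
    also have "\<dots> = (2 ^ n * (1 + 4 * real n)) * A * t powr (- \<beta>)" by simp
    also have "\<dots> \<le> (2 ^ n * (1 + 4 * real n) + (16 * (real n)\<^sup>2) ^ n) * A * t powr (- \<beta>)"
      using A by (intro mult_right_mono) auto
    finally show ?thesis
      using A t q True by (intro mean_le_mono[OF m]) (auto simp: \<beta>(3))
  next
    case False
    define x where "x = t / (2 * real n)"
    define R where "R = (exp x - 1) / \<delta>"
    have x: "2 * \<delta> \<le> x" using False n0 by (simp add: x_def field_simps)
    have ex: "x \<le> exp x - 1" using exp_ge_add_one_self[of x] by linarith
    have "2 * \<delta> \<le> exp x - 1" using x ex by linarith
    then have R2: "2 \<le> R" using \<delta> by (simp add: R_def pos_le_divide_eq)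
    have one: "1 + R * \<delta> = exp x" using \<delta> by (simp add: R_def)
    have onen: "(1 + R * \<delta>) ^ n = exp (t / 2)"
      unfolding one exp_of_nat_mult[symmetric] using n0 by (simp add: x_def)
    let ?\<rho> = "r * exp (- t)" and ?\<rho>' = "r * exp (- t) * (1 + R * \<delta>) ^ n"
    have \<rho>'eq: "?\<rho>' = r * exp (- (t / 2))"
      unfolding onen by (simp add: mult.assoc exp_add[symmetric])
    have \<rho>': "0 \<le> ?\<rho>'" "?\<rho>' < 1"
      unfolding \<rho>'eq using r t by (auto intro: le_less_trans[OF mult_left_le])
    have "?\<rho>'\<^sup>2 \<le> (exp (- (t / 2)))\<^sup>2"
      unfolding \<rho>'eq using r by (intro power_mono) (auto intro: mult_left_le_one_le)
    also have "\<dots> = exp (- t)" by (simp add: power2_eq_square exp_add[symmetric])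
    finally have "mean_le q ?\<rho>' G (A * ((1 + t) * t powr (- \<beta>)))" by (rule Gb'[OF \<rho>'(1)])
    then have m: "mean_le q ?\<rho> (op_diff n U G) (A * ((1 + t) * t powr (- \<beta>)) / (R - 1) ^ n)"
      using A t R2 r \<delta> \<rho>' by (intro mean_le_op_diff_Cauchy[OF G U near _ _ _ _ q]) auto
    \<comment> \<open>a lower bound for \<open>R / 2\<close>\<close>
    define y where "y = t * (1 + t) / (16 * (real n)\<^sup>2 * \<delta>)"
    have y: "0 < y" using t n0 \<delta> by (simp add: y_def)
    have "y * 2 * \<delta> \<le> exp x - 1"
      using exp_minus_one_lower[of t n] t n \<delta> by (simp add: y_def x_def)
    then have "y * 2 \<le> R" using \<delta> by (simp add: R_def field_simps)
    then have yR: "y \<le> R - 1" using R2 by linarith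
    have "A * ((1 + t) * t powr (- \<beta>)) / (R - 1) ^ n \<le> A * ((1 + t) * t powr (- \<beta>)) / y ^ n"
      using A t y yR by (intro divide_left_mono power_mono mult_pos_pos zero_less_power) auto
    also have "\<dots> = A * ((1 + t) * t powr (- \<beta>)) * ((16 * (real n)\<^sup>2) ^ n * \<delta> ^ n / (t ^ n * (1 + t) ^ n))"
      by (simp add: y_def power_divide power_mult_distrib)
    also have "\<dots> \<le> A * ((1 + t) * t powr (- \<beta>)) * ((16 * (real n)\<^sup>2) ^ n * \<delta> ^ n / (t ^ n * (1 + t)))"
    proof (intro mult_left_mono divide_left_mono)
      have "(1 + t) ^ 1 \<le> (1 + t) ^ n" using t n by (intro power_increasing) auto
      then show "1 + t \<le> (1 + t) ^ n" by simp
    qed (use A t \<delta> in auto)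
    also have "\<dots> = (16 * (real n)\<^sup>2) ^ n * A * (\<delta> ^ n * (t powr (- \<beta>) / t ^ n))"
    proof -
      have cancel: "A * (u * p) * (c * d / (T * u)) = c * A * (d * (p / T))" if "u \<noteq> 0" "T \<noteq> 0" for u p c d T :: real
        using that by (simp add: field_simps)
      show ?thesis by (rule cancel) (use t in auto)
    qed
    also have "t powr (- \<beta>) / t ^ n = t powr (\<alpha> - real s - real n)"
      using t by (simp add: \<beta>(3) powr_diff powr_realpow)
    also have "(16 * (real n)\<^sup>2) ^ n * A * (\<delta> ^ n * t powr (\<alpha> - real s - real n)) \<le>
      (2 ^ n * (1 + 4 * real n) + (16 * (real n)\<^sup>2) ^ n) * A * (\<delta> ^ n * t powr (\<alpha> - real s - real n))"
      using A \<delta> by (intro mult_right_mono) auto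
    finally show ?thesis
      using A t q False R2 by (intro mean_le_mono[OF m]) auto
  qed
qed

text \<open>
  Minkowski's inequality for the reproducing formula: up to constants the integrand is
  \<open>t\<^sup>\<alpha>\<^sup>-\<^sup>1 min(1, \<delta> / t)\<^sup>n\<close>, which is integrable at \<open>0\<close> because \<open>\<alpha> > 0\<close> and at infinity because \<open>\<alpha> < n\<close>,
  and scales like \<open>\<delta>\<^sup>\<alpha>\<close>.
\<close>

theorem mean_le_op_diff:
  fixes f :: "complex ^ 'n \<Rightarrow> complex"
  assumes f: "f \<in> line_holomorphic" and n: "1 \<le> n" and \<alpha>: "0 < \<alpha>" "\<alpha> < real n"
    and s: "\<alpha> < real s" "real s \<le> \<alpha> + 1" and q: "1 \<le> q" and A: "0 < A"
    and bound: "\<And>r. 0 \<le> r \<Longrightarrow> r < 1 \<Longrightarrow> mean_le q r (radial_deriv (real s) f) (A * (1 - r\<^sup>2) powr (\<alpha> - real s))"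
    and U: "U \<in> ball_ops" and near: "\<And>z. norm (U z - z) \<le> \<delta> * norm z" and \<delta>: "0 < \<delta>" "\<delta> < 1"
    and r: "0 \<le> r" "r < 1"
  shows "mean_le q r (op_diff n U f) (difference_constant n \<alpha> * A * \<delta> powr \<alpha>)"
proof -
  define G where "G = radial_deriv (real s) f"
  have G: "G \<in> line_holomorphic" unfolding G_def by (rule radial_deriv_line_holomorphic[OF f])
  define H where "H = op_diff n U G"
  have H: "H \<in> line_holomorphic" unfolding H_def by (rule op_diff_line_holomorphic[OF G U])
  have s1: "1 \<le> s" using s \<alpha> by (cases s) auto
  have n0: "0 < real n" using n by simp
  define K where "K = (2 ^ n * (1 + 4 * real n) + (16 * (real n)\<^sup>2) ^ n)"
  have K: "0 < K" unfolding K_def by (intro add_pos_nonneg mult_pos_pos) auto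
  define L where "L = 4 * real n * \<delta>"
  have L: "0 < L" using n0 \<delta> by (simp add: L_def)
  define B where "B = (\<lambda>t. K * A * (if t < L then t powr (\<alpha> - real s) else \<delta> ^ n * t powr (\<alpha> - real s - real n)))"
  have HB: "mean_le q (r * exp (- t)) H (B t)" if "0 < t" for t
    using mean_le_op_diff_kernel[OF G n \<alpha>(1) s q A _ U near \<delta> r that] bound by (simp add: H_def B_def K_def L_def G_def)
  have tB: "t ^ (s - 1) * B t = K * A * (if t < L then t powr (\<alpha> - 1) else \<delta> ^ n * t powr (\<alpha> - 1 - real n))" if t: "0 < t" for t
  proof -
    have "t ^ (s - 1) = t powr (real s - 1)" using t s1 by (simp add: powr_realpow[symmetric] of_nat_diff)
    then have "t ^ (s - 1) * t powr (\<alpha> - real s + c) = t powr (\<alpha> - 1 + c)" for c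
      by (simp add: powr_add[symmetric] algebra_simps)
    from this[of 0] this[of "- real n"] show ?thesis by (simp add: B_def mult_ac)
  qed
  have B0: "0 < B t" if "0 < t" for t using K A that \<delta> by (auto simp: B_def)
  have int: "(\<integral>\<^sup>+t. ennreal (t ^ (s - 1) * B t) * indicator {0<..} t \<partial>lborel) \<le> ennreal (difference_constant n \<alpha> * A * \<delta> powr \<alpha>)"
  proof -
    have "(\<integral>\<^sup>+t. ennreal (t ^ (s - 1) * B t) * indicator {0<..} t \<partial>lborel)
      = (\<integral>\<^sup>+t. ennreal (K * A) * (ennreal (if t < L then t powr (\<alpha> - 1) else \<delta> ^ n * t powr (\<alpha> - 1 - real n)) * indicator {0<..} t) \<partial>lborel)"
      using K A \<delta> by (intro nn_integral_cong) (auto simp: tB[unfolded One_nat_def] ennreal_mult[symmetric] split: split_indicator)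
    also have "\<dots> = ennreal (K * A) * (\<integral>\<^sup>+t. ennreal (if t < L then t powr (\<alpha> - 1) else \<delta> ^ n * t powr (\<alpha> - 1 - real n)) * indicator {0<..} t \<partial>lborel)"
      by (rule nn_integral_cmult) simp
    also have "\<dots> \<le> ennreal (K * A) * ennreal (L powr \<alpha> / \<alpha> + \<delta> ^ n * (L powr (\<alpha> - real n) / (real n - \<alpha>)))"
      using \<delta> by (intro mult_left_mono nn_integral_powr_split[OF \<alpha> L]) auto
    also have "\<dots> = ennreal (K * A * (L powr \<alpha> / \<alpha> + \<delta> ^ n * (L powr (\<alpha> - real n) / (real n - \<alpha>))))"
      using K A \<alpha> \<delta> by (intro ennreal_mult[symmetric] add_nonneg_nonneg mult_nonneg_nonneg divide_nonneg_pos) auto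
    also have "K * A * (L powr \<alpha> / \<alpha> + \<delta> ^ n * (L powr (\<alpha> - real n) / (real n - \<alpha>))) = difference_constant n \<alpha> * A * \<delta> powr \<alpha>"
    proof -
      have "\<delta> ^ n * L powr (\<alpha> - real n) = (4 * real n) powr (\<alpha> - real n) * \<delta> powr \<alpha>"
        using \<delta> n0 by (simp add: L_def powr_mult powr_diff powr_realpow)
      moreover have "L powr \<alpha> = (4 * real n) powr \<alpha> * \<delta> powr \<alpha>" using \<delta> n0 by (simp add: L_def powr_mult)
      moreover have "\<delta> ^ n * (L powr (\<alpha> - real n) / (real n - \<alpha>)) = \<delta> ^ n * L powr (\<alpha> - real n) / (real n - \<alpha>)" by simp
      moreover have "K * A * (u * e / \<alpha> + v * e / m) = K * (u / \<alpha> + v / m) * A * e" for u v e m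
        by (simp add: distrib_left distrib_right mult_ac)
      ultimately show ?thesis unfolding difference_constant_def K_def[symmetric] by simp
    qed
    finally show ?thesis .
  qed
  have W: "0 < difference_constant n \<alpha> * A * \<delta> powr \<alpha>"
    using K A \<delta> \<alpha> n0 unfolding difference_constant_def K_def[symmetric]
    by (intro mult_pos_pos add_pos_pos divide_pos_pos) auto
  have er: "0 \<le> r * exp (- t)" "r * exp (- t) < 1" if "0 < t" for t
    using r that by (auto intro: le_less_trans[OF mult_left_le])
  show ?thesis
  proof (rule mean_le_integral[where S="{0<..}" and h="\<lambda>t \<zeta>. t ^ (s - 1) * norm (H ((r * exp (- t)) *\<^sub>R \<zeta>))" and A="\<lambda>t. t ^ (s - 1) * B t"])
    show "continuous_on ({0<..} \<times> sphere 0 1) (\<lambda>(t, \<zeta>). t ^ (s - 1) * norm (H ((r * exp (- t)) *\<^sub>R \<zeta>)))"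
      unfolding split_def
      by (intro continuous_on_mult continuous_on_power continuous_on_fst continuous_on_id continuous_on_norm
           continuous_on_compose2[OF line_holomorphicD(1)[OF H]] continuous_intros)
         (use er in auto)
    show "(\<lambda>t. t ^ (s - 1) * B t) \<in> borel_measurable borel" unfolding B_def by measurable
    show "(\<integral>\<^sup>+t. ennreal (t ^ (s - 1) * B t) * indicator {0<..} t \<partial>lborel) \<le> ennreal (difference_constant n \<alpha> * A * \<delta> powr \<alpha>)"
      by (rule int)
    show "(\<integral>\<^sup>+\<zeta>. ennreal ((t ^ (s - 1) * norm (H ((r * exp (- t)) *\<^sub>R \<zeta>))) powr q) \<partial>sphere_measure) \<le> ennreal ((t ^ (s - 1) * B t) powr q)"
      if "t \<in> {0<..}" for t
      using that by (intro mean_le_cmult[OF line_holomorphicD(1)[OF H] er _ less_imp_le[OF B0] HB]) auto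
    show "continuous_on unit_ball (op_diff n U f)" by (rule line_holomorphicD(1)[OF op_diff_line_holomorphic[OF f U]])
    show "ennreal (norm (op_diff n U f (r *\<^sub>R \<zeta>))) \<le> (\<integral>\<^sup>+t. ennreal (t ^ (s - 1) * norm (H ((r * exp (- t)) *\<^sub>R \<zeta>))) * indicator {0<..} t \<partial>lborel)"
      if "norm \<zeta> = 1" for \<zeta>
      using op_diff_norm_le[OF f s1 U _ n, of "r *\<^sub>R \<zeta>"] that r
      by (simp add: H_def G_def mult.commute)
  qed (use q W r B0 in auto)
qed

lemma half_ball_op: "(\<lambda>z :: complex ^ 'n. (1/2) *s z) \<in> ball_ops"
  using clinear_op_scale[of "1/2"] by (auto simp: ball_ops_def)

text \<open>
  In the difference of \<open>f\<close> along \<open>z \<mapsto> z/2\<close>, every term other than \<open>f(z)\<close>, up to sign, evaluates \<open>f\<close> in the ball of radius \<open>1/2\<close>.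
\<close>

lemma op_diff_half_estimate:
  assumes M: "\<And>z. norm z \<le> 1/2 \<Longrightarrow> norm (f z) \<le> M" and M0: "0 \<le> M"
  shows "norm z \<le> 1/2 \<Longrightarrow> norm (op_diff n (\<lambda>z. (1/2) *s z) f z) \<le> 2 ^ n * M"
    and "norm z < 1 \<Longrightarrow> norm (f z) \<le> norm (op_diff n (\<lambda>z. (1/2) *s z) f z) + 2 ^ n * M"
proof -
  let ?D = "\<lambda>n. op_diff n (\<lambda>z. (1/2) *s z) f"
  show 1: "norm z \<le> 1/2 \<Longrightarrow> norm (?D n z) \<le> 2 ^ n * M" for n z
  proof (induction n arbitrary: z)
    case (Suc n)
    have "norm ((1/2) *s z) \<le> 1/2" using Suc.prems by simp
    from Suc.IH[OF this] Suc.IH[OF Suc.prems] show ?case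
      using norm_triangle_ineq4[of "?D n ((1/2) *s z)" "?D n z"] by (simp add: op_diff_Suc)
  qed (use M in simp)
  show "norm z < 1 \<Longrightarrow> norm (f z) \<le> norm (?D n z) + 2 ^ n * M"
  proof (induction n)
    case (Suc n)
    have "norm ((1/2) *s z) \<le> 1/2" using Suc.prems by simp
    from 1[OF this, of n] Suc.IH[OF Suc.prems] show ?case
      using norm_triangle_ineq2[of "?D n z" "?D n ((1/2) *s z)"] by (simp add: op_diff_Suc norm_minus_commute)
  qed (use M0 in simp)
qed

text \<open>
  The dilation by \<open>1/2\<close> is an operator of the ball at distance \<open>1/2\<close> from the identity, so \<open>mean_le_op_diff\<close>
  bounds the differences of order \<open>s\<close> along it. These determine \<open>f\<close> up to its values in the ball of radius \<open>1/2\<close>.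
\<close>

theorem mean_le_if_radial_deriv_bound:
  fixes f :: "complex ^ 'n \<Rightarrow> complex"
  assumes f: "f \<in> line_holomorphic" and \<alpha>: "0 < \<alpha>"
    and s: "\<alpha> < real s" "real s \<le> \<alpha> + 1" and A: "0 < A"
  obtains B where "0 \<le> B"
    "\<And>q r. 1 \<le> q \<Longrightarrow> (\<And>r. 0 \<le> r \<Longrightarrow> r < 1 \<Longrightarrow> mean_le q r (radial_deriv (real s) f) (A * (1 - r\<^sup>2) powr (\<alpha> - real s)))
       \<Longrightarrow> 0 \<le> r \<Longrightarrow> r < 1 \<Longrightarrow> mean_le q r f B"
proof -
  have s1: "1 \<le> s" using s \<alpha> by (cases s) auto
  obtain M where M: "0 \<le> M" "\<And>z. norm z \<le> 1/2 \<Longrightarrow> norm (f z) \<le> M"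
    using line_holomorphic_bounded[OF f, of "1/2"] by auto
  let ?U = "\<lambda>z :: complex ^ 'n. (1/2) *s z"
  let ?K = "difference_constant s \<alpha> * A * (1/2) powr \<alpha>"
  have K: "0 \<le> ?K" using A \<alpha> s by (auto simp: difference_constant_def)
  show thesis
  proof (rule that[of "?K + 2 ^ s * M"])
    fix q r :: real assume q: "1 \<le> q" and r: "0 \<le> r" "r < 1"
      and bd: "\<And>r. 0 \<le> r \<Longrightarrow> r < 1 \<Longrightarrow> mean_le q r (radial_deriv (real s) f) (A * (1 - r\<^sup>2) powr (\<alpha> - real s))"
    have near: "norm (?U z - z) \<le> 1/2 * norm z" for z
    proof -
      have "?U z - z = (-1/2) *s z" by (simp add: vec_eq_iff field_simps)
      then show ?thesis by (simp only: norm_vec_smult) simp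
    qed
    have "mean_le q r (op_diff s ?U f) ?K"
      by (rule mean_le_op_diff[OF f s1 \<alpha> s(1) s q A bd half_ball_op near _ _ r]) auto
    then show "mean_le q r f (?K + 2 ^ s * M)"
    proof (rule mean_le_add[OF q r, rotated 4, where h="\<lambda>_. of_real (2 ^ s * M)"])
      show "mean_le q r (\<lambda>_. of_real (2 ^ s * M)) (2 ^ s * M)"
        using q M by (intro mean_le_const) (auto simp: norm_mult norm_power)
      show "norm (f (r *\<^sub>R \<zeta>)) \<le> norm (op_diff s ?U f (r *\<^sub>R \<zeta>)) + norm (complex_of_real (2 ^ s * M))" if "norm \<zeta> = 1" for \<zeta>
        using op_diff_half_estimate(2)[where f=f and M=M and z="r *\<^sub>R \<zeta>" and n=s, OF M(2,1)] that r M(1)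
        by (simp add: norm_mult norm_power)
    qed (use K M line_holomorphicD(1)[OF f] line_holomorphicD(1)[OF op_diff_line_holomorphic[OF f half_ball_op]] in auto)
  qed (use K M in auto)
qed

section \<open>The kernel of the radial derivative\<close>

text \<open>
  Multiplication by \<open>k\<close> maps the basis into itself:
  \<open>k binom(k + i, i) = (i + 1) (binom(k + i + 1, i + 1) - binom(k + i, i))\<close>.
\<close>

lemma nat_power_binomial_expansion:
  "\<exists>c :: nat \<Rightarrow> real. \<forall>k. real k ^ s = (\<Sum>i\<le>s. c i * real ((k + i) choose i))"
proof (induction s)
  case 0
  show ?case by (intro exI[of _ "\<lambda>_. 1"]) simp
next
  case (Suc s)
  then obtain c where c: "\<And>k. real k ^ s = (\<Sum>i\<le>s. c i * real ((k + i) choose i))" by blast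
  have step: "real k * real ((k + i) choose i) = real (Suc i) * real ((k + Suc i) choose Suc i) - real (Suc i) * real ((k + i) choose i)" for k i
  proof -
    have "Suc i * ((k + Suc i) choose Suc i) = (k + Suc i) * ((k + i) choose i)"
      using Suc_times_binomial[of i "k + i"] by simp
    then have "real (Suc i) * real ((k + Suc i) choose Suc i) = real (k + Suc i) * real ((k + i) choose i)"
      by (metis of_nat_mult)
    then show ?thesis by (simp add: algebra_simps)
  qed
  define c' where "c' = (\<lambda>i. (case i of 0 \<Rightarrow> 0 | Suc j \<Rightarrow> c j * real (Suc j)) - (if i \<le> s then c i * real (Suc i) else 0))"
  have "real k ^ Suc s = (\<Sum>i\<le>Suc s. c' i * real ((k + i) choose i))" for k
  proof -
    have "real k ^ Suc s = (\<Sum>i\<le>s. c i * (real k * real ((k + i) choose i)))"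
      by (simp add: c sum_distrib_left mult_ac)
    also have "\<dots> = (\<Sum>i\<le>s. c i * real (Suc i) * real ((k + Suc i) choose Suc i)) - (\<Sum>i\<le>s. c i * real (Suc i) * real ((k + i) choose i))"
      by (simp only: step right_diff_distrib sum_subtractf mult.assoc)
    also have "(\<Sum>i\<le>s. c i * real (Suc i) * real ((k + Suc i) choose Suc i))
       = (\<Sum>i\<le>Suc s. (case i of 0 \<Rightarrow> 0 | Suc j \<Rightarrow> c j * real (Suc j)) * real ((k + i) choose i))"
      by (simp only: sum.atMost_Suc_shift) simp
    also have "(\<Sum>i\<le>s. c i * real (Suc i) * real ((k + i) choose i)) = (\<Sum>i\<le>Suc s. (if i \<le> s then c i * real (Suc i) else 0) * real ((k + i) choose i))"
      by simp
    finally show ?thesis by (simp only: c'_def left_diff_distrib sum_subtractf)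
  qed
  then show ?case by blast
qed

lemma binomial_series:
  fixes w :: complex
  assumes w: "norm w < 1"
  shows "(\<lambda>m. of_nat ((m + i) choose i) * w ^ m) sums (1 / (1 - w) ^ Suc i)"
proof -
  have "(\<lambda>m. (- of_nat (Suc i) gchoose m) * (- w) ^ m) sums (1 + - w) powr (- of_nat (Suc i))"
    by (rule gen_binomial_complex) (use w in simp)
  moreover have "(- of_nat (Suc i) gchoose m) * (- w) ^ m = of_nat ((m + i) choose i) * w ^ m" for m
  proof -
    have "(- of_nat (Suc i) gchoose m :: complex) = (- 1) ^ m * ((of_nat (Suc i) + of_nat m - 1) gchoose m)"
      by (rule gbinomial_minus)
    also have "(of_nat (Suc i) + of_nat m - 1 :: complex) = of_nat (m + i)" by simp
    also have "of_nat (m + i) gchoose m = of_nat ((m + i) choose m)" by (rule binomial_gbinomial[symmetric])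
    also have "(m + i) choose m = (m + i) choose i" using binomial_symmetric[of m "m + i"] by simp
    finally have e: "(- of_nat (Suc i) gchoose m :: complex) = (- 1) ^ m * of_nat ((m + i) choose i)" .
    show ?thesis unfolding e power_minus[of w] by (simp add: power_mult_distrib[symmetric] mult_ac)
  qed
  moreover have "(1 + - w) powr (- of_nat (Suc i)) = 1 / (1 - w) ^ Suc i"
  proof -
    have "1 - w \<noteq> 0" using w by auto
    then have "(1 - w) powr (- of_nat (Suc i)) = inverse ((1 - w) ^ Suc i)"
      by (simp only: powr_minus powr_nat if_False)
    then show ?thesis by (simp add: inverse_eq_divide)
  qed
  ultimately show ?thesis by simp
qed

text \<open>
  For \<open>s \<ge> 1\<close> this is the polylogarithm of order \<open>-s\<close>, a rational function with a pole of order \<open>s + 1\<close> at \<open>1\<close>.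
\<close>

definition power_kernel :: "nat \<Rightarrow> complex \<Rightarrow> complex" where
  "power_kernel s w = (\<Sum>m. of_nat m ^ s * w ^ m)"

lemma power_kernel_bound:
  obtains C where "0 < C" 
    "\<And>w. norm w < 1 \<Longrightarrow> (\<lambda>m. of_nat m ^ s * w ^ m) sums power_kernel s w"
    "\<And>w. norm w < 1 \<Longrightarrow> norm (power_kernel s w) \<le> C / norm (1 - w) ^ Suc s"
proof -
  obtain c :: "nat \<Rightarrow> real" where c: "\<And>k. real k ^ s = (\<Sum>i\<le>s. c i * real ((k + i) choose i))"
    using nat_power_binomial_expansion by blast
  have cc: "(of_nat k ^ s :: complex) = (\<Sum>i\<le>s. of_real (c i) * of_nat ((k + i) choose i))" for k
    using c[of k] by (metis (mono_tags, lifting) of_real_mult of_real_of_nat_eq of_real_power of_real_sum sum.cong)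
  define C where "C = (\<Sum>i\<le>s. \<bar>c i\<bar> * 2 ^ (s - i)) + 1"
  have C: "0 < C" unfolding C_def by (intro add_nonneg_pos sum_nonneg) auto
  have sums: "(\<lambda>m. of_nat m ^ s * w ^ m) sums (\<Sum>i\<le>s. of_real (c i) * (1 / (1 - w) ^ Suc i))" if w: "norm w < 1" for w :: complex
  proof -
    have "(\<lambda>m. \<Sum>i\<le>s. of_real (c i) * (of_nat ((m + i) choose i) * w ^ m)) sums (\<Sum>i\<le>s. of_real (c i) * (1 / (1 - w) ^ Suc i))"
      by (intro sums_sum sums_mult binomial_series w)
    then show ?thesis by (simp add: cc sum_distrib_right mult.assoc)
  qed
  show thesis
  proof (rule that[OF C])
    fix w :: complex assume w: "norm w < 1"
    show "(\<lambda>m. of_nat m ^ s * w ^ m) sums power_kernel s w"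
      unfolding power_kernel_def using sums[OF w] by (simp add: sums_iff)
    have eq: "power_kernel s w = (\<Sum>i\<le>s. of_real (c i) * (1 / (1 - w) ^ Suc i))"
      unfolding power_kernel_def using sums[OF w] by (simp add: sums_iff)
    have n0: "0 < norm (1 - w)" using w by auto
    have n2: "norm (1 - w) \<le> 2" using norm_triangle_ineq4[of 1 w] w by simp
    have "norm (power_kernel s w) \<le> (\<Sum>i\<le>s. \<bar>c i\<bar> * (1 / norm (1 - w) ^ Suc i))"
      unfolding eq by (intro order_trans[OF norm_sum]) (simp add: norm_mult norm_divide norm_power)
    also have "\<dots> \<le> (\<Sum>i\<le>s. \<bar>c i\<bar> * (2 ^ (s - i) / norm (1 - w) ^ Suc s))"
    proof (intro sum_mono mult_left_mono)
      fix i assume i: "i \<in> {..s}"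
      have "norm (1 - w) ^ Suc s = norm (1 - w) ^ (s - i) * norm (1 - w) ^ Suc i"
        using i by (simp add: power_add[symmetric])
      also have "\<dots> \<le> 2 ^ (s - i) * norm (1 - w) ^ Suc i"
        using n2 by (intro mult_right_mono power_mono) auto
      finally show "1 / norm (1 - w) ^ Suc i \<le> 2 ^ (s - i) / norm (1 - w) ^ Suc s"
        using n0 by (simp add: divide_simps mult_ac del: power_Suc)
    qed simp
    also have "\<dots> = (C - 1) / norm (1 - w) ^ Suc s"
      by (simp add: C_def sum_divide_distrib)
    also have "\<dots> \<le> C / norm (1 - w) ^ Suc s" by (intro divide_right_mono) auto
    finally show "norm (power_kernel s w) \<le> C / norm (1 - w) ^ Suc s" .
  qed
qed

lemma power_kernel_holomorphic: "power_kernel s holomorphic_on ball 0 1"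
proof (rule power_series_holomorphic[where a="\<lambda>m. of_nat m ^ s"])
  obtain C where C: "\<And>w. norm w < 1 \<Longrightarrow> (\<lambda>m. of_nat m ^ s * w ^ m) sums power_kernel s w"
    using power_kernel_bound[of s] by blast
  fix w :: complex assume "w \<in> ball 0 1"
  then show "(\<lambda>m. of_nat m ^ s * (w - 0) ^ m) sums power_kernel s w" using C[of w] by simp
qed

lemma power_kernel_0: "1 \<le> s \<Longrightarrow> power_kernel s 0 = 0"
  using powser_zero[of "\<lambda>m. of_nat m ^ s :: complex"] by (simp add: power_kernel_def)

section \<open>Radial derivatives from rotated differences\<close>

lemma circle_average_cnj:
  assumes S: "open S" "cball 0 1 \<subseteq> S" and h: "h holomorphic_on S"
  shows "((\<lambda>\<theta>. h (cnj (circle_point \<theta>))) has_integral h 0) {0..1}"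
proof -
  have "open (cnj -` S)" by (intro open_vimage S continuous_intros)
  moreover have "cnj -` S = cnj ` S"
  proof (intro set_eqI iffI)
    fix x assume "x \<in> cnj -` S"
    then have "cnj x \<in> S" by simp
    then show "x \<in> cnj ` S" by (metis complex_cnj_cnj imageI)
  qed auto
  ultimately have oS: "open (cnj ` S)" by simp
  have sub: "cball 0 1 \<subseteq> cnj ` S"
  proof
    fix x :: complex assume "x \<in> cball 0 1"
    then have "cnj x \<in> S" using S by auto
    then show "x \<in> cnj ` S" by (metis complex_cnj_cnj imageI)
  qed
  have "cnj ` (cnj ` S) = S" by (simp add: image_image)
  then have "(cnj \<circ> h \<circ> cnj) holomorphic_on (cnj ` S)"
    using h oS by (intro holomorphic_on_compose_cnj_cnj) auto
  from circle_average[OF oS sub this]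
  have "(cnj \<circ> (\<lambda>\<theta>. h (cnj (circle_point \<theta>))) has_integral cnj (h 0)) {0..1}" by (simp add: comp_def)
  then show ?thesis by (simp only: has_integral_cnj)
qed

lemma circle_coefficient:
  assumes S: "open S" "cball 0 1 \<subseteq> S" and h: "h holomorphic_on S"
  shows "((\<lambda>\<theta>. h (circle_point \<theta>) * cnj (circle_point \<theta>) ^ m) has_integral ((deriv ^^ m) h 0 / fact m)) {0..1}"
proof -
  have "((\<lambda>u. h u / (u - 0) ^ Suc m) has_contour_integral ((2 * pi * \<i>) / fact m * (deriv ^^ m) h 0)) (circlepath 0 1)"
  proof (rule Cauchy_has_contour_integral_higher_derivative_circlepath)
    show "continuous_on (cball 0 1) h"
      using S h by (meson holomorphic_on_imp_continuous_on holomorphic_on_subset)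
    show "h holomorphic_on ball 0 1"
      using S h by (meson ball_subset_cball holomorphic_on_subset subset_trans)
  qed simp
  from circlepath_integral_average[OF this]
  have *: "((\<lambda>\<theta>. h (circle_point \<theta>) / circle_point \<theta> ^ Suc m * circle_point \<theta>) has_integral ((deriv ^^ m) h 0 / fact m)) {0..1}"
    by simp
  have "cnj (circle_point \<theta>) = 1 / circle_point \<theta>" for \<theta>
    by (simp add: nonzero_eq_divide_eq complex_norm_square[symmetric] mult.commute)
  then show ?thesis
    by (intro has_integral_eq[OF _ *]) (simp add: power_divide)
qed

text \<open>
  The coefficients are signed binomial coefficients; the value \<open>1\<close> of the top one normalises the representation of the
  radial derivative below.
\<close>

lemma op_diff_rotation_expansion:
  "\<exists>a :: nat \<Rightarrow> complex. a n = 1 \<and> (\<forall>f c (w :: complex ^ 'n). op_diff n (\<lambda>z. c *s z) f w = (\<Sum>j\<le>n. a j * f (c ^ j *s w)))"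
proof (induction n)
  case 0
  show ?case by (intro exI[of _ "\<lambda>_. 1"]) simp
next
  case (Suc n)
  then obtain a where a: "a n = 1" "\<And>f c (w :: complex ^ 'n). op_diff n (\<lambda>z. c *s z) f w = (\<Sum>j\<le>n. a j * f (c ^ j *s w))" by blast
  define a' where "a' = (\<lambda>j. (case j of 0 \<Rightarrow> 0 | Suc i \<Rightarrow> a i) - (if j \<le> n then a j else 0))"
  have "op_diff (Suc n) (\<lambda>z. c *s z) f w = (\<Sum>j\<le>Suc n. a' j * f (c ^ j *s w))" for f c and w :: "complex ^ 'n"
  proof -
    have "(\<Sum>j\<le>Suc n. (case j of 0 \<Rightarrow> 0 | Suc i \<Rightarrow> a i) * f (c ^ j *s w)) = (\<Sum>j\<le>n. a j * f (c ^ j *s (c *s w)))"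
      by (simp only: sum.atMost_Suc_shift) (simp add: vector_smult_assoc mult.commute)
    moreover have "(\<Sum>j\<le>Suc n. (if j \<le> n then a j else 0) * f (c ^ j *s w)) = (\<Sum>j\<le>n. a j * f (c ^ j *s w))" by simp
    ultimately show ?thesis by (simp only: op_diff_Suc a a'_def left_diff_distrib sum_subtractf)
  qed
  moreover have "a' (Suc n) = 1" using a by (simp add: a'_def)
  ultimately show ?case by blast
qed

lemma radial_deriv_full_series:
  assumes f: "f \<in> line_holomorphic" and s: "1 \<le> s" and z: "norm z < 1"
  shows "(\<lambda>k. of_nat k ^ s * slice_coeff f k z) sums radial_deriv (real s) f z"
proof -
  have "(\<lambda>k. of_nat (Suc k) ^ s * slice_coeff f (Suc k) z) sums radial_deriv (real s) f z"
    unfolding radial_deriv_nat[OF f]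
    by (rule summable_sums[OF summable_norm_cancel[OF radial_deriv_summable[OF f z]]])
  then have "(\<lambda>k. of_nat k ^ s * slice_coeff f k z) sums (radial_deriv (real s) f z + of_nat 0 ^ s * slice_coeff f 0 z)"
    by (rule sums_Suc)
  then show ?thesis using s by (cases s) auto
qed

text \<open>
  The term of order \<open>m\<close> of the kernel extracts the Taylor coefficient of order \<open>m\<close> of \<open>u \<mapsto> f(uz)\<close> and multiplies it by
  \<open>m\<^sup>s \<rho>\<^sup>m\<close>.
\<close>

lemma rotation_times_kernel_integral:
  fixes f :: "complex ^ 'n \<Rightarrow> complex"
  assumes f: "f \<in> line_holomorphic" and s: "1 \<le> s" and z: "norm z < 1" and \<rho>: "0 \<le> \<rho>" "\<rho> < 1"
  shows "((\<lambda>\<theta>. f (circle_point \<theta> *s z) * power_kernel s (of_real \<rho> * cnj (circle_point \<theta>))) has_integral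
     radial_deriv (real s) f (\<rho> *\<^sub>R z)) {0..1}"
proof -
  let ?S = "{c. c *s z \<in> unit_ball}"
  have sub: "cball 0 1 \<subseteq> ?S"
    using z by (auto intro: le_less_trans[OF mult_left_le_one_le])
  note hol = slice_holomorphic[OF f, of z]
  obtain C where ks: "\<And>w. norm w < 1 \<Longrightarrow> (\<lambda>m. of_nat m ^ s * w ^ m) sums power_kernel s w"
    using power_kernel_bound[of s] by blast
  obtain M where M: "0 \<le> M" "\<And>w. norm w \<le> norm z \<Longrightarrow> norm (f w) \<le> M"
    using line_holomorphic_bounded[OF f z] by blast
  define e where "e = (\<lambda>m \<theta>. of_nat m ^ s * of_real \<rho> ^ m * (f (circle_point \<theta> *s z) * cnj (circle_point \<theta>) ^ m))"
  have eint: "(e m has_integral (of_nat m ^ s * of_real \<rho> ^ m * slice_coeff f m z)) {0..1}" for m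
    unfolding e_def slice_coeff_def
    by (intro has_integral_mult_right circle_coefficient[OF open_slice sub hol])
  have bd: "norm (e m \<theta>) \<le> M * (real m ^ s * \<rho> ^ m)" for m \<theta>
  proof -
    have "norm (f (circle_point \<theta> *s z)) \<le> M" by (rule M) simp
    from mult_left_mono[OF this, of "real m ^ s * \<rho> ^ m"] show ?thesis
      using \<rho> by (simp add: e_def norm_mult norm_power mult_ac)
  qed
  have sm: "summable (\<lambda>m. M * (real m ^ s * \<rho> ^ m))"
    using \<rho> by (intro summable_mult summable_nat_power_times_geometric) simp
  have esum: "(\<Sum>m. e m \<theta>) = f (circle_point \<theta> *s z) * power_kernel s (of_real \<rho> * cnj (circle_point \<theta>))" for \<theta>
  proof -
    have "norm (of_real \<rho> * cnj (circle_point \<theta>)) < 1" using \<rho> by (simp add: norm_mult)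
    from sums_mult[OF ks[OF this], of "f (circle_point \<theta> *s z)"] show ?thesis
      by (simp add: sums_iff e_def power_mult_distrib mult_ac)
  qed
  have ul: "uniform_limit {0..1} (\<lambda>n \<theta>. \<Sum>m<n. e m \<theta>) (\<lambda>\<theta>. \<Sum>m. e m \<theta>) sequentially"
    by (rule Weierstrass_m_test[OF _ sm]) (rule bd)
  have econt: "continuous_on {0..1} (\<lambda>\<theta>. \<Sum>m<n. e m \<theta>)" for n
  proof -
    have img: "circle_point ` {0..1} \<subseteq> ?S" using z by auto
    show ?thesis unfolding e_def
      by (intro continuous_on_sum continuous_on_mult continuous_on_const continuous_on_power continuous_on_cnj
          continuous_on_circle_point continuous_on_id continuous_on_compose2[OF holomorphic_on_imp_continuous_on[OF hol] _ img])
  qed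
  obtain I J where J: "\<And>n. ((\<lambda>\<theta>. \<Sum>m<n. e m \<theta>) has_integral I n) {0..1}"
     "((\<lambda>\<theta>. \<Sum>m. e m \<theta>) has_integral J) {0..1}" "I \<longlonglongrightarrow> J"
    using uniform_limit_integral[OF ul econt] by auto
  have "I n = (\<Sum>m<n. of_nat m ^ s * of_real \<rho> ^ m * slice_coeff f m z)" for n
    by (rule has_integral_unique[OF J(1)]) (intro has_integral_sum eint, simp)
  then have "(\<lambda>m. of_nat m ^ s * of_real \<rho> ^ m * slice_coeff f m z) sums J"
    using J(3) unfolding sums_def by presburger
  moreover have "slice_coeff f m (\<rho> *\<^sub>R z) = of_real \<rho> ^ m * slice_coeff f m z" for m
    unfolding scaleR_eq_smult by (rule slice_coeff_homogeneous[OF f])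
  moreover have "norm (\<rho> *\<^sub>R z) < 1" using z \<rho> by (simp add: le_less_trans[OF mult_left_le_one_le])
  ultimately have "radial_deriv (real s) f (\<rho> *\<^sub>R z) = J"
    using radial_deriv_full_series[OF f s, of "\<rho> *\<^sub>R z"] by (simp add: mult.assoc sums_iff)
  then show ?thesis using J(2) by (simp add: esum)
qed

text \<open>
  The integrand is a holomorphic function of the conjugate variable, so its average is its value at \<open>0\<close>, where the
  kernel vanishes.
\<close>

lemma conjugate_times_kernel_integral:
  fixes f :: "complex ^ 'n \<Rightarrow> complex"
  assumes f: "f \<in> line_holomorphic" and s: "1 \<le> s" and z: "norm z < 1" and \<rho>: "0 \<le> \<rho>" "\<rho> < 1"
  shows "((\<lambda>\<theta>. f (cnj (circle_point \<theta>) ^ l *s z) * power_kernel s (of_real \<rho> * cnj (circle_point \<theta>))) has_integral 0) {0..1}"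
proof -
  define S where "S = {c. c ^ l *s z \<in> unit_ball} \<inter> {c :: complex. norm (of_real \<rho> * c) < 1}"
  have "open ((\<lambda>c. c ^ l *s z) -` unit_ball)" by (intro open_vimage continuous_intros) auto
  moreover have "open {c :: complex. norm (of_real \<rho> * c) < 1}" by (intro open_Collect_less continuous_intros)
  ultimately have oS: "open S" unfolding S_def by (auto simp: vimage_def)
  have sub: "cball 0 1 \<subseteq> S"
  proof
    fix c :: complex assume c: "c \<in> cball 0 1"
    have "norm c ^ l * norm z \<le> norm z" using c by (intro mult_left_le_one_le) (auto intro: power_le_one)
    moreover have "\<rho> * norm c \<le> \<rho>" using c \<rho> by (intro mult_left_le) auto
    ultimately show "c \<in> S" using z \<rho> by (simp add: S_def norm_mult norm_power)
  qed
  have h1: "(\<lambda>c. f (c ^ l *s z)) holomorphic_on S"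
  proof -
    have "(\<lambda>c. (\<lambda>c. f (c *s z)) (c ^ l)) holomorphic_on S"
      by (rule holomorphic_on_compose_gen[OF _ slice_holomorphic[OF f, of z], unfolded comp_def])
         (auto simp: S_def intro!: holomorphic_intros)
    then show ?thesis .
  qed
  have h2: "(\<lambda>c. power_kernel s (of_real \<rho> * c)) holomorphic_on S"
    by (rule holomorphic_on_compose_gen[OF _ power_kernel_holomorphic, unfolded comp_def])
       (auto simp: S_def intro!: holomorphic_intros)
  from circle_average_cnj[OF oS sub holomorphic_on_mult[OF h1 h2]] show ?thesis
    by (simp add: power_kernel_0[OF s])
qed

text \<open>
  Turning the argument by the inverse rotation to the power \<open>n - 1\<close> leaves a single term \<open>f(uz)\<close> of positive frequency
  in the difference; the other terms involve nonnegative powers of the conjugate of \<open>u\<close>. The kernel contains only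
  frequencies of the opposite sign and no constant term, hence it kills those terms and turns \<open>f(uz)\<close> into the
  radial derivative.
\<close>

lemma radial_deriv_rotation_representation:
  fixes f :: "complex ^ 'n \<Rightarrow> complex"
  assumes f: "f \<in> line_holomorphic" and s: "1 \<le> s" and n: "1 \<le> n" and z: "norm z < 1" and \<rho>: "0 \<le> \<rho>" "\<rho> < 1"
  shows "((\<lambda>\<theta>. op_diff n (\<lambda>z. circle_point \<theta> *s z) f (cnj (circle_point \<theta>) ^ (n - 1) *s z)
      * power_kernel s (of_real \<rho> * cnj (circle_point \<theta>))) has_integral radial_deriv (real s) f (\<rho> *\<^sub>R z)) {0..1}"
proof -
  obtain a :: "nat \<Rightarrow> complex" where a: "a n = 1"
    "\<And>f c (w :: complex ^ 'n). op_diff n (\<lambda>z. c *s z) f w = (\<Sum>j\<le>n. a j * f (c ^ j *s w))"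
    using op_diff_rotation_expansion[of n] by blast
  let ?u = circle_point and ?P = "\<lambda>\<theta>. power_kernel s (of_real \<rho> * cnj (circle_point \<theta>))"
  have uu: "?u \<theta> * cnj (?u \<theta>) = 1" for \<theta> by (simp add: complex_norm_square[symmetric])
  have low: "?u \<theta> ^ j * cnj (?u \<theta>) ^ (n - 1) = cnj (?u \<theta>) ^ (n - 1 - j)" if "j < n" for j \<theta>
  proof -
    have "cnj (?u \<theta>) ^ (n - 1) = cnj (?u \<theta>) ^ j * cnj (?u \<theta>) ^ (n - 1 - j)"
      using that by (simp add: power_add[symmetric])
    then have "?u \<theta> ^ j * cnj (?u \<theta>) ^ (n - 1) = (?u \<theta> * cnj (?u \<theta>)) ^ j * cnj (?u \<theta>) ^ (n - 1 - j)"
      by (simp add: power_mult_distrib mult.assoc)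
    then show ?thesis by (simp add: uu)
  qed
  have top: "?u \<theta> ^ n * cnj (?u \<theta>) ^ (n - 1) = ?u \<theta>" for \<theta>
  proof -
    have "?u \<theta> ^ n = ?u \<theta> * ?u \<theta> ^ (n - 1)" using n by (simp add: power_eq_if)
    then have "?u \<theta> ^ n * cnj (?u \<theta>) ^ (n - 1) = ?u \<theta> * (?u \<theta> * cnj (?u \<theta>)) ^ (n - 1)"
      by (simp add: power_mult_distrib mult.assoc)
    then show ?thesis by (simp add: uu)
  qed
  have expand: "op_diff n (\<lambda>z. ?u \<theta> *s z) f (cnj (?u \<theta>) ^ (n - 1) *s z) * ?P \<theta>
     = (\<Sum>j<n. a j * (f (cnj (?u \<theta>) ^ (n - 1 - j) *s z) * ?P \<theta>)) + f (?u \<theta> *s z) * ?P \<theta>" for \<theta>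
  proof -
    have "op_diff n (\<lambda>z. ?u \<theta> *s z) f (cnj (?u \<theta>) ^ (n - 1) *s z)
       = (\<Sum>j<n. a j * f (cnj (?u \<theta>) ^ (n - 1 - j) *s z)) + f (?u \<theta> *s z)"
      unfolding a(2) lessThan_Suc_atMost[symmetric] vector_smult_assoc
      by (simp add: a(1) low[unfolded One_nat_def] top[unfolded One_nat_def])
    then show ?thesis by (simp add: sum_distrib_right distrib_right mult.assoc)
  qed
  have "((\<lambda>\<theta>. (\<Sum>j<n. a j * (f (cnj (?u \<theta>) ^ (n - 1 - j) *s z) * ?P \<theta>)) + f (?u \<theta> *s z) * ?P \<theta>)
     has_integral ((\<Sum>j<n. a j * 0) + radial_deriv (real s) f (\<rho> *\<^sub>R z))) {0..1}"
    by (intro has_integral_add has_integral_sum has_integral_mult_right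
        conjugate_times_kernel_integral[OF f s z \<rho>] rotation_times_kernel_integral[OF f s z \<rho>]) simp
  then show ?thesis by (simp only: expand) simp
qed


section \<open>Radial derivatives are controlled by rotation differences\<close>

lemma sin_pi_lower:
  assumes y: "0 \<le> y" "y \<le> 1/2"
  shows "y \<le> sin (pi * y)"
proof -
  define x where "x = pi * y"
  have "pi * y \<le> 4 * (1/2)" using y pi_less_4 by (intro mult_mono) auto
  then have x: "0 \<le> x" "x \<le> 2" using y by (auto simp: x_def)
  have "(\<Sum>m<3. sin_coeff m * x ^ m) = x"
    by (simp add: numeral_3_eq_3 sin_coeff_def)
  moreover have "inverse (fact 3 :: real) * \<bar>x\<bar> ^ 3 = x ^ 3 / 6" using x by (simp add: fact_numeral)
  ultimately have "\<bar>sin x - x\<bar> \<le> x ^ 3 / 6" using Maclaurin_sin_bound[of x 3] by simp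
  then have "x - x ^ 3 / 6 \<le> sin x" by linarith
  moreover have "x ^ 3 \<le> 4 * x"
    using mult_mono[of x 2 x 2] mult_right_mono[of "x * x" 4 x] x by (simp add: power3_eq_cube)
  ultimately have "x / 3 \<le> sin x" by linarith
  moreover have "3 * y \<le> pi * y" using y pi_gt3 by (intro mult_right_mono) auto
  ultimately show ?thesis by (simp add: x_def)
qed

lemma circle_point_chord:
  assumes "0 \<le> \<theta>" "\<theta> \<le> 1"
  shows "2 * min \<theta> (1 - \<theta>) \<le> norm (1 - circle_point \<theta>)"
proof -
  have "norm (circle_point \<theta> - 1) = 2 * \<bar>sin (pi * \<theta>)\<bar>"
    using dist_exp_i_1[of "2 * pi * \<theta>"] by (simp add: circle_point_def mult_ac)
  moreover have "min \<theta> (1 - \<theta>) \<le> sin (pi * \<theta>)"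
  proof (cases "\<theta> \<le> 1/2")
    case True then show ?thesis using sin_pi_lower[of \<theta>] assms by (simp add: min_def)
  next
    case False
    have "sin (pi * (1 - \<theta>)) = sin (pi * \<theta>)" by (simp add: right_diff_distrib sin_diff)
    then show ?thesis using sin_pi_lower[of "1 - \<theta>"] assms False by (simp add: min_def)
  qed
  ultimately show ?thesis by (simp add: norm_minus_commute)
qed

text \<open>
  The second bound follows from the first one and from the length of the chord:
  \<open>|1 - u| \<le> |1 - \<rho>u| + (1 - \<rho>) \<le> 2 |1 - \<rho>u|\<close>.
\<close>

lemma kernel_distance_lower:
  assumes \<theta>: "0 \<le> \<theta>" "\<theta> \<le> 1" and \<rho>: "0 \<le> \<rho>" "\<rho> < 1"
  shows "1 - \<rho> \<le> norm (1 - of_real \<rho> * cnj (circle_point \<theta>))"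
    and "min \<theta> (1 - \<theta>) \<le> norm (1 - of_real \<rho> * cnj (circle_point \<theta>))"
proof -
  let ?u = "cnj (circle_point \<theta>)"
  show 1: "1 - \<rho> \<le> norm (1 - of_real \<rho> * ?u)"
    using norm_triangle_ineq2[of 1 "of_real \<rho> * ?u"] \<rho> by (simp add: norm_mult)
  have "norm (1 - ?u) \<le> norm (1 - of_real \<rho> * ?u) + norm (of_real \<rho> * ?u - ?u)"
    using norm_triangle_ineq[of "1 - of_real \<rho> * ?u" "of_real \<rho> * ?u - ?u"] by simp
  moreover have "norm (of_real \<rho> * ?u - ?u) = 1 - \<rho>"
  proof -
    have "of_real \<rho> * ?u - ?u = of_real (\<rho> - 1) * ?u" by (simp add: left_diff_distrib)
    then show ?thesis using \<rho> by (simp only: norm_mult norm_of_real complex_mod_cnj norm_circle_point) simp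
  qed
  moreover have "norm (1 - ?u) = norm (1 - circle_point \<theta>)"
    by (metis complex_cnj_diff complex_cnj_one complex_mod_cnj)
  ultimately show "min \<theta> (1 - \<theta>) \<le> norm (1 - of_real \<rho> * ?u)"
    using circle_point_chord[OF \<theta>] 1 by (smt (verit))
qed

lemma scale_ball_op: "norm c \<le> 1 \<Longrightarrow> (\<lambda>z :: complex ^ 'n. c *s z) \<in> ball_ops"
  using clinear_op_scale[of c] by (auto simp: ball_ops_def intro!: le_less_trans[OF mult_left_le_one_le])

lemma op_diff_inverse_scale:
  assumes "c * d = 1"
  shows "op_diff n (\<lambda>z. c *s z) f z = (- 1) ^ n * op_diff n (\<lambda>z. d *s z) f (c ^ n *s z)"
proof (induction n arbitrary: z)
  case (Suc n)
  have "d *s (c ^ Suc n *s z) = c ^ n *s z"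
    using assms by (simp add: vector_smult_assoc mult.assoc[symmetric] mult.commute)
  moreover have "c ^ n *s (c *s z) = c ^ Suc n *s z" by (simp add: vector_smult_assoc mult.commute)
  ultimately show ?case
    by (simp only: op_diff_Suc Suc.IH power_Suc[of "- 1 :: complex"]) (simp add: algebra_simps del: power_Suc vector_smult_assoc)
qed simp

lemma rot_diff_eq_op_diff: "rot_diff n t f = op_diff n (\<lambda>z. exp (\<i> * of_real t) *s z) f"
  by (simp add: rot_diff_def op_diff_def)

text \<open>
  For \<open>\<theta> \<le> 1/2\<close> the rotation has angle \<open>2\<pi>\<theta>\<close>; for \<open>\<theta> > 1/2\<close> it is the inverse of the rotation by \<open>2\<pi>(1 - \<theta>)\<close>, and the
  difference along an inverse operator is, up to sign, a rotated difference along the operator. Angles of size at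
  least \<open>1\<close> are covered by the bound \<open>2\<^sup>n A\<close>.
\<close>

lemma mean_le_rotated_difference:
  fixes f :: "complex ^ 'n \<Rightarrow> complex"
  assumes f: "f \<in> line_holomorphic" and q: "1 \<le> q" and A: "0 < A" and \<alpha>: "0 < \<alpha>"
    and rot: "\<And>t r. 0 < t \<Longrightarrow> t < 1 \<Longrightarrow> 0 < r \<Longrightarrow> r < 1 \<Longrightarrow> mean_le q r (rot_diff n t f) (A * t powr \<alpha>)"
    and triv: "\<And>r. 0 < r \<Longrightarrow> r < 1 \<Longrightarrow> mean_le q r f A"
    and r: "0 < r" "r < 1" and \<theta>: "0 < \<theta>" "\<theta> < 1" and w: "norm w = 1"
  shows "mean_le q r (\<lambda>z. op_diff n (\<lambda>z. circle_point \<theta> *s z) f (w *s z)) (2 ^ n * A * (2 * pi * min \<theta> (1 - \<theta>)) powr \<alpha>)"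
proof -
  define B where "B = (\<lambda>t. 2 ^ n * A * t powr \<alpha>)"
  have base: "mean_le q r (op_diff n (\<lambda>z. exp (\<i> * of_real t) *s z) f) (B t)" if t: "0 < t" for t
  proof (cases "t < 1")
    case True
    have "1 * (A * t powr \<alpha>) \<le> 2 ^ n * (A * t powr \<alpha>)" using A by (intro mult_right_mono) auto
    then have "A * t powr \<alpha> \<le> B t" by (simp add: B_def)
    then show ?thesis
      using mean_le_mono[OF rot[OF t True r]] q A by (simp add: rot_diff_eq_op_diff)
  next
    case False
    have 1: "1 \<le> t powr \<alpha>" using False \<alpha> by (simp add: ge_one_powr_ge_zero)
    have "(\<lambda>z :: complex ^ 'n. exp (\<i> * of_real t) *s z) \<in> ball_ops" by (rule scale_ball_op) simp
    from mean_le_op_diff_trivial[OF f this _ r(2) q _ triv[OF r]]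
    have m: "mean_le q r (op_diff n (\<lambda>z. exp (\<i> * of_real t) *s z) f) (2 ^ n * A)" using r A by simp
    have "2 ^ n * A * 1 \<le> B t" unfolding B_def using 1 A by (intro mult_left_mono) auto
    then show ?thesis using mean_le_mono[OF m] q A by simp
  qed
  have turned: "mean_le q r (\<lambda>z. op_diff n (\<lambda>z. exp (\<i> * of_real t) *s z) f (c *s z)) (B t)"
    if t: "0 < t" and c: "norm c = 1" for t c
  proof (rule mean_le_compose[OF _ clinear_op_scale, of _ _ r])
    show "op_diff n (\<lambda>z. exp (\<i> * of_real t) *s z) f \<in> line_holomorphic"
      by (intro op_diff_line_holomorphic[OF f] scale_ball_op) simp
  qed (use r q A c base[OF t] in \<open>auto simp: B_def\<close>)
  show ?thesis
  proof (cases "\<theta> \<le> 1/2")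
    case True
    then have "min \<theta> (1 - \<theta>) = \<theta>" by simp
    moreover have "circle_point \<theta> = exp (\<i> * of_real (2 * pi * \<theta>))" by (simp add: circle_point_def mult_ac)
    ultimately show ?thesis using turned[of "2 * pi * \<theta>" w] \<theta> w by (simp add: B_def)
  next
    case False
    then have m: "min \<theta> (1 - \<theta>) = 1 - \<theta>" by simp
    let ?t = "2 * pi * (1 - \<theta>)"
    have inv: "circle_point \<theta> * exp (\<i> * of_real ?t) = 1"
    proof -
      have "circle_point \<theta> * exp (\<i> * of_real ?t) = exp (2 * of_real pi * \<i>)"
        by (simp add: circle_point_def exp_add[symmetric] algebra_simps)
      then show ?thesis by simp
    qed
    have "mean_le q r (\<lambda>z. op_diff n (\<lambda>z. exp (\<i> * of_real ?t) *s z) f ((circle_point \<theta> ^ n * w) *s z)) (B ?t)"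
      by (rule turned) (use \<theta> w in \<open>auto simp: norm_mult norm_power\<close>)
    then show ?thesis
      unfolding m B_def
      by (rule mean_le_mono)
         (use q A in \<open>auto simp: op_diff_inverse_scale[OF inv] norm_mult norm_power vector_smult_assoc\<close>)
  qed
qed

lemma radial_deriv_at_0:
  assumes f: "f \<in> line_holomorphic"
  shows "radial_deriv (real s) f 0 = 0"
proof -
  have "slice_coeff f (Suc k) 0 = 0" for k
    using slice_coeff_homogeneous[OF f, of "Suc k" 0 0] by simp
  then show ?thesis by (simp add: radial_deriv_nat[OF f])
qed

text \<open>
  Minkowski's inequality for the rotation representation. With \<open>y\<close> the distance of \<open>\<theta>\<close> from the integers and \<open>1 - \<epsilon>\<close> the dilation in the kernel,
  the integrand is bounded by a multiple of \<open>y\<^sup>\<alpha> / max(\<epsilon>, y)\<^sup>s\<^sup>+\<^sup>1\<close>, whose integral is of order \<open>\<epsilon>\<^sup>\<alpha>\<^sup>-\<^sup>s\<close> since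
  \<open>s > \<alpha>\<close>.
\<close>

theorem mean_le_radial_deriv:
  assumes n: "1 \<le> n" and \<alpha>: "0 < \<alpha>" and s: "\<alpha> < real s"
  obtains K where "0 < K"
    "\<And>(f :: complex ^ 'n \<Rightarrow> complex) q A r. \<lbrakk>f \<in> line_holomorphic; 1 \<le> q; 0 < A;
        \<And>t r. 0 < t \<Longrightarrow> t < 1 \<Longrightarrow> 0 < r \<Longrightarrow> r < 1 \<Longrightarrow> mean_le q r (rot_diff n t f) (A * t powr \<alpha>);
        \<And>r. 0 < r \<Longrightarrow> r < 1 \<Longrightarrow> mean_le q r f A; 0 \<le> r; r < 1\<rbrakk>
      \<Longrightarrow> mean_le q r (radial_deriv (real s) f) (K * A * (1 - r\<^sup>2) powr (\<alpha> - real s))"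
proof -
  obtain C where C: "0 < C" "\<And>w. norm w < 1 \<Longrightarrow> norm (power_kernel s w) \<le> C / norm (1 - w) ^ Suc s"
    using power_kernel_bound[of s] by metis
  define K0 where "K0 = 2 * (2 ^ n * (2 * pi) powr \<alpha> * C * (1 / (\<alpha> + 1) + 1 / (real s - \<alpha>)))"
  have K0: "0 < K0" unfolding K0_def using \<alpha> s C by (intro mult_pos_pos add_pos_pos) auto
  define K where "K = K0 * 4 powr (real s - \<alpha>)"
  have K: "0 < K" using K0 by (simp add: K_def)
  have s1: "1 \<le> s" using s \<alpha> by (cases s) auto
  show thesis
  proof (rule that[OF K])
    fix f :: "complex ^ 'n \<Rightarrow> complex" and q A r :: real
    assume f: "f \<in> line_holomorphic" and q: "1 \<le> q" and A: "0 < A"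
      and rot: "\<And>t r. 0 < t \<Longrightarrow> t < 1 \<Longrightarrow> 0 < r \<Longrightarrow> r < 1 \<Longrightarrow> mean_le q r (rot_diff n t f) (A * t powr \<alpha>)"
      and triv: "\<And>r. 0 < r \<Longrightarrow> r < 1 \<Longrightarrow> mean_le q r f A" and r: "0 \<le> r" "r < 1"
    define G where "G = radial_deriv (real s) f"
    have G: "G \<in> line_holomorphic" unfolding G_def by (rule radial_deriv_line_holomorphic[OF f])
    show "mean_le q r (radial_deriv (real s) f) (K * A * (1 - r\<^sup>2) powr (\<alpha> - real s))"
    proof (cases "r = 0")
      case True
      then show ?thesis using q K A by (intro mean_le_const) (auto simp: radial_deriv_at_0[OF f])
    next
      case False
      \<comment> \<open>one factor \<open>x\<close> of the radius \<open>r = x\<^sup>2\<close> is the dilation \<open>\<rho>\<close> in the kernel, the other one the radius of the mean\<close>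
      define x where "x = sqrt r"
      have x: "0 < x" "x < 1" "r = x * x" using r False by (auto simp: x_def)
      define \<epsilon> where "\<epsilon> = 1 - x"
      have \<epsilon>: "0 < \<epsilon>" "\<epsilon> \<le> 1" using x by (auto simp: \<epsilon>_def)
      \<comment> \<open>\<open>\<epsilon>\<^sup>s\<^sup>+\<^sup>1 y\<^sup>\<alpha> / max(\<epsilon>, y)\<^sup>s\<^sup>+\<^sup>1\<close>, written in the form required by \<open>nn_integral_powr_split\<close> with exponent \<open>\<alpha> + 1\<close> and order \<open>s + 1\<close>\<close>
      define E where "E = (\<lambda>y. if y < \<epsilon> then y powr (\<alpha> + 1 - 1) else \<epsilon> ^ Suc s * y powr (\<alpha> + 1 - 1 - real (Suc s)))"
      have E0: "0 < E y" if "0 < y" for y using that \<epsilon> by (auto simp: E_def)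
      have E0': "0 \<le> E y" for y using \<epsilon> by (auto simp: E_def)
      have Em[measurable]: "E \<in> borel_measurable borel" unfolding E_def by measurable
      define J where "J = \<epsilon> powr (\<alpha> + 1) / (\<alpha> + 1) + \<epsilon> ^ Suc s * (\<epsilon> powr (\<alpha> + 1 - real (Suc s)) / (real (Suc s) - (\<alpha> + 1)))"
      have EJ: "(\<integral>\<^sup>+y. ennreal (E y) * indicator {0<..} y \<partial>lborel) \<le> ennreal J"
        unfolding E_def J_def using \<alpha> s \<epsilon> by (intro nn_integral_powr_split) auto
      have J: "J = \<epsilon> powr (\<alpha> + 1) * (1 / (\<alpha> + 1) + 1 / (real s - \<alpha>))"
      proof -
        have "\<epsilon> ^ Suc s * \<epsilon> powr (\<alpha> + 1 - real (Suc s)) = \<epsilon> powr (\<alpha> + 1)"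
          using \<epsilon> by (simp add: powr_realpow[symmetric] powr_add[symmetric] add.commute del: power_Suc)
        then show ?thesis by (simp add: J_def distrib_left)
      qed
      define K1 where "K1 = 2 ^ n * A * (2 * pi) powr \<alpha> * C / \<epsilon> ^ Suc s"
      have K1: "0 < K1" unfolding K1_def using A C \<epsilon> by (intro divide_pos_pos mult_pos_pos) auto
      define W where "W = K1 * (J + J)"
      have W: "W = K0 * A * \<epsilon> powr (\<alpha> - real s)"
      proof -
        have "\<epsilon> powr (\<alpha> + 1) / \<epsilon> ^ Suc s = \<epsilon> powr (\<alpha> - real s)"
          using \<epsilon> by (simp add: powr_realpow[symmetric] powr_diff[symmetric] del: power_Suc)
        moreover have "W = K0 * A * (\<epsilon> powr (\<alpha> + 1) / \<epsilon> ^ Suc s)"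
          unfolding W_def K0_def K1_def J by simp
        ultimately show ?thesis by simp
      qed
      have W0: "0 < W" unfolding W using K0 A \<epsilon> by simp
      let ?u = circle_point
      let ?P = "\<lambda>\<theta>. power_kernel s (of_real x * cnj (?u \<theta>))"
      define D where "D = (\<lambda>\<theta> z. op_diff n (\<lambda>z. ?u \<theta> *s z) f (cnj (?u \<theta>) ^ (n - 1) *s z))"
      have Dlh: "D \<theta> \<in> line_holomorphic" for \<theta>
        unfolding D_def
        by (rule line_holomorphic_compose[OF op_diff_line_holomorphic[OF f]])
           (auto intro!: scale_ball_op simp: norm_power)
      have inb: "norm (of_real x * cnj (?u \<theta>)) < 1" for \<theta> using x by (simp add: norm_mult)
      have Pb: "norm (?P \<theta>) * (2 ^ n * A * (2 * pi * min \<theta> (1 - \<theta>)) powr \<alpha>) \<le> K1 * (E \<theta> + E (1 - \<theta>))"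
        if \<theta>: "0 < \<theta>" "\<theta> < 1" for \<theta>
      proof -
        define y where "y = min \<theta> (1 - \<theta>)"
        define d where "d = norm (1 - of_real x * cnj (?u \<theta>))"
        have y: "0 < y" using \<theta> by (simp add: y_def)
        have d: "\<epsilon> \<le> d" "y \<le> d"
          using kernel_distance_lower[of \<theta> x] \<theta> x by (auto simp: d_def \<epsilon>_def y_def)
        have yE: "y powr \<alpha> / d ^ Suc s \<le> E y / \<epsilon> ^ Suc s"
        proof (cases "y < \<epsilon>")
          case True
          have "y powr \<alpha> / d ^ Suc s \<le> y powr \<alpha> / \<epsilon> ^ Suc s"
            using d \<epsilon> by (intro divide_left_mono power_mono mult_pos_pos zero_less_power) auto
          then show ?thesis using True by (simp add: E_def)
        next
          case False
          have "y powr \<alpha> / d ^ Suc s \<le> y powr \<alpha> / y ^ Suc s"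
            using d y by (intro divide_left_mono power_mono mult_pos_pos zero_less_power) auto
          also have "\<dots> = E y / \<epsilon> ^ Suc s"
            using False y \<epsilon> by (simp add: E_def powr_diff powr_realpow del: power_Suc of_nat_Suc)
          finally show ?thesis .
        qed
        have "norm (?P \<theta>) * (2 ^ n * A * (2 * pi * y) powr \<alpha>) \<le> C / d ^ Suc s * (2 ^ n * A * (2 * pi * y) powr \<alpha>)"
          unfolding d_def using A by (intro mult_right_mono C(2) inb) auto
        also have "\<dots> = 2 ^ n * A * (2 * pi) powr \<alpha> * C * (y powr \<alpha> / d ^ Suc s)"
          using y by (simp add: powr_mult)
        also have "\<dots> \<le> 2 ^ n * A * (2 * pi) powr \<alpha> * C * (E y / \<epsilon> ^ Suc s)"
          using yE A C by (intro mult_left_mono) auto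
        also have "\<dots> = K1 * E y" by (simp add: K1_def)
        also have "\<dots> \<le> K1 * (E \<theta> + E (1 - \<theta>))"
          using K1 E0'[of \<theta>] E0'[of "1 - \<theta>"] by (intro mult_left_mono) (auto simp: y_def min_def)
        finally show ?thesis by (simp add: y_def)
      qed
      have Dc: "continuous_on (UNIV \<times> unit_ball) (\<lambda>p. D (fst p) (snd p))"
      proof -
        obtain a :: "nat \<Rightarrow> complex" where a:
          "\<And>f c (w :: complex ^ 'n). op_diff n (\<lambda>z. c *s z) f w = (\<Sum>j\<le>n. a j * f (c ^ j *s w))"
          using op_diff_rotation_expansion[of n] by blast
        show ?thesis unfolding D_def a
          by (intro continuous_on_sum continuous_on_mult continuous_on_const
              continuous_on_compose2[OF line_holomorphicD(1)[OF f]] continuous_on_smult continuous_on_power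
              continuous_on_circle_point continuous_on_cnj continuous_on_fst continuous_on_snd continuous_on_id)
             (auto simp: norm_power norm_mult)
      qed
      have Pc: "continuous_on UNIV ?P"
        by (rule continuous_on_compose2[OF holomorphic_on_imp_continuous_on[OF power_kernel_holomorphic]])
           (use inb in \<open>auto intro!: continuous_intros\<close>)
      have "mean_le q x (\<lambda>z. G (x *\<^sub>R z)) W"
      proof (rule mean_le_integral[where S="{0<..<1}" and h="\<lambda>\<theta> \<zeta>. norm (?P \<theta>) * norm (D \<theta> (x *\<^sub>R \<zeta>))"
            and A="\<lambda>\<theta>. K1 * (E \<theta> + E (1 - \<theta>))"])
        show "continuous_on ({0<..<1} \<times> sphere 0 1) (\<lambda>(\<theta>, \<zeta>). norm (?P \<theta>) * norm (D \<theta> (x *\<^sub>R \<zeta>)))"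
        proof -
          have 1: "continuous_on ({0<..<1::real} \<times> sphere (0 :: complex ^ 'n) 1) (\<lambda>p. (fst p, x *\<^sub>R snd p))"
            by (intro continuous_intros)
          have 2: "(\<lambda>p. (fst p, x *\<^sub>R snd p)) ` ({0<..<1::real} \<times> sphere (0 :: complex ^ 'n) 1) \<subseteq> UNIV \<times> unit_ball"
            using x by auto
          from continuous_on_compose2[OF Dc 1 2]
          have 3: "continuous_on ({0<..<1::real} \<times> sphere (0 :: complex ^ 'n) 1) (\<lambda>p. D (fst p) (x *\<^sub>R snd p))" by simp
          have 4: "continuous_on ({0<..<1::real} \<times> sphere (0 :: complex ^ 'n) 1) (\<lambda>p. ?P (fst p))"
            by (rule continuous_on_compose2[OF Pc continuous_on_fst[OF continuous_on_id]]) simp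
          show ?thesis unfolding split_def by (intro continuous_on_mult continuous_on_norm 3 4)
        qed
        show "(\<lambda>\<theta>. K1 * (E \<theta> + E (1 - \<theta>))) \<in> borel_measurable borel" by measurable
        show "(\<integral>\<^sup>+\<theta>. ennreal (K1 * (E \<theta> + E (1 - \<theta>))) * indicator {0<..<1} \<theta> \<partial>lborel) \<le> ennreal W"
        proof -
          have "(\<integral>\<^sup>+\<theta>. ennreal (E (1 - \<theta>)) * indicator {0<..} (1 - \<theta>) \<partial>lborel)
             = (\<integral>\<^sup>+\<theta>. ennreal (E (1 + \<theta>)) * indicator {0<..} (1 + \<theta>) \<partial>lborel)"
            using nn_integral_lborel_reflect[of "\<lambda>\<theta>. ennreal (E (1 + \<theta>)) * indicator {0<..} (1 + \<theta>)"] by simp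
          also have "\<dots> = (\<integral>\<^sup>+\<theta>. ennreal (E \<theta>) * indicator {0<..} \<theta> \<partial>lborel)"
            by (rule nn_integral_lborel_translate[of "\<lambda>\<theta>. ennreal (E \<theta>) * indicator {0<..} \<theta>"]) simp
          finally have EJ': "(\<integral>\<^sup>+\<theta>. ennreal (E (1 - \<theta>)) * indicator {0<..} (1 - \<theta>) \<partial>lborel) \<le> ennreal J"
            using EJ by simp
          have J0: "0 \<le> J" unfolding J using \<alpha> s by (intro mult_nonneg_nonneg add_nonneg_nonneg) auto
          have "(\<integral>\<^sup>+\<theta>. ennreal (K1 * (E \<theta> + E (1 - \<theta>))) * indicator {0<..<1} \<theta> \<partial>lborel)
            \<le> (\<integral>\<^sup>+\<theta>. ennreal K1 * (ennreal (E \<theta>) * indicator {0<..} \<theta> + ennreal (E (1 - \<theta>)) * indicator {0<..} (1 - \<theta>)) \<partial>lborel)"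
            using K1 E0' by (intro nn_integral_mono) (auto simp: ennreal_mult ennreal_plus split: split_indicator)
          also have "\<dots> = ennreal K1 * ((\<integral>\<^sup>+\<theta>. ennreal (E \<theta>) * indicator {0<..} \<theta> \<partial>lborel) +
               (\<integral>\<^sup>+\<theta>. ennreal (E (1 - \<theta>)) * indicator {0<..} (1 - \<theta>) \<partial>lborel))"
            by (subst nn_integral_cmult, measurable, subst nn_integral_add) auto
          also have "\<dots> \<le> ennreal K1 * (ennreal J + ennreal J)"
            by (intro mult_left_mono add_mono EJ EJ') simp
          also have "\<dots> = ennreal W" unfolding W_def using K1 J0
            by (subst ennreal_mult, simp, simp, subst ennreal_plus) auto
          finally show ?thesis .
        qed
        show "(\<integral>\<^sup>+\<zeta>. ennreal ((norm (?P \<theta>) * norm (D \<theta> (x *\<^sub>R \<zeta>))) powr q) \<partial>sphere_measure)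
            \<le> ennreal ((K1 * (E \<theta> + E (1 - \<theta>))) powr q)" if "\<theta> \<in> {0<..<1}" for \<theta>
        proof -
          have \<theta>: "0 < \<theta>" "\<theta> < 1" using that by auto
          have "mean_le q x (D \<theta>) (2 ^ n * A * (2 * pi * min \<theta> (1 - \<theta>)) powr \<alpha>)"
            unfolding D_def
            by (rule mean_le_rotated_difference[OF f q A \<alpha> rot triv x(1,2) \<theta>]) (auto simp: norm_power)
          then have "(\<integral>\<^sup>+\<zeta>. ennreal ((norm (?P \<theta>) * norm (D \<theta> (x *\<^sub>R \<zeta>))) powr q) \<partial>sphere_measure)
            \<le> ennreal ((norm (?P \<theta>) * (2 ^ n * A * (2 * pi * min \<theta> (1 - \<theta>)) powr \<alpha>)) powr q)"
            using x A by (intro mean_le_cmult line_holomorphicD(1)[OF Dlh]) auto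
          also have "\<dots> \<le> ennreal ((K1 * (E \<theta> + E (1 - \<theta>))) powr q)"
            using Pb[OF \<theta>] A q by (intro ennreal_leI powr_mono2) auto
          finally show ?thesis .
        qed
        show "continuous_on unit_ball (\<lambda>z. G (x *\<^sub>R z))"
          unfolding scaleR_eq_smult
          by (rule line_holomorphicD(1)[OF line_holomorphic_compose[OF G scale_ball_op]]) (use x in simp)
        fix \<zeta> :: "complex ^ 'n" assume z: "norm \<zeta> = 1"
        have z1: "norm (x *\<^sub>R \<zeta>) < 1" using z x by simp
        have int: "((\<lambda>\<theta>. D \<theta> (x *\<^sub>R \<zeta>) * ?P \<theta>) has_integral G (x *\<^sub>R (x *\<^sub>R \<zeta>))) {0..1}"
          unfolding D_def G_def by (rule radial_deriv_rotation_representation[OF f s1 n z1]) (use x in auto)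
        have img: "(\<lambda>\<theta>. (\<theta>, x *\<^sub>R \<zeta>)) ` {0..1} \<subseteq> UNIV \<times> unit_ball" using z1 by auto
        have "continuous_on {0..1} (\<lambda>\<theta>. D \<theta> (x *\<^sub>R \<zeta>))"
          using continuous_on_compose2[OF Dc continuous_on_Pair[OF continuous_on_id continuous_on_const] img] by simp
        then have cont: "continuous_on {0..1} (\<lambda>\<theta>. D \<theta> (x *\<^sub>R \<zeta>) * ?P \<theta>)"
          by (intro continuous_on_mult continuous_on_subset[OF Pc]) auto
        have "ennreal (norm (G (x *\<^sub>R (x *\<^sub>R \<zeta>)))) \<le> (\<integral>\<^sup>+\<theta>. ennreal (norm (D \<theta> (x *\<^sub>R \<zeta>) * ?P \<theta>)) * indicator {0..1} \<theta> \<partial>lborel)"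
          by (rule norm_integral_le_nn_integral[OF int cont])
        also have "\<dots> = (\<integral>\<^sup>+\<theta>. ennreal (norm (?P \<theta>) * norm (D \<theta> (x *\<^sub>R \<zeta>))) * indicator {0<..<1} \<theta> \<partial>lborel)"
        proof (rule nn_integral_cong_AE)
          have "AE \<theta> in lborel. \<theta> \<noteq> (0::real)" "AE \<theta> in lborel. \<theta> \<noteq> (1::real)" by (rule AE_lborel_singleton)+
          then show "AE \<theta> in lborel. ennreal (norm (D \<theta> (x *\<^sub>R \<zeta>) * ?P \<theta>)) * indicator {0..1} \<theta>
             = ennreal (norm (?P \<theta>) * norm (D \<theta> (x *\<^sub>R \<zeta>))) * indicator {0<..<1} \<theta>"
            by eventually_elim (auto simp: norm_mult mult.commute split: split_indicator)
        qed
        finally show "ennreal (norm (G (x *\<^sub>R (x *\<^sub>R \<zeta>)))) \<le> \<dots>" .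
      next
        show "0 < K1 * (E \<theta> + E (1 - \<theta>))" if "\<theta> \<in> {0<..<1}" for \<theta>
          using that by (intro mult_pos_pos add_pos_pos K1 E0) auto
      qed (use q W0 x in simp_all)
      then have m: "mean_le q r G W" by (simp add: mean_le_def x(3))
      have "W \<le> K * A * (1 - r\<^sup>2) powr (\<alpha> - real s)"
      proof -
        have r2: "1 - r\<^sup>2 = \<epsilon> * ((1 + x) * (1 + x\<^sup>2))"
          by (simp add: x(3) \<epsilon>_def power2_eq_square algebra_simps)
        have "(1 + x) * (1 + x\<^sup>2) \<le> 2 * 2"
          using x by (intro mult_mono) (auto simp: power_le_one)
        then have "1 - r\<^sup>2 \<le> \<epsilon> * (2 * 2)" unfolding r2 using \<epsilon> by (intro mult_left_mono) auto
        then have le: "(1 - r\<^sup>2) / 4 \<le> \<epsilon>" by simp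
        have pos: "0 < (1 - r\<^sup>2) / 4" using r by (simp add: power_less_one_iff abs_square_less_1)
        have "\<epsilon> powr (\<alpha> - real s) \<le> ((1 - r\<^sup>2) / 4) powr (\<alpha> - real s)"
          using le pos s by (intro powr_mono2') auto
        also have "\<dots> = 4 powr (real s - \<alpha>) * (1 - r\<^sup>2) powr (\<alpha> - real s)"
          using pos by (simp add: powr_divide powr_diff)
        finally have "K0 * A * \<epsilon> powr (\<alpha> - real s) \<le> K0 * A * (4 powr (real s - \<alpha>) * (1 - r\<^sup>2) powr (\<alpha> - real s))"
          using K0 A by (intro mult_left_mono) auto
        then show ?thesis by (simp add: W K_def mult_ac)
      qed
      then show ?thesis using mean_le_mono[OF m] q W0 by (simp add: G_def)
    qed
  qed
qed

section \<open>The equivalences\<close>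

lemma holo_ball_line_holomorphic:
  fixes f :: "complex ^ 'n \<Rightarrow> complex"
  assumes "f \<in> holo_ball"
  shows "f \<in> line_holomorphic"
  unfolding line_holomorphic_def
proof (intro CollectI conjI allI)
  have deriv: "\<exists>D. (f has_derivative D) (at z) \<and> (\<forall>c v. D (c *s v) = c * D v)" if "z \<in> unit_ball" for z
    using assms that by (auto simp: holo_ball_def)
  show "continuous_on unit_ball f"
    by (rule continuous_at_imp_continuous_on) (use deriv has_derivative_continuous in blast)
  fix z v :: "complex ^ 'n"
  show "(\<lambda>c. f (z + c *s v)) holomorphic_on {c. z + c *s v \<in> unit_ball}"
  proof (rule holomorphic_on_open[OF open_line_slice, THEN iffD2], rule ballI)
    fix c assume c: "c \<in> {c. z + c *s v \<in> unit_ball}"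
    obtain D where D: "(f has_derivative D) (at (z + c *s v))" "\<And>c v. D (c *s v) = c * D v"
      using deriv[of "z + c *s v"] c by blast
    have "bounded_linear (\<lambda>h. h *s v)"
      by (rule linear_conv_bounded_linear[THEN iffD1], rule linearI) (auto simp: vec_eq_iff algebra_simps)
    then have "((\<lambda>c. z + c *s v) has_derivative (\<lambda>h. 0 + h *s v)) (at c)"
      by (intro has_derivative_add has_derivative_const bounded_linear_imp_has_derivative)
    from has_derivative_compose[OF this D(1)]
    have "((\<lambda>c. f (z + c *s v)) has_field_derivative (D v)) (at c)"
      by (simp add: D(2) has_field_derivative_def mult.commute[of _ "D v"])
    then show "\<exists>f'. ((\<lambda>c. f (z + c *s v)) has_field_derivative f') (at c)" by blast
  qed
qed

lemma hardy_norm_le_iff: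
  fixes g :: "complex ^ 'n \<Rightarrow> complex"
  assumes "continuous_on unit_ball g" "1 \<le> p" "0 \<le> A"
  shows "hardy_norm p g \<le> ennreal A \<longleftrightarrow> (\<forall>q\<in>finite_exponents p. \<forall>r. 0 < r \<and> r < 1 \<longrightarrow> mean_le q r g A)"
  unfolding hardy_norm_def SUP_le_iff using pmean_le_iff[OF assms(1) _ _ assms(2,3)] by auto

lemma ennreal_finite_bound:
  assumes "x < (\<infinity> :: ennreal)"
  obtains A where "0 < A" "x \<le> ennreal A"
  using assms by (cases x) (auto intro: that[of "enn2real x + 1"] simp: ennreal_leI)

lemma ennreal_mult_le_iff:
  assumes "0 < c"
  shows "ennreal c * x \<le> ennreal A \<longleftrightarrow> x \<le> ennreal (A / c)"
proof (cases x rule: ennreal_cases)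
  case (real y)
  show ?thesis
  proof (cases "0 \<le> A")
    case True
    then show ?thesis using real assms by (simp add: ennreal_mult[symmetric] ennreal_le_iff field_simps)
  next
    case False
    then have "A / c \<le> 0" using assms by (simp add: divide_nonpos_pos)
    then show ?thesis using real assms False by (simp add: ennreal_neg ennreal_mult[symmetric] mult_le_0_iff)
  qed
qed (use assms in \<open>auto simp: ennreal_mult_top top_unique\<close>)

text \<open>
  All radii share one constant \<open>A\<close>, and for \<open>p = \<infinity>\<close> all finite exponents share it as well.
\<close>

lemma lipschitz_space_iff:
  fixes f :: "complex ^ 'n \<Rightarrow> complex"
  assumes f: "f \<in> holo_ball" and p: "1 \<le> p" and s: "real s = real_of_int (\<lfloor>\<alpha>\<rfloor> + 1)"
  shows "f \<in> lipschitz_space p \<alpha> \<longleftrightarrow> (\<exists>A>0. \<forall>q\<in>finite_exponents p. \<forall>r. 0 \<le> r \<and> r < 1 \<longrightarrow>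
     mean_le q r (radial_deriv (real s) f) (A * (1 - r\<^sup>2) powr (\<alpha> - real s)))"
proof -
  let ?G = "radial_deriv (real s) f"
  have G: "continuous_on unit_ball ?G"
    by (rule line_holomorphicD(1)[OF radial_deriv_line_holomorphic[OF holo_ball_line_holomorphic[OF f]]])
  have eq: "ennreal ((1 - r\<^sup>2) powr (real s - \<alpha>)) * pmean p r ?G \<le> ennreal A \<longleftrightarrow>
      (\<forall>q\<in>finite_exponents p. mean_le q r ?G (A * (1 - r\<^sup>2) powr (\<alpha> - real s)))"
    if r: "0 \<le> r" "r < 1" and A: "0 < A" for r A
  proof -
    have "0 < 1 - r\<^sup>2" using r by (simp add: abs_square_less_1)
    then have pos: "0 < (1 - r\<^sup>2) powr (real s - \<alpha>)" and inv: "A / (1 - r\<^sup>2) powr (real s - \<alpha>) = A * (1 - r\<^sup>2) powr (\<alpha> - real s)"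
      using powr_minus_divide[of "1 - r\<^sup>2" "real s - \<alpha>"] by auto
    show ?thesis unfolding ennreal_mult_le_iff[OF pos] inv by (rule pmean_le_iff[OF G r p]) (use A in simp)
  qed
  have "f \<in> lipschitz_space p \<alpha> \<longleftrightarrow> (SUP r\<in>{0..<1}. ennreal ((1 - r\<^sup>2) powr (real s - \<alpha>)) * pmean p r ?G) < \<infinity>"
    using f by (simp add: lipschitz_space_def s Let_def)
  also have "\<dots> \<longleftrightarrow> (\<exists>A>0. (SUP r\<in>{0..<1}. ennreal ((1 - r\<^sup>2) powr (real s - \<alpha>)) * pmean p r ?G) \<le> ennreal A)"
  proof -
    have "S < \<infinity> \<longleftrightarrow> (\<exists>A>0. S \<le> ennreal A)" for S :: ennreal
      by (rule iffI, blast elim: ennreal_finite_bound, auto intro: le_less_trans)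
    then show ?thesis by blast
  qed
  also have "\<dots> \<longleftrightarrow> (\<exists>A>0. \<forall>r\<in>{0..<1}. \<forall>q\<in>finite_exponents p. mean_le q r ?G (A * (1 - r\<^sup>2) powr (\<alpha> - real s)))"
  proof -
    have "(SUP r\<in>{0..<1}. ennreal ((1 - r\<^sup>2) powr (real s - \<alpha>)) * pmean p r ?G) \<le> ennreal A \<longleftrightarrow>
        (\<forall>r\<in>{0..<1}. \<forall>q\<in>finite_exponents p. mean_le q r ?G (A * (1 - r\<^sup>2) powr (\<alpha> - real s)))" if "0 < A" for A
      unfolding SUP_le_iff by (rule ball_cong[OF refl]) (rule eq, use that in simp_all)
    then show ?thesis by blast
  qed
  finally show ?thesis by auto
qed

lemma power_bound_pos:
  assumes "power_bound \<alpha> h"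
  obtains C where "0 < C" "\<And>x. 0 < x \<Longrightarrow> x < 1 \<Longrightarrow> h x \<le> ennreal (C * x powr \<alpha>)"
proof -
  obtain C where C: "\<And>x. 0 < x \<and> x < 1 \<Longrightarrow> h x \<le> ennreal (C * x powr \<alpha>)"
    using assms unfolding power_bound_def by blast
  show thesis
  proof (rule that[of "max C 1"])
    fix x :: real assume x: "0 < x" "x < 1"
    have "ennreal (C * x powr \<alpha>) \<le> ennreal (max C 1 * x powr \<alpha>)" by (intro ennreal_leI mult_right_mono) auto
    then show "h x \<le> ennreal (max C 1 * x powr \<alpha>)" using C[of x] x by (meson order_trans)
  qed simp
qed

lemma power_bound_mono:
  assumes "power_bound \<alpha> h" "\<And>x. 0 < x \<Longrightarrow> x < 1 \<Longrightarrow> k x \<le> h x"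
  shows "power_bound \<alpha> k"
  using assms unfolding power_bound_def by (meson order_trans)

lemma unitary_ops_subset_ball_ops: "unitary_ops \<subseteq> (ball_ops :: (complex ^ 'n \<Rightarrow> complex ^ 'n) set)"
proof
  fix U :: "complex ^ 'n \<Rightarrow> complex ^ 'n" assume U: "U \<in> unitary_ops"
  have "norm (U z) = norm z" for z
  proof -
    have "hprod (U z) (U z) = hprod z z" using U by (simp add: unitary_ops_def)
    then have "(norm (U z))\<^sup>2 = (norm z)\<^sup>2" unfolding hprod_self by (simp only: of_real_eq_iff)
    then show ?thesis by simp
  qed
  then show "U \<in> ball_ops" using U by (auto simp: unitary_ops_def ball_ops_def)
qed

lemma rotation_unitary: "(\<lambda>z :: complex ^ 'n. exp (\<i> * of_real t) *s z) \<in> unitary_ops"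
proof -
  let ?c = "exp (\<i> * complex_of_real t)"
  have cc: "?c * cnj ?c = 1" by (simp add: complex_norm_square[symmetric])
  have "surj (\<lambda>z :: complex ^ 'n. ?c *s z)"
    by (rule surjI[where f="\<lambda>z. cnj ?c *s z"]) (simp add: vector_smult_assoc cc)
  moreover have "hprod (?c *s z) (?c *s w) = hprod z w" for z w :: "complex ^ 'n"
  proof -
    have "hprod (?c *s z) (?c *s w) = (\<Sum>i\<in>UNIV. (?c * cnj ?c) * (z $ i * cnj (w $ i)))"
      by (simp add: hprod_def mult_ac)
    then show ?thesis unfolding cc by (simp add: hprod_def)
  qed
  ultimately show ?thesis by (simp add: unitary_ops_def clinear_op_scale)
qed

lemma onorm_rotation_le: "onorm (\<lambda>z :: complex ^ 'n. exp (\<i> * of_real t) *s z - z) \<le> \<bar>t\<bar>"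
proof (rule onorm_le)
  fix z :: "complex ^ 'n"
  have "norm (exp (\<i> * of_real t) - 1) \<le> \<bar>t\<bar>"
    using dist_exp_i_1[of t] abs_sin_x_le_abs_x[of "t / 2"] by simp
  moreover have "exp (\<i> * of_real t) *s z - z = (exp (\<i> * of_real t) - 1) *s z"
    by (simp add: vec_eq_iff left_diff_distrib)
  ultimately show "norm (exp (\<i> * of_real t) *s z - z) \<le> \<bar>t\<bar> * norm z"
    by (simp only: norm_vec_smult mult_right_mono norm_ge_zero)
qed

lemma modulus_le_modulus_plus: "modulus n \<delta> f p \<le> modulus_plus n \<delta> f p"
  unfolding modulus_def modulus_plus_def
  using unitary_ops_subset_ball_ops by (intro SUP_subset_mono) auto

lemma modulus_minus_le_modulus: "modulus_minus n \<delta> f p \<le> modulus n \<delta> f p"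
  unfolding modulus_minus_def modulus_def
proof (rule SUP_least)
  fix t assume "t \<in> {t. \<bar>t\<bar> < \<delta>}"
  then have "(\<lambda>z. exp (\<i> * of_real t) *s z) \<in> {U \<in> unitary_ops. onorm (\<lambda>z. U z - z) < \<delta>}"
    using rotation_unitary[of t] le_less_trans[OF onorm_rotation_le[of t]] by auto
  then show "hardy_norm p (rot_diff n t f) \<le> (SUP U\<in>{U \<in> unitary_ops. onorm (\<lambda>z. U z - z) < \<delta>}. hardy_norm p (op_diff n U f))"
    unfolding rot_diff_eq_op_diff by (rule SUP_upper)
qed

lemma rot_diff_power_bound_if_modulus_minus:
  assumes "power_bound \<alpha> (\<lambda>\<delta>. modulus_minus n \<delta> f p)" and \<alpha>: "0 < \<alpha>"
  shows "power_bound \<alpha> (\<lambda>t. hardy_norm p (rot_diff n t f))"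
proof -
  obtain C where C: "0 < C" "\<And>\<delta>. 0 < \<delta> \<Longrightarrow> \<delta> < 1 \<Longrightarrow> modulus_minus n \<delta> f p \<le> ennreal (C * \<delta> powr \<alpha>)"
    using power_bound_pos[OF assms(1)] by blast
  show ?thesis unfolding power_bound_def
  proof (intro exI[of _ "C * 2 powr \<alpha>"] allI impI)
    fix t :: real assume t: "0 < t \<and> t < 1"
    \<comment> \<open>strictly between \<open>t\<close> and \<open>1\<close>, but at most \<open>2t\<close>\<close>
    define \<delta> where "\<delta> = min (2 * t) ((1 + t) / 2)"
    have \<delta>: "0 < \<delta>" "\<delta> < 1" "t < \<delta>" "\<delta> \<le> 2 * t" using t by (auto simp: \<delta>_def min_less_iff_disj)
    have "hardy_norm p (rot_diff n t f) \<le> modulus_minus n \<delta> f p"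
      unfolding modulus_minus_def using t \<delta> by (intro SUP_upper) auto
    also have "\<dots> \<le> ennreal (C * \<delta> powr \<alpha>)" by (rule C(2)[OF \<delta>(1,2)])
    also have "\<dots> \<le> ennreal (C * (2 * t) powr \<alpha>)"
      using C(1) \<delta> \<alpha> by (intro ennreal_leI mult_left_mono powr_mono2) auto
    also have "C * (2 * t) powr \<alpha> = C * 2 powr \<alpha> * t powr \<alpha>" using t by (simp add: powr_mult)
    finally show "hardy_norm p (rot_diff n t f) \<le> ennreal (C * 2 powr \<alpha> * t powr \<alpha>)" .
  qed
qed

lemma order_of_radial_derivative:
  assumes "0 < \<alpha>"
  obtains s :: nat where "real s = real_of_int (\<lfloor>\<alpha>\<rfloor> + 1)" "\<alpha> < real s" "real s \<le> \<alpha> + 1"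
proof (rule that[of "nat (\<lfloor>\<alpha>\<rfloor> + 1)"])
  have "0 \<le> \<lfloor>\<alpha>\<rfloor>" using assms by simp
  then show eq: "real (nat (\<lfloor>\<alpha>\<rfloor> + 1)) = real_of_int (\<lfloor>\<alpha>\<rfloor> + 1)" by simp
  show "\<alpha> < real (nat (\<lfloor>\<alpha>\<rfloor> + 1))" "real (nat (\<lfloor>\<alpha>\<rfloor> + 1)) \<le> \<alpha> + 1"
    unfolding eq using real_of_int_floor_add_one_gt[of \<alpha>] of_int_floor_le[of \<alpha>] by simp_all
qed

lemma modulus_plus_power_bound_if_lipschitz:
  fixes f :: "complex ^ 'n \<Rightarrow> complex"
  assumes f: "f \<in> lipschitz_space p \<alpha>" and n: "1 \<le> n" and p: "1 \<le> p" and \<alpha>: "0 < \<alpha>" "\<alpha> < real n"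
  shows "power_bound \<alpha> (\<lambda>\<delta>. modulus_plus n \<delta> f p)"
proof -
  obtain s :: nat where s: "real s = real_of_int (\<lfloor>\<alpha>\<rfloor> + 1)" "\<alpha> < real s" "real s \<le> \<alpha> + 1"
    using order_of_radial_derivative[OF \<alpha>(1)] by blast
  have fh: "f \<in> holo_ball" using f by (simp add: lipschitz_space_def)
  note fl = holo_ball_line_holomorphic[OF fh]
  obtain A where A: "0 < A" "\<And>q r. q \<in> finite_exponents p \<Longrightarrow> 0 \<le> r \<Longrightarrow> r < 1 \<Longrightarrow>
     mean_le q r (radial_deriv (real s) f) (A * (1 - r\<^sup>2) powr (\<alpha> - real s))"
    using f lipschitz_space_iff[OF fh p s(1)] by blast
  show ?thesis unfolding power_bound_def
  proof (intro exI[of _ "difference_constant n \<alpha> * A"] allI impI)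
    fix \<delta> :: real assume \<delta>: "0 < \<delta> \<and> \<delta> < 1"
    show "modulus_plus n \<delta> f p \<le> ennreal (difference_constant n \<alpha> * A * \<delta> powr \<alpha>)"
      unfolding modulus_plus_def
    proof (rule SUP_least)
      fix U :: "complex ^ 'n \<Rightarrow> complex ^ 'n"
      assume "U \<in> {U \<in> ball_ops. onorm (\<lambda>z. U z - z) < \<delta>}"
      then have U: "U \<in> ball_ops" "onorm (\<lambda>z. U z - z) < \<delta>" by auto
      have "bounded_linear (\<lambda>z. U z - z)"
        by (intro bounded_linear_sub clinear_op_bounded_linear bounded_linear_ident ball_opsD(1)[OF U(1)])
      then have near: "norm (U z - z) \<le> \<delta> * norm z" for z
        using onorm[of "\<lambda>z. U z - z" z] mult_right_mono[OF less_imp_le[OF U(2)], of "norm z"] by simp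
      have K: "0 \<le> difference_constant n \<alpha> * A * \<delta> powr \<alpha>"
        using A \<alpha> by (auto simp: difference_constant_def)
      show "hardy_norm p (op_diff n U f) \<le> ennreal (difference_constant n \<alpha> * A * \<delta> powr \<alpha>)"
        unfolding hardy_norm_le_iff[OF line_holomorphicD(1)[OF op_diff_line_holomorphic[OF fl U(1)]] p K]
      proof (intro ballI allI impI)
        fix q r :: real assume q: "q \<in> finite_exponents p" and r: "0 < r \<and> r < 1"
        show "mean_le q r (op_diff n U f) (difference_constant n \<alpha> * A * \<delta> powr \<alpha>)"
          by (rule mean_le_op_diff[OF fl n \<alpha> s(2,3) finite_exponents_ge_1[OF p q] A(1) A(2)[OF q] U(1) near])
             (use \<delta> r in auto)
      qed
    qed
  qed
qed

lemma lipschitz_if_rot_diff_power_bound: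
  fixes f :: "complex ^ 'n \<Rightarrow> complex"
  assumes f: "f \<in> hardy_space p" and n: "1 \<le> n" and p: "1 \<le> p" and \<alpha>: "0 < \<alpha>"
    and bound: "power_bound \<alpha> (\<lambda>t. hardy_norm p (rot_diff n t f))"
  shows "f \<in> lipschitz_space p \<alpha>"
proof -
  obtain s :: nat where s: "real s = real_of_int (\<lfloor>\<alpha>\<rfloor> + 1)" "\<alpha> < real s" "real s \<le> \<alpha> + 1"
    using order_of_radial_derivative[OF \<alpha>] by blast
  have fh: "f \<in> holo_ball" using f by (simp add: hardy_space_def)
  note fl = holo_ball_line_holomorphic[OF fh]
  obtain C where C: "0 < C" "\<And>t. 0 < t \<Longrightarrow> t < 1 \<Longrightarrow> hardy_norm p (rot_diff n t f) \<le> ennreal (C * t powr \<alpha>)"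
    using power_bound_pos[OF bound] by blast
  obtain H where H: "0 < H" "hardy_norm p f \<le> ennreal H"
    using f ennreal_finite_bound unfolding hardy_space_def by blast
  define A where "A = max C H"
  have A: "0 < A" "C \<le> A" "H \<le> A" using C(1) by (auto simp: A_def)
  have rotl: "rot_diff n t f \<in> line_holomorphic" for t
    unfolding rot_diff_eq_op_diff by (intro op_diff_line_holomorphic[OF fl] scale_ball_op) simp
  have rot: "mean_le q r (rot_diff n t f) (A * t powr \<alpha>)"
    if q: "q \<in> finite_exponents p" and t: "0 < t" "t < 1" and r: "0 < r" "r < 1" for q t r
  proof -
    have "hardy_norm p (rot_diff n t f) \<le> ennreal (A * t powr \<alpha>)"
      using A by (intro order_trans[OF C(2)[OF t]] ennreal_leI mult_right_mono) auto
    then show ?thesis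
      using hardy_norm_le_iff[OF line_holomorphicD(1)[OF rotl[of t]] p, of "A * t powr \<alpha>"] A q r by simp
  qed
  have triv: "mean_le q r f A" if q: "q \<in> finite_exponents p" and r: "0 < r" "r < 1" for q r
  proof -
    have "hardy_norm p f \<le> ennreal A" using A by (intro order_trans[OF H(2)] ennreal_leI) auto
    then show ?thesis using hardy_norm_le_iff[OF line_holomorphicD(1)[OF fl] p, of A] A q r by simp
  qed
  obtain K where K: "0 < K"
    "\<And>(f :: complex ^ 'n \<Rightarrow> complex) q A r. \<lbrakk>f \<in> line_holomorphic; 1 \<le> q; 0 < A;
        \<And>t r. 0 < t \<Longrightarrow> t < 1 \<Longrightarrow> 0 < r \<Longrightarrow> r < 1 \<Longrightarrow> mean_le q r (rot_diff n t f) (A * t powr \<alpha>);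
        \<And>r. 0 < r \<Longrightarrow> r < 1 \<Longrightarrow> mean_le q r f A; 0 \<le> r; r < 1\<rbrakk>
      \<Longrightarrow> mean_le q r (radial_deriv (real s) f) (K * A * (1 - r\<^sup>2) powr (\<alpha> - real s))"
    using mean_le_radial_deriv[OF n \<alpha> s(2)] by blast
  have "mean_le q r (radial_deriv (real s) f) (K * A * (1 - r\<^sup>2) powr (\<alpha> - real s))"
    if "q \<in> finite_exponents p" "0 \<le> r" "r < 1" for q r
    by (rule K(2)[OF fl finite_exponents_ge_1[OF p that(1)] A(1) rot[OF that(1)] triv[OF that(1)] that(2,3)])
  then show ?thesis
    unfolding lipschitz_space_iff[OF fh p s(1)] using K(1) A(1) by (intro exI[of _ "K * A"]) auto
qed

lemma lipschitz_space_subset_hardy_space: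
  assumes p: "1 \<le> p" and \<alpha>: "0 < \<alpha>"
  shows "(lipschitz_space p \<alpha> :: (complex ^ 'n \<Rightarrow> complex) set) \<subseteq> hardy_space p"
proof
  fix f :: "complex ^ 'n \<Rightarrow> complex" assume f: "f \<in> lipschitz_space p \<alpha>"
  obtain s :: nat where s: "real s = real_of_int (\<lfloor>\<alpha>\<rfloor> + 1)" "\<alpha> < real s" "real s \<le> \<alpha> + 1"
    using order_of_radial_derivative[OF \<alpha>] by blast
  have fh: "f \<in> holo_ball" using f by (simp add: lipschitz_space_def)
  note fl = holo_ball_line_holomorphic[OF fh]
  obtain A where A: "0 < A" "\<And>q r. q \<in> finite_exponents p \<Longrightarrow> 0 \<le> r \<Longrightarrow> r < 1 \<Longrightarrow>
     mean_le q r (radial_deriv (real s) f) (A * (1 - r\<^sup>2) powr (\<alpha> - real s))"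
    using f lipschitz_space_iff[OF fh p s(1)] by blast
  obtain B where B: "0 \<le> B"
    "\<And>q r. 1 \<le> q \<Longrightarrow> (\<And>r. 0 \<le> r \<Longrightarrow> r < 1 \<Longrightarrow> mean_le q r (radial_deriv (real s) f) (A * (1 - r\<^sup>2) powr (\<alpha> - real s)))
       \<Longrightarrow> 0 \<le> r \<Longrightarrow> r < 1 \<Longrightarrow> mean_le q r f B"
    using mean_le_if_radial_deriv_bound[OF fl \<alpha> s(2,3) A(1)] by blast
  have "hardy_norm p f \<le> ennreal B"
    unfolding hardy_norm_le_iff[OF line_holomorphicD(1)[OF fl] p B(1)]
    using B(2) finite_exponents_ge_1[OF p] A(2) by auto
  also have "\<dots> < \<infinity>" by simp
  finally show "f \<in> hardy_space p" using fh by (simp add: hardy_space_def)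
qed

theorem theorem1p3:
  fixes n :: nat and p :: ennreal and \<alpha> :: real
  assumes "n \<ge> 1" and "1 \<le> p" and "0 < \<alpha>" and "\<alpha> < real n"
  shows "(lipschitz_space p \<alpha> :: (complex ^ 'N \<Rightarrow> complex) set) \<subseteq> hardy_space p \<and>
    (\<forall>f \<in> (hardy_space p :: (complex ^ 'N \<Rightarrow> complex) set).
       (f \<in> lipschitz_space p \<alpha> \<longleftrightarrow> power_bound \<alpha> (\<lambda>t. hardy_norm p (rot_diff n t f))) \<and>
       (f \<in> lipschitz_space p \<alpha> \<longleftrightarrow> power_bound \<alpha> (\<lambda>\<delta>. modulus_minus n \<delta> f p)) \<and>
       (f \<in> lipschitz_space p \<alpha> \<longleftrightarrow> power_bound \<alpha> (\<lambda>\<delta>. modulus n \<delta> f p)) \<and>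
       (f \<in> lipschitz_space p \<alpha> \<longleftrightarrow> power_bound \<alpha> (\<lambda>\<delta>. modulus_plus n \<delta> f p)))"
proof (intro conjI ballI)
  show "(lipschitz_space p \<alpha> :: (complex ^ 'N \<Rightarrow> complex) set) \<subseteq> hardy_space p"
    by (rule lipschitz_space_subset_hardy_space[OF assms(2,3)])
  fix f :: "complex ^ 'N \<Rightarrow> complex" assume f: "f \<in> hardy_space p"
  let ?R = "f \<in> lipschitz_space p \<alpha>"
  have 1: "power_bound \<alpha> (\<lambda>\<delta>. modulus_plus n \<delta> f p)" if ?R
    by (rule modulus_plus_power_bound_if_lipschitz[OF that assms])
  have 2: "power_bound \<alpha> (\<lambda>\<delta>. modulus n \<delta> f p)" if "power_bound \<alpha> (\<lambda>\<delta>. modulus_plus n \<delta> f p)"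
    by (rule power_bound_mono[OF that modulus_le_modulus_plus])
  have 3: "power_bound \<alpha> (\<lambda>\<delta>. modulus_minus n \<delta> f p)" if "power_bound \<alpha> (\<lambda>\<delta>. modulus n \<delta> f p)"
    by (rule power_bound_mono[OF that modulus_minus_le_modulus])
  have 4: "power_bound \<alpha> (\<lambda>t. hardy_norm p (rot_diff n t f))" if "power_bound \<alpha> (\<lambda>\<delta>. modulus_minus n \<delta> f p)"
    by (rule rot_diff_power_bound_if_modulus_minus[OF that assms(3)])
  have 5: ?R if "power_bound \<alpha> (\<lambda>t. hardy_norm p (rot_diff n t f))"
    by (rule lipschitz_if_rot_diff_power_bound[OF f assms(1-3) that])
  show "?R \<longleftrightarrow> power_bound \<alpha> (\<lambda>t. hardy_norm p (rot_diff n t f))" using 1 2 3 4 5 by blast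
  show "?R \<longleftrightarrow> power_bound \<alpha> (\<lambda>\<delta>. modulus_minus n \<delta> f p)" using 1 2 3 4 5 by blast
  show "?R \<longleftrightarrow> power_bound \<alpha> (\<lambda>\<delta>. modulus n \<delta> f p)" using 1 2 3 4 5 by blast
  show "?R \<longleftrightarrow> power_bound \<alpha> (\<lambda>\<delta>. modulus_plus n \<delta> f p)" using 1 2 3 4 5 by blast
qed

end
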